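(* Let $\mathcal{K}\subset\mathbb{R}^n$ ($n\ge 2$) be a nonempty closed set and let $f_1,\ldots,f_m$ be vector fields on $\mathbb{R}^n$ of class $C^\infty$ satisfying Hörmander's condition $\mathrm{Lie}_{\{f_1,\ldots,f_m\}}(x)=\mathbb{R}^n$ for every $x\in\mathbb{R}^n$. Suppose that, given $x_0\in\mathbb{R}^n\setminus\mathcal{K}$, there exist $\varepsilon>0$ and a closed set $N$ of measure zero such that $$B_\varepsilon(x_0)\cap E(\tau)\subset N\qquad\forall\,\tau>0,$$ where $E(\tau)$ is the set of characteristic points at time $\tau$. Then the minimum time function $\mathcal{T}_{\mathcal{K}}$ satisfies $$\operatorname{sing\,supp}_{Lip}\mathcal{T}_{\mathcal{K}}\cap B_\varepsilon(x_0)\subset N.$$ In particular, $\operatorname{sing\,supp}_{Lip}\mathcal{T}_{\mathcal{K}}\cap B_\varepsilon(x_0)$ is a set of measure zero.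
   Context: Control system: $y'(t)=f(y(t))u(t)=\sum_{i=1}^m u_i(t)f_i(y(t))$ for a.e. $t\ge 0$, where the controls are the Lebesgue measurable maps $u:[0,+\infty[\to\bar B^m_1(0)$ and $\bar B_1^m(0)$ is the closed unit ball of $\mathbb{R}^m$. The vector fields are not assumed to be linearly independent nor to have sublinear growth. For $x\in\mathbb{R}^n$ and a control $u$, $y_{x,u}$ denotes the solution with $y_{x,u}(0)=x$. The minimum time function with target $\mathcal{K}$ is the function $\mathcal{T}_{\mathcal{K}}:\mathbb{R}^n\to[0,+\infty]$, $\mathcal{T}_{\mathcal{K}}(x)=\inf\{t\ge 0 : y_{x,u}(t)\in\mathcal{K}\text{ for some control }u\}$; under Hörmander's condition it is finite everywhere. For $\tau>0$ the reachable set is $\mathcal{R}(\tau)=\{x\in\mathbb{R}^n : \mathcal{T}_{\mathcal{K}}(x)\le\tau\}$. $B_\varepsilon(x_0)$ is the open Euclidean ball of center $x_0$ and radius $\varepsilon$. Commutators: $[f,g](x)=Dg(x)(f(x))-Df(x)(g(x))$. $\mathrm{Lie}_{\{f_1,\ldots,f_m\}}$ is the Lie algebra generated by $f_1,\dots,f_m$ and all their iterated commutators, and $\mathrm{Lie}_{\{f_1,\ldots,f_m\}}(x)=\{g(x): g\in \mathrm{Lie}_{\{f_1,\ldots,f_m\}}\}$. Normal cones: for a closed set $C\subset\mathbb{R}^n$ and $x\in C$, the proximal normal cone is $N^P_C(x)=\{p\in\mathbb{R}^n : \exists\,\sigma\ge 0,\ p\cdot(y-x)\le\sigma|y-x|^2\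 \forall y\in C\}$, and the limiting normal cone is $N^L_C(x)=\{p\in\mathbb{R}^n : \exists\, x_h\in C,\ x_h\to x,\ \exists\, p_h\in N^P_C(x_h),\ p_h\to p\}$. Hamiltonian: $H(x,p)=\big(\sum_{i=1}^m (f_i(x)\cdot p)^2\big)^{1/2}$. Characteristic points: for $\tau>0$, $E(\tau)$ is the set of $x\in\mathbb{R}^n\setminus\mathcal{K}$ such that $\mathcal{T}_{\mathcal{K}}(x)=\tau$ and there is $\eta\in N^L_{\mathcal{R}(\tau)}(x)\setminus\{0\}$ with $H(x,\eta)=0$. For a real-valued function $g$ on an open set $\Omega\subset\mathbb{R}^n$, the Lipschitz singular support $\operatorname{sing\,supp}_{Lip} g$ is the smallest closed subset of $\Omega$ such that $g$ is locally Lipschitz outside it; in other words, if $x\in\Omega$ is not in it, then $g$ is Lipschitz continuous on some open set containing $x$.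
   Formalization: The Lipschitz singular support is taken in the open set R^n \ K, so points of K in the ball are not covered; with all of R^n the claim fails when the ball meets K (Heisenberg fields, K={0}, N empty: T is not Lipschitz at 0). *)

theory Defs
  imports "HOL-Analysis.Analysis"
begin

type_synonym 'n vector_field = "real ^ 'n \<Rightarrow> real ^ 'n"

(* In finite dimension the Frechet derivative map is C^k iff all directional
   derivatives are C^k. *)
fun C_k :: "nat \<Rightarrow> ('a::euclidean_space \<Rightarrow> 'b::real_normed_vector) \<Rightarrow> bool" where
  "C_k 0 g \<longleftrightarrow> continuous_on UNIV g"
| "C_k (Suc k) g \<longleftrightarrow>
     (\<forall>x. g differentiable (at x)) \<and>
     (\<forall>v. C_k k (\<lambda>x. frechet_derivative g (at x) v))"

definition C_infinity :: "('a::euclidean_space \<Rightarrow> 'b::real_normed_vector) \<Rightarrow> bool" where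
  "C_infinity g \<longleftrightarrow> (\<forall>k. C_k k g)"

definition lie_bracket :: "('n::finite) vector_field \<Rightarrow> 'n vector_field \<Rightarrow> 'n vector_field" where
  "lie_bracket f g =
     (\<lambda>x. frechet_derivative g (at x) (f x) - frechet_derivative f (at x) (g x))"

inductive_set lie_algebra :: "('m \<Rightarrow> ('n::finite) vector_field) \<Rightarrow> 'n vector_field set"
  for f :: "'m \<Rightarrow> ('n::finite) vector_field" where
  generator: "f i \<in> lie_algebra f"
| add: "g \<in> lie_algebra f \<Longrightarrow> h \<in> lie_algebra f \<Longrightarrow> (\<lambda>x. g x + h x) \<in> lie_algebra f"
| scale: "g \<in> lie_algebra f \<Longrightarrow> (\<lambda>x. c *\<^sub>R g x) \<in> lie_algebra f"
| bracket: "g \<in> lie_algebra f \<Longrightarrow> h \<in> lie_algebra f \<Longrightarrow> lie_bracket g h \<in> lie_algebra f"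

definition lie_algebra_at :: "('m \<Rightarrow> ('n::finite) vector_field) \<Rightarrow> real ^ 'n \<Rightarrow> (real ^ 'n) set" where
  "lie_algebra_at f x = (\<lambda>g. g x) ` lie_algebra f"

definition hoermander_condition :: "('m \<Rightarrow> ('n::finite) vector_field) \<Rightarrow> bool" where
  "hoermander_condition f \<longleftrightarrow> (\<forall>x. lie_algebra_at f x = UNIV)"

definition controls :: "(real \<Rightarrow> real ^ ('m::finite)) set" where
  "controls = {u. u \<in> borel_measurable (lebesgue_on {0..}) \<and> (\<forall>t\<ge>0. u t \<in> cball 0 1)}"

definition abs_continuous_on_interval :: "real \<Rightarrow> real \<Rightarrow> (real \<Rightarrow> 'a::metric_space) \<Rightarrow> bool" where
  "abs_continuous_on_interval a b y \<longleftrightarrow>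
     (\<forall>\<epsilon>>0. \<exists>\<delta>>0. \<forall>(k::nat) l r.
        (\<forall>i<k. a \<le> l i \<and> l i \<le> r i \<and> r i \<le> b) \<and>
        disjoint_family_on (\<lambda>i. {l i<..<r i}) {..<k} \<and>
        (\<Sum>i<k. r i - l i) < \<delta> \<longrightarrow>
        (\<Sum>i<k. dist (y (l i)) (y (r i))) < \<epsilon>)"

(* Solutions are absolutely continuous (Caratheodory). Without a growth assumption the
   solution for x and u may explode in finite time, so it is only required to exist on [0,t]. *)
definition solution_on ::
  "('m::finite \<Rightarrow> ('n::finite) vector_field) \<Rightarrow> real ^ 'n \<Rightarrow> (real \<Rightarrow> real ^ 'm) \<Rightarrow> real \<Rightarrow>
   (real \<Rightarrow> real ^ 'n) \<Rightarrow> bool" where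
  "solution_on f x u t y \<longleftrightarrow>
     y 0 = x \<and> abs_continuous_on_interval 0 t y \<and>
     (AE s in lebesgue_on {0..t}.
        (y has_vector_derivative (\<Sum>i\<in>UNIV. (u s $ i) *\<^sub>R f i (y s))) (at s within {0..t}))"

definition minimum_time ::
  "(real ^ 'n) set \<Rightarrow> ('m::finite \<Rightarrow> ('n::finite) vector_field) \<Rightarrow> real ^ 'n \<Rightarrow> ennreal" where
  "minimum_time K f x =
     Inf {ennreal t | t. t \<ge> 0 \<and> (\<exists>u\<in>controls. \<exists>y. solution_on f x u t y \<and> y t \<in> K)}"

definition reachable_set ::
  "(real ^ 'n) set \<Rightarrow> ('m::finite \<Rightarrow> ('n::finite) vector_field) \<Rightarrow> real \<Rightarrow> (real ^ 'n) set" where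
  "reachable_set K f \<tau> = {x. minimum_time K f x \<le> ennreal \<tau>}"

definition proximal_normal_cone :: "'a::real_inner set \<Rightarrow> 'a \<Rightarrow> 'a set" where
  "proximal_normal_cone C x =
     {p. \<exists>\<sigma>\<ge>0. \<forall>y\<in>C. p \<bullet> (y - x) \<le> \<sigma> * (norm (y - x))\<^sup>2}"

definition limiting_normal_cone :: "'a::real_inner set \<Rightarrow> 'a \<Rightarrow> 'a set" where
  "limiting_normal_cone C x =
     {p. \<exists>X P. (\<forall>h::nat. X h \<in> C) \<and> X \<longlonglongrightarrow> x \<and>
               (\<forall>h. P h \<in> proximal_normal_cone C (X h)) \<and> P \<longlonglongrightarrow> p}"

definition hamiltonian ::
  "('m::finite \<Rightarrow> ('n::finite) vector_field) \<Rightarrow> real ^ 'n \<Rightarrow> real ^ 'n \<Rightarrow> real" where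
  "hamiltonian f x p = sqrt (\<Sum>i\<in>UNIV. (f i x \<bullet> p)\<^sup>2)"

definition characteristic_points ::
  "(real ^ 'n) set \<Rightarrow> ('m::finite \<Rightarrow> ('n::finite) vector_field) \<Rightarrow> real \<Rightarrow> (real ^ 'n) set" where
  "characteristic_points K f \<tau> =
     {x. x \<notin> K \<and> minimum_time K f x = ennreal \<tau> \<and>
         (\<exists>\<eta> \<in> limiting_normal_cone (reachable_set K f \<tau>) x - {0}. hamiltonian f x \<eta> = 0)}"

(* For extended-valued g, local Lipschitz continuity includes local finiteness, so the
   convention enn2real top = 0 cannot create spurious Lipschitz points. *)
definition locally_Lipschitz_on :: "'a::metric_space set \<Rightarrow> ('a \<Rightarrow> ennreal) \<Rightarrow> bool" where
  "locally_Lipschitz_on \<Omega> g \<longleftrightarrow>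
     (\<forall>x\<in>\<Omega>. \<exists>V L. open V \<and> x \<in> V \<and> V \<subseteq> \<Omega> \<and>
        (\<forall>z\<in>V. g z < top) \<and> L-lipschitz_on V (\<lambda>z. enn2real (g z)))"

(* For the minimum time function the relevant open set is \<Omega> = - K: even when no
   characteristic points exist, minimum_time K f can fail to be Lipschitz at points of K
   (Heisenberg fields with K = {0}). *)
definition sing_supp_Lip :: "'a::metric_space set \<Rightarrow> ('a \<Rightarrow> ennreal) \<Rightarrow> 'a set" where
  "sing_supp_Lip \<Omega> g =
     \<Inter>{S. closedin (top_of_set \<Omega>) S \<and> locally_Lipschitz_on (\<Omega> - S) g}"

(* The smallest such set exists. *)
lemma sing_supp_Lip_least:
  shows "closedin (top_of_set \<Omega>) (sing_supp_Lip \<Omega> g)"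
    and "locally_Lipschitz_on (\<Omega> - sing_supp_Lip \<Omega> g) g"
    and "closedin (top_of_set \<Omega>) S \<Longrightarrow> locally_Lipschitz_on (\<Omega> - S) g \<Longrightarrow> sing_supp_Lip \<Omega> g \<subseteq> S"
proof -
  let ?F = "{S. closedin (top_of_set \<Omega>) S \<and> locally_Lipschitz_on (\<Omega> - S) g}"
  have "\<Omega> \<in> ?F" by (simp add: locally_Lipschitz_on_def)
  then have "?F \<noteq> {}" by blast
  then show "closedin (top_of_set \<Omega>) (sing_supp_Lip \<Omega> g)"
    unfolding sing_supp_Lip_def by (intro closedin_Inter) auto
  show "locally_Lipschitz_on (\<Omega> - sing_supp_Lip \<Omega> g) g"
    unfolding locally_Lipschitz_on_def
  proof
    fix x assume "x \<in> \<Omega> - sing_supp_Lip \<Omega> g"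
    then obtain S where S: "S \<in> ?F" "x \<in> \<Omega> - S"
      unfolding sing_supp_Lip_def by blast
    then have "sing_supp_Lip \<Omega> g \<subseteq> S"
      unfolding sing_supp_Lip_def by blast
    moreover obtain V L where "open V" "x \<in> V" "V \<subseteq> \<Omega> - S"
        "\<forall>z\<in>V. g z < top" "L-lipschitz_on V (\<lambda>z. enn2real (g z))"
      using S unfolding locally_Lipschitz_on_def by blast
    ultimately show "\<exists>V L. open V \<and> x \<in> V \<and> V \<subseteq> \<Omega> - sing_supp_Lip \<Omega> g \<and>
        (\<forall>z\<in>V. g z < top) \<and> L-lipschitz_on V (\<lambda>z. enn2real (g z))"
      by blast
  qed
  show "sing_supp_Lip \<Omega> g \<subseteq> S" if "closedin (top_of_set \<Omega>) S" "locally_Lipschitz_on (\<Omega> - S) g"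
    using that unfolding sing_supp_Lip_def by blast
qed

end

theory Submission
  imports Defs
begin

text \<open>
  By Hoermander's condition the minimum time function \<open>T\<close> is finite and continuous. If \<open>T\<close> is not
  Lipschitz near \<open>x\<close>, there are proximal subgradients \<open>\<zeta>\<close> of \<open>T\<close> with \<open>norm \<zeta> \<rightarrow> \<infinity>\<close> at
  points near \<open>x\<close>. Following a nearly optimal trajectory from such a point down to one fixed level
  \<open>\<tau>' < T x\<close> close to \<open>T x\<close>, the adjoint equation carries \<open>\<zeta>\<close> to an almost-subgradient \<open>p\<close> of
  comparable norm. The dynamic programming inequality bounds \<open>\<bar>f i \<bullet> p\<bar>\<close> by a constant, and \<open>p\<close> is
  close to a proximal normal of the sublevel set \<open>{T \<le> \<tau>'}\<close>. Normalising and passing to the limit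
  gives a characteristic point on the level \<open>\<tau>'\<close> near \<open>x\<close>. Working with a common level below
  \<open>T x\<close> is what makes the limit a normal to a single sublevel set, and it is why \<open>N\<close> has to be
  closed.

  Continuity of \<open>T\<close> is the Chow--Rashevskii theorem. Compositions of flows are compared through their
  asymptotic expansions \<open>g (\<phi> \<tau> y) \<sim> (\<Sum>j. \<tau>^j A\<^sub>j g y)\<close> for all smooth \<open>g\<close>, which compose formally
  like power series of operators, so that no regularity of the flows beyond continuity is used; a
  commutator of families of orders \<open>k\<close> and \<open>l\<close> has order \<open>k + l\<close> with the Lie bracket as leading
  term. Products of such families, reparametrised by roots, form a continuous map
  that has the identity as derivative at the origin and hence is open there.
\<close>

section \<open>Smooth maps\<close>

text \<open>Without growth bounds on the fields optimal trajectories need not exist, so a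
  subgradient is transported along a trajectory that is optimal only up to an error
  \<open>e\<close>, and what arrives is a subgradient inequality with defect \<open>e\<close>. The
  defect is harmless because of the order of the choices: the quadratic coefficient and the radius
  come with the given subgradient, the time step of the Hamiltonian bound is fixed next, and
  \<open>e\<close> is chosen last. Maximising a penalised linear form over the sublevel set
  (\<open>level_set_proximal_normal\<close>) then yields an exact proximal normal at distance at
  most 1 from \<open>p\<close>, whatever the size of \<open>p\<close>; after division by norm
  \<zeta> this distance disappears. The system has no drift and the control ball is symmetric, so
  trajectories can be reversed. This makes \<open>reach\<close> symmetric, which turns local
  reachability into continuity of T, and it provides competitors that end at a prescribed point.
  Local estimates are needed only for times with L * t \<le> 1 / 4, where an absorption argument
  replaces exponential bounds.\<close>

lemma C_k_continuous: "C_k k g \<Longrightarrow> continuous_on UNIV g"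
  by (cases k) (auto intro!: differentiable_imp_continuous_on simp: differentiable_on_def)

lemma C_k_Suc_imp: "C_k (Suc k) g \<Longrightarrow> C_k k g"
proof (induction k arbitrary: g)
  case 0
  then show ?case by (auto intro!: differentiable_imp_continuous_on simp: differentiable_on_def)
next
  case (Suc k)
  then show ?case by (metis C_k.simps(2))
qed

lemma C_infinity_differentiable: "C_infinity g \<Longrightarrow> g differentiable (at x)"
  unfolding C_infinity_def by (metis C_k.simps(2))

lemma C_infinity_has_derivative:
  "C_infinity g \<Longrightarrow> (g has_derivative frechet_derivative g (at x)) (at x)"
  using C_infinity_differentiable frechet_derivative_works by blast

lemma C_infinity_continuous: "C_infinity g \<Longrightarrow> continuous_on S g"
  unfolding C_infinity_def using C_k_continuous continuous_on_subset by blast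

lemma C_infinity_directional: "C_infinity g \<Longrightarrow> C_infinity (\<lambda>x. frechet_derivative g (at x) v)"
  unfolding C_infinity_def by (metis C_k.simps(2))

lemma C_infinity_const: "C_infinity (\<lambda>x::'a::euclidean_space. c :: 'b::real_normed_vector)"
proof -
  have "C_k k (\<lambda>x::'a. c)" for k and c :: 'b
    by (induction k arbitrary: c) auto
  then show ?thesis by (simp add: C_infinity_def)
qed

lemma C_infinity_bounded_linear:
  fixes L :: "'a::euclidean_space \<Rightarrow> 'b::real_normed_vector"
  assumes "bounded_linear L" shows "C_infinity L"
proof -
  have fd: "frechet_derivative L (at x) = L" for x
    by (intro frechet_derivative_at[symmetric] bounded_linear_imp_has_derivative assms)
  have "C_k k (\<lambda>x::'a. c)" for k and c :: 'b
    using C_infinity_const C_infinity_def by blast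
  moreover have "continuous_on UNIV L" "\<forall>x. L differentiable (at x)"
    using assms bounded_linear_imp_differentiable linear_continuous_on by blast+
  ultimately have "C_k k L" for k
    by (cases k) (auto simp: fd)
  then show ?thesis by (simp add: C_infinity_def)
qed

lemma C_k_compose_linear:
  assumes "bounded_linear L" shows "C_k k g \<Longrightarrow> C_k k (\<lambda>x. L (g x))"
proof (induction k arbitrary: g)
  case 0
  then show ?case using assms by (simp add: bounded_linear.continuous_on)
next
  case (Suc k)
  have d: "((\<lambda>x. L (g x)) has_derivative (\<lambda>h. L (frechet_derivative g (at x) h))) (at x)" for x
    using Suc.prems by (intro bounded_linear.has_derivative[OF assms]) (simp add: frechet_derivative_works[symmetric])
  have fd: "frechet_derivative (\<lambda>x. L (g x)) (at x) = (\<lambda>h. L (frechet_derivative g (at x) h))" for x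
    by (rule frechet_derivative_at[symmetric, OF d])
  show ?case using Suc d by (auto simp: fd differentiable_def)
qed

lemma C_infinity_compose_linear:
  "bounded_linear L \<Longrightarrow> C_infinity g \<Longrightarrow> C_infinity (\<lambda>x. L (g x))"
  unfolding C_infinity_def using C_k_compose_linear by blast

lemma C_k_add: "C_k k g \<Longrightarrow> C_k k h \<Longrightarrow> C_k k (\<lambda>x. g x + h x)"
proof (induction k arbitrary: g h)
  case 0
  then show ?case by (simp add: continuous_on_add)
next
  case (Suc k)
  have d: "((\<lambda>x. g x + h x) has_derivative (\<lambda>v. frechet_derivative g (at x) v + frechet_derivative h (at x) v)) (at x)" for x
    using Suc.prems by (intro has_derivative_add) (simp_all add: frechet_derivative_works[symmetric])
  have fd: "frechet_derivative (\<lambda>x. g x + h x) (at x) = (\<lambda>v. frechet_derivative g (at x) v + frechet_derivative h (at x) v)" for x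
    by (rule frechet_derivative_at[symmetric, OF d])
  show ?case using Suc d by (auto simp: fd differentiable_def)
qed

lemma C_infinity_add: "C_infinity g \<Longrightarrow> C_infinity h \<Longrightarrow> C_infinity (\<lambda>x. g x + h x)"
  unfolding C_infinity_def using C_k_add by blast

lemma C_infinity_scaleR_left: "C_infinity g \<Longrightarrow> C_infinity (\<lambda>x. c *\<^sub>R g x)"
  by (rule C_infinity_compose_linear[OF bounded_linear_scaleR_right])

lemma C_infinity_minus: "C_infinity g \<Longrightarrow> C_infinity (\<lambda>x. - g x)"
  by (rule C_infinity_compose_linear[OF bounded_linear_minus[OF bounded_linear_ident]])

lemma C_infinity_diff: "C_infinity g \<Longrightarrow> C_infinity h \<Longrightarrow> C_infinity (\<lambda>x. g x - h x)"
  using C_infinity_add[OF _ C_infinity_minus, of g h] by simp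

lemma C_infinity_sum:
  "(\<And>i. i \<in> I \<Longrightarrow> C_infinity (g i)) \<Longrightarrow> C_infinity (\<lambda>x. \<Sum>i\<in>I. g i x)"
  by (induction I rule: infinite_finite_induct) (auto simp: C_infinity_const C_infinity_add)

lemma C_k_scaleR:
  fixes a :: "'a::euclidean_space \<Rightarrow> real"
  shows "C_k k a \<Longrightarrow> C_k k g \<Longrightarrow> C_k k (\<lambda>x. a x *\<^sub>R g x)"
proof (induction k arbitrary: a g)
  case 0
  then show ?case by (simp add: continuous_on_scaleR)
next
  case (Suc k)
  have d: "((\<lambda>x. a x *\<^sub>R g x) has_derivative
      (\<lambda>v. a x *\<^sub>R frechet_derivative g (at x) v + frechet_derivative a (at x) v *\<^sub>R g x)) (at x)" for x
    using Suc.prems by (intro has_derivative_scaleR) (simp_all add: frechet_derivative_works[symmetric])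
  have fd: "frechet_derivative (\<lambda>x. a x *\<^sub>R g x) (at x) =
      (\<lambda>v. a x *\<^sub>R frechet_derivative g (at x) v + frechet_derivative a (at x) v *\<^sub>R g x)" for x
    by (rule frechet_derivative_at[symmetric, OF d])
  have "C_k k a" "C_k k g" using Suc.prems C_k_Suc_imp by blast+
  then show ?case using Suc d by (auto simp: fd differentiable_def intro!: C_k_add)
qed

lemma C_infinity_scaleR:
  fixes a :: "'a::euclidean_space \<Rightarrow> real"
  shows "C_infinity a \<Longrightarrow> C_infinity g \<Longrightarrow> C_infinity (\<lambda>x. a x *\<^sub>R g x)"
  unfolding C_infinity_def using C_k_scaleR by blast

lemma linear_basis_expansion:
  fixes L :: "'a::euclidean_space \<Rightarrow> 'b::real_normed_vector"
  assumes "bounded_linear L"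
  shows "L v = (\<Sum>b\<in>Basis. (v \<bullet> b) *\<^sub>R L b)"
proof -
  interpret L: bounded_linear L by fact
  have "L v = L (\<Sum>b\<in>Basis. (v \<bullet> b) *\<^sub>R b)" by (simp add: euclidean_representation)
  then show ?thesis by (simp add: L.sum L.scaleR)
qed

lemma bounded_linear_frechet_derivative:
  "C_infinity g \<Longrightarrow> bounded_linear (frechet_derivative g (at x))"
  using C_infinity_has_derivative has_derivative_bounded_linear by blast

section \<open>Lie derivatives and bounds on compact sets\<close>

definition lie_derivative :: "('a \<Rightarrow> 'a) \<Rightarrow> ('a::euclidean_space \<Rightarrow> 'b::real_normed_vector) \<Rightarrow> 'a \<Rightarrow> 'b"
  where "lie_derivative X g = (\<lambda>x. frechet_derivative g (at x) (X x))"

text \<open>\<open>C_k\<close> speaks only of derivatives in a fixed direction, whereas the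
  direction \<open>X x\<close> varies. The basis expansion gives a finite sum of smooth scalar
  factors times fixed directional derivatives.\<close>

lemma C_infinity_lie_derivative:
  assumes "C_infinity X" "C_infinity g"
  shows "C_infinity (lie_derivative X g)"
proof -
  have "lie_derivative X g = (\<lambda>x. \<Sum>b\<in>Basis. (X x \<bullet> b) *\<^sub>R frechet_derivative g (at x) b)"
    unfolding lie_derivative_def
    by (rule ext) (rule linear_basis_expansion[OF bounded_linear_frechet_derivative[OF assms(2)]])
  moreover have "C_infinity (\<lambda>x. X x \<bullet> b)" for b
    by (rule C_infinity_compose_linear[OF bounded_linear_inner_left assms(1)])
  ultimately show ?thesis
    using assms by (auto intro!: C_infinity_sum C_infinity_scaleR C_infinity_directional)
qed

lemma C_infinity_bounded_on_compact:
  assumes "C_infinity g" "compact S"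
  obtains C where "C > 0" "\<And>x. x \<in> S \<Longrightarrow> norm (g x) \<le> C"
proof -
  have "bounded (g ` S)"
    by (intro compact_imp_bounded compact_continuous_image C_infinity_continuous assms)
  then show ?thesis using that bounded_pos by (metis imageI)
qed

lemma C_infinity_derivative_bound:
  fixes g :: "'a::euclidean_space \<Rightarrow> 'b::real_normed_vector"
  assumes "C_infinity g" "compact S"
  obtains C where "C > 0" "\<And>x v. x \<in> S \<Longrightarrow> norm (frechet_derivative g (at x) v) \<le> C * norm v"
proof -
  have "\<exists>C>0. \<forall>x\<in>S. norm (frechet_derivative g (at x) b) \<le> C" for b
    by (rule C_infinity_bounded_on_compact[OF C_infinity_directional[OF assms(1)] assms(2), of b]) blast
  then obtain C where C: "\<And>b. C b > 0" "\<And>b x. x \<in> S \<Longrightarrow> norm (frechet_derivative g (at x) b) \<le> C b"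
    by metis
  have "norm (frechet_derivative g (at x) v) \<le> (\<Sum>b\<in>Basis. C b) * norm v" if "x \<in> S" for x v
  proof -
    have "norm (frechet_derivative g (at x) v) \<le> (\<Sum>b\<in>Basis. norm ((v \<bullet> b) *\<^sub>R frechet_derivative g (at x) b))"
      by (subst linear_basis_expansion[OF bounded_linear_frechet_derivative[OF assms(1)]]) (rule norm_sum)
    also have "\<dots> \<le> (\<Sum>b\<in>Basis. C b * norm v)"
    proof (rule sum_mono)
      fix b :: 'a assume "b \<in> Basis"
      then show "norm ((v \<bullet> b) *\<^sub>R frechet_derivative g (at x) b) \<le> C b * norm v"
        using mult_mono[OF C(2)[OF that, of b] Basis_le_norm[of b v]] less_imp_le[OF C(1)[of b]]
        by (simp add: mult.commute)
    qed
    finally show ?thesis by (simp add: sum_distrib_right)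
  qed
  moreover have "(\<Sum>b\<in>Basis. C b) > 0" using C(1) by (intro sum_pos) auto
  ultimately show ?thesis using that by blast
qed

lemma C_infinity_lipschitz_on_cball:
  fixes g :: "'a::euclidean_space \<Rightarrow> 'b::real_normed_vector"
  assumes "C_infinity g"
  obtains C where "C > 0" "\<And>x y. x \<in> cball c R \<Longrightarrow> y \<in> cball c R \<Longrightarrow> norm (g x - g y) \<le> C * norm (x - y)"
proof -
  obtain C where C: "C > 0" "\<And>x v. x \<in> cball c R \<Longrightarrow> norm (frechet_derivative g (at x) v) \<le> C * norm v"
    using C_infinity_derivative_bound[OF assms compact_cball] by blast
  have "norm (g x - g y) \<le> C * norm (x - y)" if "x \<in> cball c R" "y \<in> cball c R" for x y
  proof (rule differentiable_bound[OF convex_cball _ _ that, of _ "\<lambda>x. frechet_derivative g (at x)"])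
    fix x assume "x \<in> cball c R"
    then show "onorm (frechet_derivative g (at x)) \<le> C"
      using C by (intro onorm_bound) auto
  qed (rule has_derivative_at_withinI[OF C_infinity_has_derivative[OF assms]])
  then show ?thesis using C(1) that by blast
qed

text \<open>Mean value inequality for \<open>g\<close> minus its linear part at \<open>y\<close>, on
  the segment from \<open>x\<close> to \<open>y\<close>: the derivative of that difference has norm
  at most K * norm (x - y) there, because the derivative of \<open>g\<close> is Lipschitz on the
  ball.\<close>

lemma C_infinity_taylor2:
  fixes g :: "'a::euclidean_space \<Rightarrow> 'b::real_normed_vector"
  assumes "C_infinity g"
  obtains C where "C > 0" "\<And>x y. x \<in> cball c R \<Longrightarrow> y \<in> cball c R \<Longrightarrow>
     norm (g x - g y - frechet_derivative g (at y) (x - y)) \<le> C * (norm (x - y))\<^sup>2"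
proof -
  have "\<exists>C>0. \<forall>x\<in>cball c R. \<forall>y\<in>cball c R.
      norm (frechet_derivative g (at x) b - frechet_derivative g (at y) b) \<le> C * norm (x - y)" for b
    by (rule C_infinity_lipschitz_on_cball[OF C_infinity_directional[OF assms], of c R b]) blast
  then obtain C where C: "\<And>b. C b > 0" "\<And>b x y. x \<in> cball c R \<Longrightarrow> y \<in> cball c R \<Longrightarrow>
      norm (frechet_derivative g (at x) b - frechet_derivative g (at y) b) \<le> C b * norm (x - y)"
    using choice[of "\<lambda>b C. C > 0 \<and> (\<forall>x\<in>cball c R. \<forall>y\<in>cball c R.
      norm (frechet_derivative g (at x) b - frechet_derivative g (at y) b) \<le> C * norm (x - y))"] by blast
  define K where "K = (\<Sum>b\<in>Basis. C b)"
  have Kpos: "K > 0" unfolding K_def using C(1) by (intro sum_pos) auto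
  have K: "norm (frechet_derivative g (at x) v - frechet_derivative g (at y) v) \<le> (K * norm (x - y)) * norm v"
    if "x \<in> cball c R" "y \<in> cball c R" for x y v
  proof -
    have "bounded_linear (\<lambda>v. frechet_derivative g (at x) v - frechet_derivative g (at y) v)"
      by (intro bounded_linear_sub bounded_linear_frechet_derivative assms)
    then have eq: "frechet_derivative g (at x) v - frechet_derivative g (at y) v =
      (\<Sum>b\<in>Basis. (v \<bullet> b) *\<^sub>R (frechet_derivative g (at x) b - frechet_derivative g (at y) b))"
      by (rule linear_basis_expansion)
    have "norm (frechet_derivative g (at x) v - frechet_derivative g (at y) v) \<le>
      (\<Sum>b\<in>Basis. norm ((v \<bullet> b) *\<^sub>R (frechet_derivative g (at x) b - frechet_derivative g (at y) b)))"
      unfolding eq by (rule norm_sum)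
    also have "\<dots> \<le> (\<Sum>b\<in>Basis. (C b * norm (x - y)) * norm v)"
    proof (rule sum_mono)
      fix b :: 'a assume "b \<in> Basis"
      then show "norm ((v \<bullet> b) *\<^sub>R (frechet_derivative g (at x) b - frechet_derivative g (at y) b))
          \<le> (C b * norm (x - y)) * norm v"
        using mult_mono[OF C(2)[OF that, of b] Basis_le_norm[of b v]] less_imp_le[OF C(1)[of b]]
        by (simp add: mult.commute)
    qed
    finally show ?thesis by (simp add: K_def sum_distrib_right)
  qed
  have "norm (g x - g y - frechet_derivative g (at y) (x - y)) \<le> K * (norm (x - y))\<^sup>2"
    if xy: "x \<in> cball c R" "y \<in> cball c R" for x y
  proof -
    have seg: "closed_segment x y \<subseteq> cball c R"
      using xy by (simp add: closed_segment_subset)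
    define h where "h = (\<lambda>z. g z - frechet_derivative g (at y) z)"
    define h' where "h' = (\<lambda>z v. frechet_derivative g (at z) v - frechet_derivative g (at y) v)"
    have "(h has_derivative h' z) (at z within S)" for z S
      unfolding h_def h'_def
      by (rule has_derivative_diff)
         (rule has_derivative_at_withinI[OF C_infinity_has_derivative[OF assms]]
           bounded_linear_imp_has_derivative[OF bounded_linear_frechet_derivative[OF assms]])+
    moreover have "onorm (h' z) \<le> K * norm (x - y)" if z: "z \<in> closed_segment x y" for z
    proof (rule onorm_bound)
      have "norm (z - y) \<le> norm (x - y)"
        using z segment_bound[of z y x] by (simp add: closed_segment_commute norm_minus_commute)
      then have "(K * norm (z - y)) * norm v \<le> (K * norm (x - y)) * norm v" for v
        using Kpos by (intro mult_right_mono mult_left_mono) auto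
      moreover have "z \<in> cball c R" using z seg by blast
      ultimately show "norm (h' z v) \<le> K * norm (x - y) * norm v" for v
        unfolding h'_def using K[of z y v] xy order_trans by blast
    qed (use Kpos in simp)
    ultimately have "norm (h x - h y) \<le> (K * norm (x - y)) * norm (x - y)"
      using differentiable_bound[OF convex_closed_segment[of x y], of h h' "K * norm (x - y)" x y] by simp
    moreover have "linear (frechet_derivative g (at y))"
      using bounded_linear_frechet_derivative[OF assms] bounded_linear.linear by blast
    ultimately show ?thesis by (simp add: h_def linear_diff power2_eq_square algebra_simps)
  qed
  then show ?thesis using that Kpos by blast
qed

section \<open>Calculus for absolutely continuous functions\<close>

lemma abs_continuous_on_intervalE:
  assumes "abs_continuous_on_interval a b y" "e > 0"
  obtains \<delta> where "\<delta> > 0" "\<And>(k::nat) l r. (\<forall>i<k. a \<le> l i \<and> l i \<le> r i \<and> r i \<le> b) \<Longrightarrow>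
    disjoint_family_on (\<lambda>i. {l i<..<r i}) {..<k} \<Longrightarrow> (\<Sum>i<k. r i - l i) < \<delta> \<Longrightarrow>
    (\<Sum>i<k. dist (y (l i)) (y (r i))) < e"
proof -
  obtain \<delta> where "\<delta> > 0" and \<delta>: "\<forall>(k::nat) l r. (\<forall>i<k. a \<le> l i \<and> l i \<le> r i \<and> r i \<le> b) \<and>
      disjoint_family_on (\<lambda>i. {l i<..<r i}) {..<k} \<and> (\<Sum>i<k. r i - l i) < \<delta> \<longrightarrow>
      (\<Sum>i<k. dist (y (l i)) (y (r i))) < e"
    using assms unfolding abs_continuous_on_interval_def by blast
  show ?thesis
    by (rule that[OF \<open>\<delta> > 0\<close>], rule \<delta>[rule_format], intro conjI) blast+
qed

text \<open>The gauge integral makes a direct proof possible. At tags outside \<open>S\<close> the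
  derivative controls the increments. At tags in \<open>S\<close> the gauge is an open set
  \<open>U\<close> around \<open>S\<close> of measure below the \<delta> of absolute continuity, so
  the intervals with such tags have small total length and the increments of \<open>y\<close> over
  them add up to less than e / 2.\<close>

lemma fundamental_theorem_of_calculus_abs_continuous:
  fixes y :: "real \<Rightarrow> 'a::euclidean_space"
  assumes "a \<le> b" and ac: "abs_continuous_on_interval a b y" and neg: "negligible S"
    and deriv: "\<And>s. s \<in> {a..b} - S \<Longrightarrow> (y has_vector_derivative g s) (at s within {a..b})"
  shows "(g has_integral (y b - y a)) {a..b}"
proof -
  \<comment> \<open>With the value 0 on \<open>S\<close> the Riemann sum has no contribution from
    tags in \<open>S\<close>, where \<open>g\<close> is not controlled; the null set is put back at
    the end.\<close>
  define g0 where "g0 = (\<lambda>s. if s \<in> S then 0 else g s)"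
  have "(g0 has_integral (y b - y a)) {a..b}"
    unfolding has_integral_real
  proof (intro allI impI)
    fix e :: real assume "e > 0"
    \<comment> \<open>The tags outside \<open>S\<close> contribute at most e' * (b - a), which must
      stay below e / 2; the + 1 covers a = b.\<close>
    define e' where "e' = e / (2 * (b - a + 1))"
    have e': "e' > 0" "e' * (b - a) < e / 2"
      using \<open>e > 0\<close> \<open>a \<le> b\<close> by (auto simp: e'_def divide_simps)
    have "e / 2 > 0" using \<open>e > 0\<close> by simp
    obtain \<delta> where "\<delta> > 0" and \<delta>: "\<And>(k::nat) l r. (\<forall>i<k. a \<le> l i \<and> l i \<le> r i \<and> r i \<le> b) \<Longrightarrow>
        disjoint_family_on (\<lambda>i. {l i<..<r i}) {..<k} \<Longrightarrow> (\<Sum>i<k. r i - l i) < \<delta> \<Longrightarrow>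
        (\<Sum>i<k. dist (y (l i)) (y (r i))) < e / 2"
      by (rule abs_continuous_on_intervalE[OF ac \<open>e / 2 > 0\<close>]) (rule that)
    have "S \<in> sets lebesgue" "emeasure lebesgue S = 0"
      using neg by (auto simp: negligible_iff_null_sets)
    then obtain U where U: "open U" "S \<subseteq> U" "(U - S) \<in> lmeasurable" "emeasure lebesgue (U - S) < ennreal \<delta>"
      using sets_lebesgue_outer_open[OF _ \<open>\<delta> > 0\<close>] by metis
    have "emeasure lebesgue U \<le> emeasure lebesgue (U - S) + emeasure lebesgue S"
      using U \<open>S \<in> sets lebesgue\<close> emeasure_subadditive[of "U - S" lebesgue S]
      by (simp add: fmeasurableD Un_absorb1 Un_absorb2)
    then have U\<delta>: "emeasure lebesgue U < ennreal \<delta>"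
      using U \<open>emeasure lebesgue S = 0\<close> by simp
    then have Ufm: "U \<in> lmeasurable"
      using U(1) by (intro fmeasurableI) (auto simp: order_less_trans[OF _ ennreal_less_top])
    have mU: "measure lebesgue U < \<delta>"
      using U\<delta> Ufm by (simp add: emeasure_eq_measure2 ennreal_less_iff)
    have "\<exists>d>0. \<forall>z\<in>{a..b}. norm (z - s) < d \<longrightarrow> norm (y z - y s - (z - s) *\<^sub>R g s) \<le> e' * norm (z - s)"
      if "s \<in> {a..b} - S" for s
      using deriv[OF that] e'(1) unfolding has_vector_derivative_def has_derivative_within_alt by blast
    then obtain d where d: "\<And>s. s \<in> {a..b} - S \<Longrightarrow> d s > 0"
       "\<And>s z. s \<in> {a..b} - S \<Longrightarrow> z \<in> {a..b} \<Longrightarrow> norm (z - s) < d s \<Longrightarrow>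
          norm (y z - y s - (z - s) *\<^sub>R g s) \<le> e' * norm (z - s)" by metis
    define \<gamma> where "\<gamma> s = (if s \<in> S then U else if s \<in> {a..b} then ball s (d s) else ball s 1)" for s
    have "gauge \<gamma>"
      unfolding gauge_def \<gamma>_def using U d(1) by (auto split: if_splits)
    moreover have "norm (sum (\<lambda>(x,k). measure lborel k *\<^sub>R g0 x) p - (y b - y a)) < e"
      if p: "p tagged_division_of {a..b}" and fine: "\<gamma> fine p" for p
    proof -
      have "finite p" using p by blast
      have K: "x \<in> K \<and> K \<subseteq> \<gamma> x \<and> K = {Inf K..Sup K} \<and> a \<le> Inf K \<and> Inf K \<le> x \<and> x \<le> Sup K \<and> Sup K \<le> b"
        if xK: "(x, K) \<in> p" for x K
      proof -
        obtain u v where uv: "K = cbox u v" using p xK by blast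
        have "x \<in> K" "K \<subseteq> {a..b}" using p xK by blast+
        then show ?thesis using uv fine xK unfolding fine_def by fastforce
      qed
      let ?h = "\<lambda>(x,K). measure lborel K *\<^sub>R g0 x - (y (Sup K) - y (Inf K))"
      define pS where "pS = {q \<in> p. fst q \<in> S}"
      have pS: "finite pS" "pS \<subseteq> p" using \<open>finite p\<close> by (auto simp: pS_def)
      have sumeq: "sum (\<lambda>(x,k). measure lborel k *\<^sub>R g0 x) p - (y b - y a) = sum ?h p"
        using additive_tagged_division_1[OF \<open>a \<le> b\<close> p, of y]
        by (simp add: case_prod_unfold sum_subtractf)
      have "norm (sum ?h p) \<le> (\<Sum>q\<in>p. norm (?h q))" by (rule norm_sum)
      also have "\<dots> = (\<Sum>q\<in>p - pS. norm (?h q)) + (\<Sum>q\<in>pS. norm (?h q))"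
        using pS \<open>finite p\<close> by (simp add: sum.subset_diff)
      also have "(\<Sum>q\<in>p - pS. norm (?h q)) \<le> (\<Sum>q\<in>p - pS. e' * measure lborel (snd q))"
      proof (rule sum_mono)
        fix q assume q: "q \<in> p - pS"
        obtain x K where [simp]: "q = (x, K)" by force
        note k = K[of x K]
        have "x \<notin> S" "x \<in> {a..b}" using q k by (auto simp: pS_def)
        then have x: "x \<in> {a..b} - S" by simp
        have "K \<subseteq> ball x (d x)" using k q x by (auto simp: \<gamma>_def)
        moreover have "Inf K \<in> K" "Sup K \<in> K" using k q
          by (metis DiffD1 \<open>q = (x, K)\<close> atLeastAtMost_iff order_refl order_trans)+
        ultimately have "norm (Inf K - x) < d x" "norm (Sup K - x) < d x"
          by (metis dist_commute dist_norm mem_ball subsetD)+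
        then have "norm (y (Inf K) - y x - (Inf K - x) *\<^sub>R g x) \<le> e' * norm (Inf K - x)"
            "norm (y (Sup K) - y x - (Sup K - x) *\<^sub>R g x) \<le> e' * norm (Sup K - x)"
          using d(2)[OF x, of "Inf K"] d(2)[OF x, of "Sup K"] k q by auto
        then have "norm ((y (Inf K) - y x - (Inf K - x) *\<^sub>R g x) - (y (Sup K) - y x - (Sup K - x) *\<^sub>R g x))
           \<le> e' * norm (Inf K - x) + e' * norm (Sup K - x)"
          using norm_triangle_ineq4 order_trans add_mono by meson
        also have "\<dots> = e' * (Sup K - Inf K)"
          using k q by (auto simp: algebra_simps)
        also have "(y (Inf K) - y x - (Inf K - x) *\<^sub>R g x) - (y (Sup K) - y x - (Sup K - x) *\<^sub>R g x)
           = (Sup K - Inf K) *\<^sub>R g x - (y (Sup K) - y (Inf K))"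
          by (simp add: algebra_simps)
        finally have "norm ((Sup K - Inf K) *\<^sub>R g x - (y (Sup K) - y (Inf K))) \<le> e' * (Sup K - Inf K)" .
        moreover have "measure lborel K = Sup K - Inf K"
          using k q by (metis DiffD1 \<open>q = (x, K)\<close> content_real order_trans)
        ultimately show "norm (?h q) \<le> e' * measure lborel (snd q)"
          using x by (simp add: g0_def)
      qed
      also have "\<dots> \<le> (\<Sum>q\<in>p. e' * measure lborel (snd q))"
        using \<open>finite p\<close> e' by (intro sum_mono2) auto
      also have "\<dots> = e' * (b - a)"
        using additive_content_tagged_division[of p a b] p \<open>a \<le> b\<close>
        by (simp add: sum_distrib_left[symmetric] case_prod_unfold)
      also have "(\<Sum>q\<in>pS. norm (?h q)) < e / 2"
      proof -
        \<comment> \<open>Absolute continuity is stated for families indexed by numbers, so the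
          intervals with tags in \<open>S\<close> are enumerated.\<close>
        obtain \<phi> where \<phi>: "bij_betw \<phi> {..<card pS} pS"
          using ex_bij_betw_nat_finite[OF pS(1)] by (auto simp: atLeast0LessThan)
        define l where "l i = Inf (snd (\<phi> i))" for i
        define r where "r i = Sup (snd (\<phi> i))" for i
        have \<phi>p: "\<phi> i \<in> p" "fst (\<phi> i) \<in> S" if "i < card pS" for i
          using \<phi> that by (auto simp: bij_betw_def pS_def)
        have lr: "a \<le> l i \<and> l i \<le> r i \<and> r i \<le> b" "{l i..r i} \<subseteq> U" "snd (\<phi> i) = {l i..r i}" if "i < card pS" for i
          using K[of "fst (\<phi> i)" "snd (\<phi> i)"] \<phi>p[OF that] by (auto simp: l_def r_def \<gamma>_def)
        have disj: "disjoint_family_on (\<lambda>i. {l i<..<r i}) {..<card pS}"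
          unfolding disjoint_family_on_def
        proof (intro ballI impI)
          fix i j assume ij: "i \<in> {..<card pS}" "j \<in> {..<card pS}" "i \<noteq> j"
          then have "\<phi> i \<noteq> \<phi> j" using \<phi> by (auto simp: bij_betw_def inj_on_def)
          then have "interior (snd (\<phi> i)) \<inter> interior (snd (\<phi> j)) = {}"
            using tagged_division_ofD(5)[OF p, of "fst (\<phi> i)" "snd (\<phi> i)" "fst (\<phi> j)" "snd (\<phi> j)"] \<phi>p ij by simp
          then show "{l i<..<r i} \<inter> {l j<..<r j} = {}"
            using lr(3)[of i] lr(3)[of j] ij by (simp add: interior_atLeastAtMost_real)
        qed
        have "(\<Sum>i<card pS. r i - l i) = (\<Sum>i<card pS. measure lebesgue {l i<..<r i})"
          using lr by (intro sum.cong) auto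
        also have "\<dots> = measure lebesgue (\<Union>i<card pS. {l i<..<r i})"
          using lr by (intro measure_finite_Union[symmetric] disj) auto
        also have "\<dots> \<le> measure lebesgue U"
          using lr(2) Ufm by (intro measure_mono_fmeasurable) (auto intro!: sets.finite_UN, force)
        finally have "(\<Sum>i<card pS. r i - l i) < \<delta>" using mU by simp
        then have "(\<Sum>i<card pS. dist (y (l i)) (y (r i))) < e / 2"
          using \<delta>[of "card pS" l r] lr(1) disj by blast
        moreover have "(\<Sum>q\<in>pS. norm (?h q)) = (\<Sum>i<card pS. norm (?h (\<phi> i)))"
          by (rule sum.reindex_bij_betw[symmetric, OF \<phi>])
        moreover have "(\<Sum>i<card pS. norm (?h (\<phi> i))) = (\<Sum>i<card pS. dist (y (l i)) (y (r i)))"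
          using \<phi>p(2) by (intro sum.cong) (auto simp: case_prod_unfold g0_def l_def r_def dist_norm norm_minus_commute)
        ultimately show ?thesis by simp
      qed
      finally show ?thesis using e'(2) sumeq by simp
    qed
    ultimately show "\<exists>\<gamma>. gauge \<gamma> \<and> (\<forall>p. p tagged_division_of {a..b} \<and> \<gamma> fine p \<longrightarrow>
        norm (sum (\<lambda>(x,k). measure lborel k *\<^sub>R g0 x) p - (y b - y a)) < e)"
      by (intro exI[of _ \<gamma>] conjI allI impI) (assumption | elim conjE)+
  qed
  then show ?thesis
    by (rule has_integral_spike[OF neg, rotated]) (auto simp: g0_def)
qed

text \<open>Lebesgue differentiation for the gauge integral. Where differentiability fails there is
  some c = 1 / Suc n such that arbitrarily short intervals with endpoint \<open>x\<close> have an
  increment that differs from the linear one by more than \<open>c\<close> times their length. By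
  Henstock's lemma finitely many disjoint such intervals have small total length, and by Vitali's
  theorem disjoint ones cover almost all of the exceptional set, which is therefore null.\<close>

lemma indefinite_integral_has_vector_derivative_ae:
  fixes g :: "real \<Rightarrow> 'a::euclidean_space"
  assumes g: "g integrable_on {a..b}"
  obtains S where "negligible S"
    "\<And>s. s \<in> {a..b} - S \<Longrightarrow> ((\<lambda>r. integral {a..r} g) has_vector_derivative g s) (at s within {a..b})"
proof -
  define bad where "bad c x l r \<longleftrightarrow> l < r \<and> (x = l \<or> x = r) \<and> a \<le> l \<and> r \<le> b \<and>
      c * (r - l) < norm ((r - l) *\<^sub>R g x - integral {l..r} g)" for c x l r :: real
  define B where "B c = {x. \<forall>d>0. \<exists>l r. bad c x l r \<and> r - l < d}" for c
  have negB: "negligible (B c)" if "c > 0" for c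
    unfolding negligible_outer
  proof (intro allI impI)
    fix e :: real assume "e > 0"
    \<comment> \<open>On disjoint bad intervals Henstock's sum is at least \<open>c\<close> times
      the total length, so the bound c * e / 2 makes the total length at most e / 2.\<close>
    have "g integrable_on cbox a b" "c * e / 2 > 0" using g \<open>c > 0\<close> \<open>e > 0\<close> by auto
    then obtain \<gamma> where \<gamma>: "gauge \<gamma>" "\<And>p. p tagged_partial_division_of (cbox a b) \<Longrightarrow> \<gamma> fine p \<Longrightarrow>
        sum (\<lambda>(x,k). norm (measure lborel k *\<^sub>R g x - integral k g)) p < c * e / 2"
      by (rule Henstock_lemma) (rule that)
    define I where "I = {(x, l, r). bad c x l r \<and> {l..r} \<subseteq> \<gamma> x}"
    define m where "m = (\<lambda>(x::real, l, r). (l + r) / (2::real))"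
    define \<rho> where "\<rho> = (\<lambda>(x::real, l, r). (r - l) / (2::real))"
    have cb: "cball (m i) (\<rho> i) = {fst (snd i)..snd (snd i)}" for i
      unfolding m_def \<rho>_def cball_eq_atLeastAtMost by (auto simp: case_prod_unfold field_simps)
    have cov: "\<exists>i. i \<in> I \<and> x \<in> cball (m i) (\<rho> i) \<and> \<rho> i < d" if "x \<in> B c" "d > 0" for x d
    proof -
      obtain d' where d': "d' > 0" "ball x d' \<subseteq> \<gamma> x"
        using \<gamma>(1) unfolding gauge_def by (meson openE)
      then have "min d d' > 0" using \<open>d > 0\<close> by simp
      then obtain l r where lr: "bad c x l r" "r - l < min d d'"
        using \<open>x \<in> B c\<close> unfolding B_def by blast
      have "{l..r} \<subseteq> ball x d'" using lr by (auto simp: bad_def dist_real_def)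
      then have "(x, l, r) \<in> I" using lr d' by (auto simp: I_def)
      moreover have "x \<in> cball (m (x,l,r)) (\<rho> (x,l,r))"
        unfolding cb using lr by (auto simp: bad_def)
      moreover have "\<rho> (x,l,r) < d"
        using lr by (auto simp: bad_def \<rho>_def)
      ultimately show ?thesis by blast
    qed
    have pos: "0 < \<rho> i" if "i \<in> I" for i using that by (auto simp: I_def \<rho>_def bad_def)
    obtain C where C: "countable C" "C \<subseteq> I"
      "pairwise (\<lambda>i j. disjnt (cball (m i) (\<rho> i)) (cball (m j) (\<rho> j))) C"
      "negligible (B c - (\<Union>i\<in>C. cball (m i) (\<rho> i)))"
      by (rule Vitali_covering_theorem_cballs[of I \<rho> "B c" m, OF pos cov]) (assumption | rule that)+
    have bound: "measure lebesgue (\<Union>i\<in>D. cball (m i) (\<rho> i)) \<le> e / 2" if D: "D \<subseteq> C" "finite D" for D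
    proof -
      let ?J = "\<lambda>i. {fst (snd i)..snd (snd i)} :: real set"
      have Dbad: "bad c (fst i) (fst (snd i)) (snd (snd i)) \<and> ?J i \<subseteq> \<gamma> (fst i)" if "i \<in> D" for i
      proof -
        have "i \<in> I" using that D C(2) by blast
        then show ?thesis by (simp add: I_def case_prod_unfold)
      qed
      have disj: "?J i \<inter> ?J j = {}" if "i \<in> D" "j \<in> D" "i \<noteq> j" for i j
        using C(3) D that unfolding pairwise_def disjnt_def cb by blast
      define p where "p = (\<lambda>i. (fst i, ?J i)) ` D"
      have inj: "inj_on (\<lambda>i. (fst i, ?J i)) D"
      proof (rule inj_onI)
        fix i j assume ij: "i \<in> D" "j \<in> D" "(fst i, ?J i) = (fst j, ?J j)"
        then have "?J i \<inter> ?J j \<noteq> {}" using Dbad[of i] by (auto simp: bad_def)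
        then show "i = j" using disj ij by blast
      qed
      have "p tagged_partial_division_of (cbox a b)"
        unfolding tagged_partial_division_of_def
      proof (intro conjI allI impI)
        show "finite p" using D by (simp add: p_def)
      next
        fix x K assume "(x, K) \<in> p"
        then obtain i where "i \<in> D" "x = fst i" "K = ?J i" by (auto simp: p_def)
        then show "x \<in> K" "K \<subseteq> cbox a b" "\<exists>a b. K = cbox a b"
          using Dbad[of i] by (auto simp: bad_def intro: box_real(2)[symmetric])
      next
        fix x1 x2 K1 K2 assume *: "(x1, K1) \<in> p \<and> (x2, K2) \<in> p \<and> (x1, K1) \<noteq> (x2, K2)"
        then obtain i j where "i \<in> D" "j \<in> D" "(x1, K1) = (fst i, ?J i)" "(x2, K2) = (fst j, ?J j)"
          unfolding p_def by blast
        with * have "i \<in> D" "j \<in> D" "K1 = ?J i" "K2 = ?J j" "i \<noteq> j" by auto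
        then show "interior K1 \<inter> interior K2 = {}"
          using disj[of i j] interior_subset by blast
      qed
      moreover have "\<gamma> fine p" unfolding fine_def p_def using Dbad by auto
      ultimately have "sum (\<lambda>(x,k). norm (measure lborel k *\<^sub>R g x - integral k g)) p < c * e / 2"
        by (rule \<gamma>(2))
      moreover have "sum (\<lambda>(x,k). norm (measure lborel k *\<^sub>R g x - integral k g)) p
         = (\<Sum>i\<in>D. norm (measure lborel (?J i) *\<^sub>R g (fst i) - integral (?J i) g))"
        unfolding p_def by (subst sum.reindex[OF inj]) (simp add: o_def)
      moreover have "(\<Sum>i\<in>D. c * measure lebesgue (cball (m i) (\<rho> i))) \<le>
          (\<Sum>i\<in>D. norm (measure lborel (?J i) *\<^sub>R g (fst i) - integral (?J i) g))"
      proof (rule sum_mono)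
        fix i assume "i \<in> D"
        with Dbad[of i] show "c * measure lebesgue (cball (m i) (\<rho> i)) \<le> norm (measure lborel (?J i) *\<^sub>R g (fst i) - integral (?J i) g)"
          by (simp add: cb bad_def)
      qed
      ultimately have "c * (\<Sum>i\<in>D. measure lebesgue (cball (m i) (\<rho> i))) \<le> c * (e / 2)"
        by (simp add: sum_distrib_left)
      then have "(\<Sum>i\<in>D. measure lebesgue (cball (m i) (\<rho> i))) \<le> e / 2"
        using \<open>c > 0\<close> by (simp only: mult_le_cancel_left_pos)
      moreover have "measure lebesgue (\<Union>i\<in>D. cball (m i) (\<rho> i)) \<le> (\<Sum>i\<in>D. measure lebesgue (cball (m i) (\<rho> i)))"
        using D by (intro measure_UNION_le) auto
      ultimately show ?thesis by simp
    qed
    let ?W = "\<Union>i\<in>C. cball (m i) (\<rho> i)"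
    have "?W \<in> lmeasurable" "measure lebesgue ?W \<le> e / 2"
      by (rule fmeasurable_UN_bound[OF C(1) _ bound] measure_UN_bound[OF C(1) _ bound]; simp)+
    moreover have "B c - ?W \<in> lmeasurable" "measure lebesgue (B c - ?W) = 0"
      using C(4) by (auto simp: negligible_iff_measure)
    moreover from calculation have "?W \<union> (B c - ?W) \<in> lmeasurable" by (intro fmeasurable.Un)
    ultimately have "?W \<union> (B c - ?W) \<in> lmeasurable" "measure lebesgue (?W \<union> (B c - ?W)) < e"
      using \<open>e > 0\<close> measure_Un_le[of ?W lebesgue "B c - ?W"] by (simp_all add: fmeasurableD del: Un_Diff_cancel)
    then show "\<exists>T. B c \<subseteq> T \<and> T \<in> lmeasurable \<and> measure lebesgue T < e"
      by (intro exI[of _ "?W \<union> (B c - ?W)"] conjI) blast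
  qed
  have "negligible (\<Union>n::nat. B (1 / real (Suc n)))"
    using negB by (intro negligible_countable_Union) auto
  moreover have "((\<lambda>r. integral {a..r} g) has_vector_derivative g s) (at s within {a..b})"
    if s: "s \<in> {a..b} - (\<Union>n::nat. B (1 / real (Suc n)))" for s
    unfolding has_vector_derivative_def has_derivative_within_alt
  proof (intro conjI allI impI)
    show "bounded_linear (\<lambda>x. x *\<^sub>R g s)" by (rule bounded_linear_scaleR_left)
    fix e :: real assume "e > 0"
    then obtain n where n: "1 / real (Suc n) < e" by (meson nat_approx_posE)
    have "s \<notin> B (1 / real (Suc n))" using s by blast
    then obtain d where d: "d > 0" "\<And>l r. bad (1 / real (Suc n)) s l r \<Longrightarrow> \<not> r - l < d"
      unfolding B_def mem_Collect_eq by blast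
    have main: "norm ((r - l) *\<^sub>R g s - integral {l..r} g) \<le> e * (r - l)"
      if "l < r" "s = l \<or> s = r" "a \<le> l" "r \<le> b" "r - l < d" for l r
    proof -
      have "norm ((r - l) *\<^sub>R g s - integral {l..r} g) \<le> 1 / real (Suc n) * (r - l)"
        using d(2)[of l r] that unfolding bad_def by argo
      also have "\<dots> \<le> e * (r - l)" using n that by (intro mult_right_mono) auto
      finally show ?thesis .
    qed
    show "\<exists>d>0. \<forall>y\<in>{a..b}. norm (y - s) < d \<longrightarrow>
        norm (integral {a..y} g - integral {a..s} g - (y - s) *\<^sub>R g s) \<le> e * norm (y - s)"
    proof (intro exI[of _ d] conjI ballI impI d(1))
      fix y assume y: "y \<in> {a..b}" "norm (y - s) < d"
      consider "y = s" | "s < y" | "y < s" by linarith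
      then show "norm (integral {a..y} g - integral {a..s} g - (y - s) *\<^sub>R g s) \<le> e * norm (y - s)"
      proof cases
        case 2
        have "g integrable_on {a..y}" using y by (auto intro!: integrable_subinterval_real[OF g])
        then have "integral {a..s} g + integral {s..y} g = integral {a..y} g"
          using Henstock_Kurzweil_Integration.integral_combine[of a s y g] s 2 by simp
        then have "integral {a..y} g - integral {a..s} g - (y - s) *\<^sub>R g s = - ((y - s) *\<^sub>R g s - integral {s..y} g)"
          by (simp add: algebra_simps)
        then show ?thesis using main[of s y] 2 y s by (simp add: norm_minus_commute)
      next
        case 3
        have "g integrable_on {a..s}" using s by (auto intro!: integrable_subinterval_real[OF g])
        then have "integral {a..y} g + integral {y..s} g = integral {a..s} g"
          using Henstock_Kurzweil_Integration.integral_combine[of a y s g] s y 3 by simp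
        then have "integral {a..y} g - integral {a..s} g - (y - s) *\<^sub>R g s = (s - y) *\<^sub>R g s - integral {y..s} g"
          by (simp add: algebra_simps)
        then show ?thesis using main[of y s] 3 y s by simp
      qed simp
    qed
  qed
  ultimately show ?thesis using that by blast
qed

text \<open>Banach's fixed point theorem for the integral operator. In the applications
  \<open>G\<close> is only measurable in time, so integrability along continuous curves is made a
  hypothesis. The contraction factor is L * t, so the bound 1 / 2 avoids weighted norms.\<close>

lemma picard_solution_exists:
  fixes G :: "real \<Rightarrow> 'a::euclidean_space \<Rightarrow> 'a"
  assumes "0 \<le> t" "0 \<le> L" "L * t \<le> 1 / 2"
    and lip: "\<And>s a b. s \<in> {0..t} \<Longrightarrow> norm (G s a - G s b) \<le> L * norm (a - b)"
    and int: "\<And>y. continuous_on {0..t} y \<Longrightarrow> (\<lambda>s. G s (y s)) integrable_on {0..t}"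
  obtains y where "continuous_on {0..t} y" "y 0 = x"
    "\<And>r. r \<in> {0..t} \<Longrightarrow> ((\<lambda>s. G s (y s)) has_integral (y r - y 0)) {0..r}"
proof -
  \<comment> \<open>Clamping the time to the interval lets the operator act on bounded continuous
    functions on the whole line, which form a complete metric space.\<close>
  define cl where "cl r = max 0 (min t r)" for r :: real
  have cl: "cl r \<in> {0..t}" "continuous_on UNIV cl" for r
    using \<open>0 \<le> t\<close> unfolding cl_def by (auto intro!: continuous_intros)
  have cl_id: "cl r = r" if "r \<in> {0..t}" for r using that by (auto simp: cl_def)
  define P where "P \<phi> = (\<lambda>r. x + integral {0..cl r} (\<lambda>s. G s (apply_bcontfun \<phi> s)))" for \<phi>
  have intb: "(\<lambda>s. G s (apply_bcontfun \<phi> s)) integrable_on {0..t}" for \<phi>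
    by (rule int) simp
  have P: "P \<phi> \<in> bcontfun" for \<phi>
  proof -
    have "continuous_on {0..t} (\<lambda>r. integral {0..r} (\<lambda>s. G s (apply_bcontfun \<phi> s)))"
      by (rule indefinite_integral_continuous_1[OF intb])
    then have c: "continuous_on {0..t} (\<lambda>r. x + integral {0..r} (\<lambda>s. G s (apply_bcontfun \<phi> s)))"
      by (intro continuous_intros)
    have r: "range (P \<phi>) \<subseteq> (\<lambda>r. x + integral {0..r} (\<lambda>s. G s (apply_bcontfun \<phi> s))) ` {0..t}"
      using cl(1) by (auto simp: P_def)
    have "bounded (range (P \<phi>))"
      by (rule bounded_subset[OF _ r]) (intro compact_imp_bounded compact_continuous_image c compact_Icc)
    moreover have "continuous_on UNIV (P \<phi>)"
      unfolding P_def using continuous_on_compose2[OF c cl(2)] cl(1) by blast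
    ultimately show ?thesis by (simp add: bcontfun_def)
  qed
  have "\<exists>!\<phi>. Bcontfun (P \<phi>) = \<phi>"
  proof (rule banach_fix_type)
    show "\<forall>\<phi> \<psi>. dist (Bcontfun (P \<phi>)) (Bcontfun (P \<psi>)) \<le> 1 / 2 * dist \<phi> \<psi>"
    proof (intro allI dist_bound)
      fix \<phi> \<psi> :: "real \<Rightarrow>\<^sub>C 'a" and r
      have "norm (integral {0..cl r} (\<lambda>s. G s (\<phi> s)) - integral {0..cl r} (\<lambda>s. G s (\<psi> s)))
         \<le> (L * dist \<phi> \<psi>) * (cl r - 0)"
      proof -
        have i: "(\<lambda>s. G s (\<phi> s)) integrable_on {0..cl r}" "(\<lambda>s. G s (\<psi> s)) integrable_on {0..cl r}"
          using cl(1)[of r] by (auto intro!: integrable_subinterval_real[OF intb])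
        then have "integral {0..cl r} (\<lambda>s. G s (\<phi> s)) - integral {0..cl r} (\<lambda>s. G s (\<psi> s)) =
            integral {0..cl r} (\<lambda>s. G s (\<phi> s) - G s (\<psi> s))" by (simp add: integral_diff)
        moreover have "norm (integral {0..cl r} (\<lambda>s. G s (\<phi> s) - G s (\<psi> s))) \<le> integral {0..cl r} (\<lambda>s. L * dist \<phi> \<psi>)"
        proof (rule integral_norm_bound_integral)
          fix s assume "s \<in> {0..cl r}"
          then have "norm (G s (\<phi> s) - G s (\<psi> s)) \<le> L * norm (\<phi> s - \<psi> s)"
            using cl(1)[of r] by (intro lip) auto
          also have "\<dots> \<le> L * dist \<phi> \<psi>"
            using dist_bounded[of \<phi> s \<psi>] \<open>0 \<le> L\<close> by (intro mult_left_mono) (simp_all add: dist_norm)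
          finally show "norm (G s (\<phi> s) - G s (\<psi> s)) \<le> L * dist \<phi> \<psi>" .
        qed (use i in \<open>auto intro: integrable_diff\<close>)
        ultimately show ?thesis using cl(1)[of r] by (simp add: mult_ac)
      qed
      also have "\<dots> \<le> (L * dist \<phi> \<psi>) * t"
        using cl(1)[of r] \<open>0 \<le> L\<close> by (intro mult_left_mono) auto
      also have "\<dots> = (L * t) * dist \<phi> \<psi>" by simp
      also have "\<dots> \<le> 1 / 2 * dist \<phi> \<psi>" using assms(3) by (intro mult_right_mono) auto
      finally show "dist (apply_bcontfun (Bcontfun (P \<phi>)) r) (apply_bcontfun (Bcontfun (P \<psi>)) r) \<le> 1 / 2 * dist \<phi> \<psi>"
        by (simp add: Bcontfun_inverse[OF P]) (simp add: P_def dist_norm)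
    qed
  qed auto
  then obtain \<phi> where \<phi>: "Bcontfun (P \<phi>) = \<phi>" by blast
  then have eq: "apply_bcontfun \<phi> r = P \<phi> r" for r
    using Bcontfun_inverse[OF P, of \<phi>] by simp
  have *: "apply_bcontfun \<phi> r = x + integral {0..r} (\<lambda>s. G s (apply_bcontfun \<phi> s))" if "r \<in> {0..t}" for r
    using eq[of r] cl_id[OF that] by (simp add: P_def)
  have 0: "apply_bcontfun \<phi> 0 = x" using *[of 0] \<open>0 \<le> t\<close> by simp
  show ?thesis
  proof (rule that[of "apply_bcontfun \<phi>"])
    fix r assume r: "r \<in> {0..t}"
    then have "(\<lambda>s. G s (apply_bcontfun \<phi> s)) integrable_on {0..r}"
      by (auto intro!: integrable_subinterval_real[OF intb])
    then show "((\<lambda>s. G s (apply_bcontfun \<phi> s)) has_integral (apply_bcontfun \<phi> r - apply_bcontfun \<phi> 0)) {0..r}"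
      using *[OF r] 0 by (simp add: has_integral_integral)
  qed (use 0 in auto)
qed

section \<open>Trajectories\<close>

definition control_field :: "('m::finite \<Rightarrow> ('n::finite) vector_field) \<Rightarrow> real ^ 'm \<Rightarrow> 'n vector_field" where
  "control_field f v y = (\<Sum>i\<in>UNIV. (v $ i) *\<^sub>R f i y)"

text \<open>The integral form of \<open>solution_on\<close>; the two are linked by
  \<open>solution_on_imp_traj\<close> and \<open>traj_imp_solution_on\<close>. Nothing is asked of
  \<open>u\<close> and \<open>Y\<close> outside the interval, so that restricting, shifting,
  reversing and concatenating trajectories become substitutions in integrals.\<close>

definition traj ::
  "('m::finite \<Rightarrow> ('n::finite) vector_field) \<Rightarrow> (real \<Rightarrow> real ^ 'm) \<Rightarrow> real \<Rightarrow> (real \<Rightarrow> real ^ 'n) \<Rightarrow> bool" where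
  "traj f u t Y \<longleftrightarrow> u integrable_on {0..t} \<and> (\<forall>s\<in>{0..t}. norm (u s) \<le> 1) \<and> continuous_on {0..t} Y \<and>
     (\<forall>r\<in>{0..t}. ((\<lambda>s. control_field f (u s) (Y s)) has_integral (Y r - Y 0)) {0..r})"

definition reach :: "('m::finite \<Rightarrow> ('n::finite) vector_field) \<Rightarrow> real \<Rightarrow> real ^ 'n \<Rightarrow> real ^ 'n \<Rightarrow> bool" where
  "reach f t x y \<longleftrightarrow> 0 \<le> t \<and> (\<exists>u Y. traj f u t Y \<and> Y 0 = x \<and> Y t = y)"

lemma integrable_scaleR_continuous:
  fixes u :: "real \<Rightarrow> real ^ 'm" and c :: "real \<Rightarrow> 'a::euclidean_space"
  assumes u: "u integrable_on {0..t}" "\<And>s. s \<in> {0..t} \<Longrightarrow> norm (u s) \<le> 1" and c: "continuous_on {0..t} c"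
  shows "(\<lambda>s. (u s $ i) *\<^sub>R c s) integrable_on {0..t}"
proof -
  have "bounded (c ` {0..t})" by (intro compact_imp_bounded compact_continuous_image c compact_Icc)
  then obtain C where C: "C > 0" "\<And>s. s \<in> {0..t} \<Longrightarrow> norm (c s) \<le> C"
    unfolding bounded_pos by blast
  have "u \<in> borel_measurable (lebesgue_on {0..t})" by (rule integrable_imp_measurable[OF u(1)])
  then have "(\<lambda>s. u s $ i) \<in> borel_measurable (lebesgue_on {0..t})"
    by (rule measurable_compose) (simp add: borel_measurable_continuous_onI continuous_on_component)
  moreover have "c \<in> borel_measurable (lebesgue_on {0..t})"
    by (rule continuous_imp_measurable_on_sets_lebesgue[OF c]) auto
  ultimately have "(\<lambda>s. (u s $ i) *\<^sub>R c s) \<in> borel_measurable (lebesgue_on {0..t})"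
    by (rule borel_measurable_scaleR)
  then show ?thesis
  proof (rule measurable_bounded_by_integrable_imp_integrable[of _ _ "\<lambda>_. C"])
    fix s assume s: "s \<in> {0..t}"
    have "\<bar>u s $ i\<bar> \<le> 1" using component_le_norm_cart[of "u s" i] u(2)[OF s] by simp
    then show "norm ((u s $ i) *\<^sub>R c s) \<le> C"
      using C s mult_mono[of "\<bar>u s $ i\<bar>" 1 "norm (c s)" C] by simp
  qed auto
qed

lemma integrable_control_field:
  fixes u :: "real \<Rightarrow> real ^ 'm"
  assumes "\<And>i. continuous_on UNIV (f i)" "u integrable_on {0..t}"
    "\<And>s. s \<in> {0..t} \<Longrightarrow> norm (u s) \<le> 1" "continuous_on {0..t} Y"
  shows "(\<lambda>s. control_field f (u s) (Y s)) integrable_on {0..t}"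
proof -
  have "continuous_on {0..t} (\<lambda>s. f i (Y s))" for i
    by (rule continuous_on_compose2[OF assms(1) assms(4)]) simp
  then show ?thesis
    unfolding control_field_def
    by (intro integrable_sum finite integrable_scaleR_continuous[OF assms(2,3)])
qed

lemma increment_has_integral:
  fixes w :: "real \<Rightarrow> 'a::euclidean_space"
  assumes w: "\<And>r. r \<in> {0..t} \<Longrightarrow> (F has_integral (w r - w 0)) {0..r}" and ab: "0 \<le> a" "a \<le> b" "b \<le> t"
  shows "(F has_integral (w b - w a)) {a..b}"
proof -
  have Fb: "(F has_integral (w b - w 0)) {0..b}" and Fa: "(F has_integral (w a - w 0)) {0..a}"
    using ab by (auto intro: w)
  have "F integrable_on {0..b}" using Fb by blast
  then have "integral {0..a} F + integral {a..b} F = integral {0..b} F" "F integrable_on {a..b}"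
    using Henstock_Kurzweil_Integration.integral_combine[of 0 a b F] ab
    by (auto intro: integrable_subinterval_real)
  moreover have "integral {0..a} F = w a - w 0" "integral {0..b} F = w b - w 0"
    using Fa Fb by (simp_all add: integral_unique)
  ultimately have "integral {a..b} F = w b - w a" "F integrable_on {a..b}" by (auto simp: algebra_simps)
  then show ?thesis using has_integral_integral by metis
qed

lemma traj_increment:
  assumes "traj f u t Y" "0 \<le> a" "a \<le> b" "b \<le> t"
  shows "((\<lambda>s. control_field f (u s) (Y s)) has_integral (Y b - Y a)) {a..b}"
proof (rule increment_has_integral[OF _ assms(2-4)])
  show "((\<lambda>s. control_field f (u s) (Y s)) has_integral (Y r - Y 0)) {0..r}" if "r \<in> {0..t}" for r
    using assms(1) that unfolding traj_def by blast
qed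

lemma traj_shift:
  assumes Y: "traj f u t Y" and ab: "0 \<le> a" "a \<le> b" "b \<le> t"
  shows "traj f (\<lambda>s. u (s + a)) (b - a) (\<lambda>s. Y (s + a))"
proof -
  have "u integrable_on {a..b}" using Y ab by (auto simp: traj_def intro: integrable_subinterval_real)
  then have "(\<lambda>s. u (s + a)) integrable_on {0..b - a}"
    using has_integral_shift_Icc_real[of u a _ 0 "b - a"] by (auto simp: integrable_on_def o_def add.commute)
  moreover have "continuous_on {0..b - a} (\<lambda>s. Y (s + a))"
    by (rule continuous_on_compose2[of "{0..t}" Y]) (use Y ab in \<open>auto simp: traj_def intro!: continuous_intros\<close>)
  moreover have "((\<lambda>s. control_field f (u (s + a)) (Y (s + a))) has_integral (Y (r + a) - Y (0 + a))) {0..r}"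
    if "r \<in> {0..b - a}" for r
    using has_integral_shift_Icc_real[of "\<lambda>s. control_field f (u s) (Y s)" a "Y (r + a) - Y a" 0 r]
      traj_increment[OF Y, of a "r + a"] that ab by (simp add: o_def add.commute)
  ultimately show ?thesis using Y ab by (auto simp: traj_def)
qed

lemma control_field_minus: "control_field f (- v) y = - control_field f v y"
  by (simp add: control_field_def sum_negf)

text \<open>There is no drift and the control ball is symmetric, so the reversed curve obeys an
  admissible control. This is the source of \<open>reach_sym\<close>, and hence of two-sided
  estimates for the minimum time.\<close>

lemma traj_reverse:
  assumes Y: "traj f u t Y" and "0 \<le> t"
  shows "traj f (\<lambda>s. - u (t - s)) t (\<lambda>s. Y (t - s))"
proof -
  have rev: "((\<lambda>s. g (t - s)) has_integral I) {0..r}"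
    if "(g has_integral I) {t - r..t}" "r \<in> {0..t}" for r I and g :: "real \<Rightarrow> 'z::euclidean_space"
  proof -
    have "((\<lambda>x. g (- 1 *\<^sub>R x + t)) has_integral (1 / \<bar>-1\<bar> ^ DIM(real)) *\<^sub>R I)
        ((\<lambda>x. (1 / - 1) *\<^sub>R x + - ((1 / - 1) *\<^sub>R t)) ` cbox (t - r) t)"
      using that by (intro has_integral_affinity) auto
    moreover have "(\<lambda>x. (1 / - 1) *\<^sub>R x + - ((1 / - 1) *\<^sub>R t)) ` cbox (t - r) t = {0..r}"
    proof -
      have "x \<in> (\<lambda>x. t - x) ` {t - r..t}" if "x \<in> {0..r}" for x
        using that by (intro image_eqI[of _ _ "t - x"]) auto
      then show ?thesis by auto
    qed
    ultimately show ?thesis by simp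
  qed
  have "u integrable_on {t - t..t}" using Y by (simp add: traj_def)
  then have "(\<lambda>s. u (t - s)) integrable_on {0..t}"
    using rev[of u _ t] \<open>0 \<le> t\<close> by (auto simp: integrable_on_def)
  then have "(\<lambda>s. - u (t - s)) integrable_on {0..t}" by (rule integrable_neg)
  moreover have "continuous_on {0..t} (\<lambda>s. Y (t - s))"
    by (rule continuous_on_compose2[of "{0..t}" Y]) (use Y in \<open>auto simp: traj_def intro!: continuous_intros\<close>)
  moreover have "((\<lambda>s. control_field f (- u (t - s)) (Y (t - s))) has_integral (Y (t - r) - Y (t - 0))) {0..r}"
    if "r \<in> {0..t}" for r
    using has_integral_neg[OF rev[OF traj_increment[OF Y, of "t - r" t]]] that by (simp add: control_field_minus)
  ultimately show ?thesis using Y by (auto simp: traj_def)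
qed

lemma traj_concat:
  assumes Y: "traj f u s Y" and Z: "traj f v t Z" and YZ: "Y s = Z 0" and st: "0 \<le> s" "0 \<le> t"
  shows "traj f (\<lambda>r. if r \<le> s then u r else v (r - s)) (s + t) (\<lambda>r. if r \<le> s then Y r else Z (r - s))"
proof -
  let ?w = "\<lambda>r. if r \<le> s then u r else v (r - s)" and ?W = "\<lambda>r. if r \<le> s then Y r else Z (r - s)"
  have glue: "((\<lambda>r. if r \<le> s then g r else h (r - s)) has_integral (I + J)) {0..r}"
    if "(g has_integral I) {0..s}" "(h has_integral J) {0..r - s}" "s \<le> r" for r I J and g h :: "real \<Rightarrow> 'z::euclidean_space"
  proof (rule has_integral_combine[of 0 s r])
    show "((\<lambda>r. if r \<le> s then g r else h (r - s)) has_integral I) {0..s}"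
      by (rule has_integral_eq[OF _ that(1)]) auto
    have "((\<lambda>r. h (r - s)) has_integral J) {s..r}"
      using has_integral_shift_Icc_real[of "\<lambda>r. h (r - s)" s J 0 "r - s"] that by (simp add: o_def)
    \<comment> \<open>Only at the junction \<open>s\<close> may the integrand differ from the
      shifted one, and a single point is negligible.\<close>
    then show "((\<lambda>r. if r \<le> s then g r else h (r - s)) has_integral J) {s..r}"
      by (rule has_integral_spike[of "{s}", rotated 2]) auto
  qed (use st that in auto)
  have "u integrable_on {0..s}" "v integrable_on {0..s + t - s}" using Y Z by (auto simp: traj_def)
  then obtain I J where "(u has_integral I) {0..s}" "(v has_integral J) {0..s + t - s}"
    unfolding integrable_on_def by blast
  then have "?w integrable_on {0..s + t}"
    by (intro has_integral_integrable[OF glue]) (use st in auto)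
  moreover have "continuous_on ({0..s} \<union> {s..s + t}) ?W"
  proof (rule continuous_on_If)
    show "continuous_on {s..s + t} (\<lambda>r. Z (r - s))"
      by (rule continuous_on_compose2[of "{0..t}" Z]) (use Z in \<open>auto simp: traj_def intro!: continuous_intros\<close>)
  qed (use Y YZ in \<open>auto simp: traj_def\<close>)
  moreover have "{0..s} \<union> {s..s + t} = {0..s + t}" using st by auto
  moreover have "((\<lambda>r. control_field f (?w r) (?W r)) has_integral (?W r - ?W 0)) {0..r}"
    if r: "r \<in> {0..s + t}" for r
  proof -
    have eq: "control_field f (?w r) (?W r) = (if r \<le> s then control_field f (u r) (Y r) else control_field f (v (r - s)) (Z (r - s)))" for r
      by simp
    show ?thesis
    proof (cases "r \<le> s")
      case True
      have "((\<lambda>r. control_field f (u r) (Y r)) has_integral (Y r - Y 0)) {0..r}"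
        using Y True r by (auto simp: traj_def)
      then have "((\<lambda>r. control_field f (?w r) (?W r)) has_integral (Y r - Y 0)) {0..r}"
        by (rule has_integral_eq[rotated]) (use True in auto)
      then show ?thesis using True st by simp
    next
      case False
      have "((\<lambda>r. if r \<le> s then control_field f (u r) (Y r) else control_field f (v (r - s)) (Z (r - s)))
         has_integral ((Y s - Y 0) + (Z (r - s) - Z 0))) {0..r}"
        by (rule glue[of "\<lambda>r. control_field f (u r) (Y r)" _ "\<lambda>r. control_field f (v r) (Z r)"])
          (use Y Z False r st in \<open>auto simp: traj_def\<close>)
      then show ?thesis unfolding eq using False st YZ by simp
    qed
  qed
  ultimately show ?thesis using Y Z by (auto simp: traj_def)
qed

lemma reach_trans: "reach f s x y \<Longrightarrow> reach f t y z \<Longrightarrow> reach f (s + t) x z"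
proof -
  assume xy: "reach f s x y" and yz: "reach f t y z"
  obtain u Y where Y: "0 \<le> s" "traj f u s Y" "Y 0 = x" "Y s = y" using xy by (auto simp: reach_def)
  obtain v Z where Z: "0 \<le> t" "traj f v t Z" "Z 0 = y" "Z t = z" using yz by (auto simp: reach_def)
  let ?W = "\<lambda>r. if r \<le> s then Y r else Z (r - s)"
  have "traj f (\<lambda>r. if r \<le> s then u r else v (r - s)) (s + t) ?W"
    by (rule traj_concat) (use Y Z in auto)
  moreover have "?W 0 = x" "?W (s + t) = z" "0 \<le> s + t" using Y Z by auto
  ultimately show ?thesis unfolding reach_def by blast
qed

lemma reach_sym: assumes "reach f s x y" shows "reach f s y x"
proof -
  obtain u Y where Y: "0 \<le> s" "traj f u s Y" "Y 0 = x" "Y s = y" using assms by (auto simp: reach_def)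
  have "traj f (\<lambda>r. - u (s - r)) s (\<lambda>r. Y (s - r))" by (rule traj_reverse) (use Y in auto)
  moreover have "(\<lambda>r. Y (s - r)) 0 = y" "(\<lambda>r. Y (s - r)) s = x" using Y by auto
  ultimately show ?thesis using Y(1) unfolding reach_def by blast
qed

lemma reach_0: "reach f 0 x x"
proof -
  have "traj f (\<lambda>_. 0) 0 (\<lambda>_. x)" by (simp add: traj_def control_field_def integrable_0)
  then show ?thesis unfolding reach_def by blast
qed

lemma traj_reach:
  assumes "traj f u t Y" "0 \<le> a" "a \<le> b" "b \<le> t"
  shows "reach f (b - a) (Y a) (Y b)"
proof -
  have "traj f (\<lambda>s. u (s + a)) (b - a) (\<lambda>s. Y (s + a))" by (rule traj_shift[OF assms])
  moreover have "(\<lambda>s. Y (s + a)) 0 = Y a" "(\<lambda>s. Y (s + a)) (b - a) = Y b" by auto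
  moreover have "0 \<le> b - a" using assms by simp
  ultimately show ?thesis unfolding reach_def by blast
qed

lemma lipschitz_imp_abs_continuous:
  fixes y :: "real \<Rightarrow> 'a::real_normed_vector"
  assumes "C > 0" and lip: "\<And>r s. r \<in> {a..b} \<Longrightarrow> s \<in> {a..b} \<Longrightarrow> norm (y r - y s) \<le> C * \<bar>r - s\<bar>"
  shows "abs_continuous_on_interval a b y"
  unfolding abs_continuous_on_interval_def
proof (intro allI impI)
  fix e :: real assume "e > 0"
  show "\<exists>\<delta>>0. \<forall>(k::nat) l r. (\<forall>i<k. a \<le> l i \<and> l i \<le> r i \<and> r i \<le> b) \<and>
        disjoint_family_on (\<lambda>i. {l i<..<r i}) {..<k} \<and> (\<Sum>i<k. r i - l i) < \<delta> \<longrightarrow>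
        (\<Sum>i<k. dist (y (l i)) (y (r i))) < e"
  proof (intro exI[of _ "e / C"] conjI allI impI)
    fix k :: nat and l r
    assume *: "(\<forall>i<k. a \<le> l i \<and> l i \<le> r i \<and> r i \<le> b) \<and>
        disjoint_family_on (\<lambda>i. {l i<..<r i}) {..<k} \<and> (\<Sum>i<k. r i - l i) < e / C"
    have "(\<Sum>i<k. dist (y (l i)) (y (r i))) \<le> (\<Sum>i<k. C * (r i - l i))"
    proof (rule sum_mono)
      fix i assume "i \<in> {..<k}"
      then show "dist (y (l i)) (y (r i)) \<le> C * (r i - l i)"
        using lip[of "l i" "r i"] * by (force simp: dist_norm)
    qed
    also have "\<dots> = C * (\<Sum>i<k. r i - l i)" by (simp add: sum_distrib_left)
    also have "\<dots> < e" using * \<open>C > 0\<close> by (simp add: field_simps)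
    finally show "(\<Sum>i<k. dist (y (l i)) (y (r i))) < e" .
  qed (use \<open>e > 0\<close> \<open>C > 0\<close> in auto)
qed

lemma primitive_has_derivative_ae:
  fixes w :: "real \<Rightarrow> 'a::euclidean_space"
  assumes w: "\<And>r. r \<in> {0..t} \<Longrightarrow> (F has_integral (w r - w 0)) {0..r}" and "0 \<le> t"
  obtains S where "negligible S"
    "\<And>s. s \<in> {0..t} - S \<Longrightarrow> (w has_vector_derivative F s) (at s within {0..t})"
proof -
  have F: "F integrable_on {0..t}" using w[of t] \<open>0 \<le> t\<close> by auto
  obtain S where S: "negligible S"
    "\<And>s. s \<in> {0..t} - S \<Longrightarrow> ((\<lambda>r. integral {0..r} F) has_vector_derivative F s) (at s within {0..t})"
    using indefinite_integral_has_vector_derivative_ae[OF F] by blast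
  have w_eq: "w r = w 0 + integral {0..r} F" if "r \<in> {0..t}" for r
    using integral_unique[OF w[OF that]] by simp
  have "(w has_vector_derivative F s) (at s within {0..t})" if s: "s \<in> {0..t} - S" for s
  proof (rule has_vector_derivative_transform[of s "{0..t}"])
    show "((\<lambda>r. w 0 + integral {0..r} F) has_vector_derivative F s) (at s within {0..t})"
      using has_vector_derivative_add[OF has_vector_derivative_const S(2)[OF s]] by simp
    show "s \<in> {0..t}" using s by simp
    show "w r = w 0 + integral {0..r} F" if "r \<in> {0..t}" for r
      by (rule w_eq[OF that])
  qed
  with S(1) show ?thesis by (rule that)
qed

lemma primitive_lipschitz:
  fixes w :: "real \<Rightarrow> 'a::euclidean_space"
  assumes w: "\<And>r. r \<in> {0..t} \<Longrightarrow> (F has_integral (w r - w 0)) {0..r}"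
    and bound: "\<And>s. s \<in> {0..t} \<Longrightarrow> norm (F s) \<le> C" and rs: "r \<in> {0..t}" "s \<in> {0..t}"
  shows "norm (w r - w s) \<le> C * \<bar>r - s\<bar>"
proof -
  have C: "0 \<le> C" using bound[of r] rs norm_ge_zero order_trans by blast
  have *: "norm (w r - w s) \<le> C * \<bar>r - s\<bar>" if "s \<le> r" "r \<in> {0..t}" "s \<in> {0..t}" for r s
    using has_integral_bound_real[OF C finite.emptyI increment_has_integral[OF w, of t s r]] bound that by auto
  show ?thesis
  proof (cases "s \<le> r")
    case False
    then show ?thesis using *[of r s] rs by (simp add: norm_minus_commute abs_minus_commute)
  qed (use * rs in auto)
qed

lemma solution_on_imp_traj:
  assumes sol: "solution_on f x u t y" and u: "u \<in> controls" and "0 \<le> t"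
  shows "traj f u t y" "y 0 = x"
proof -
  show "y 0 = x" using sol by (simp add: solution_on_def)
  have ac: "abs_continuous_on_interval 0 t y" using sol by (simp add: solution_on_def)
  \<comment> \<open>The integral equation is needed up to every \<open>r\<close>, not just up to
    \<open>t\<close>, so absolute continuity is restricted first.\<close>
  have ac_sub: "abs_continuous_on_interval 0 r y" if "r \<le> t" for r
    unfolding abs_continuous_on_interval_def
  proof (intro allI impI)
    fix e :: real assume "e > 0"
    obtain \<delta> where "\<delta> > 0" and \<delta>: "\<And>(k::nat) l r. (\<forall>i<k. 0 \<le> l i \<and> l i \<le> r i \<and> r i \<le> t) \<Longrightarrow>
        disjoint_family_on (\<lambda>i. {l i<..<r i}) {..<k} \<Longrightarrow> (\<Sum>i<k. r i - l i) < \<delta> \<Longrightarrow>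
        (\<Sum>i<k. dist (y (l i)) (y (r i))) < e"
      by (rule abs_continuous_on_intervalE[OF ac \<open>e > 0\<close>]) (rule that)
    show "\<exists>\<delta>>0. \<forall>(k::nat) l ra. (\<forall>i<k. 0 \<le> l i \<and> l i \<le> ra i \<and> ra i \<le> r) \<and>
        disjoint_family_on (\<lambda>i. {l i<..<ra i}) {..<k} \<and> (\<Sum>i<k. ra i - l i) < \<delta> \<longrightarrow>
        (\<Sum>i<k. dist (y (l i)) (y (ra i))) < e"
      by (intro exI[of _ \<delta>] conjI allI impI \<open>\<delta> > 0\<close>, elim conjE, rule \<delta>)
        (use \<open>r \<le> t\<close> in fastforce)+
  qed
  have "AE s in lebesgue_on {0..t}.
        (y has_vector_derivative control_field f (u s) (y s)) (at s within {0..t})"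
    using sol by (simp add: solution_on_def control_field_def)
  then obtain S where S: "S \<in> null_sets (lebesgue_on {0..t})"
    "{s \<in> {0..t}. \<not> (y has_vector_derivative control_field f (u s) (y s)) (at s within {0..t})} \<subseteq> S"
    by (auto simp: eventually_ae_filter)
  have neg: "negligible S"
    using S(1) by (simp add: null_sets_restrict_space negligible_iff_null_sets)
  have der: "(y has_vector_derivative control_field f (u s) (y s)) (at s within {0..t})" if "s \<in> {0..t} - S" for s
    using S(2) that by blast
  have int: "((\<lambda>s. control_field f (u s) (y s)) has_integral (y r - y 0)) {0..r}" if r: "r \<in> {0..t}" for r
  proof (rule fundamental_theorem_of_calculus_abs_continuous[OF _ _ neg])
    fix s assume "s \<in> {0..r} - S"
    then show "(y has_vector_derivative control_field f (u s) (y s)) (at s within {0..r})"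
      using r by (intro has_vector_derivative_within_subset[OF der]) auto
  qed (use r ac_sub in auto)
  have "continuous_on {0..t} y"
  proof -
    have "continuous_on {0..t} (\<lambda>r. y 0 + integral {0..r} (\<lambda>s. control_field f (u s) (y s)))"
      by (intro continuous_intros indefinite_integral_continuous_1) (use int[of t] \<open>0 \<le> t\<close> in auto)
    then show ?thesis
      by (rule continuous_on_eq) (use integral_unique[OF int] in simp)
  qed
  moreover have "u integrable_on {0..t}"
  proof (rule measurable_bounded_by_integrable_imp_integrable[of _ _ "\<lambda>_. 1"])
    have "u \<in> borel_measurable (lebesgue_on {0..})" using u by (simp add: controls_def)
    then show "u \<in> borel_measurable (lebesgue_on {0..t})"
      by (rule measurable_restrict_mono) auto
  qed (use u in \<open>auto simp: controls_def\<close>)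
  ultimately show "traj f u t y"
    using int u by (auto simp: traj_def controls_def)
qed

lemma traj_imp_solution_on:
  assumes f: "\<And>i. continuous_on UNIV (f i)" and Y: "traj f u t Y" and "0 \<le> t"
  obtains u' where "u' \<in> controls" "solution_on f (Y 0) u' t Y"
proof -
  \<comment> \<open>Admissible controls live on the whole half-line; the value 0 beyond
    \<open>t\<close> keeps measurability and the bound.\<close>
  define u' where "u' s = (if s \<in> {0..t} then u s else 0)" for s
  have u: "u integrable_on {0..t}" and u1: "\<And>s. s \<in> {0..t} \<Longrightarrow> norm (u s) \<le> 1"
    using Y by (auto simp: traj_def)
  have cY: "continuous_on {0..t} Y" using Y by (simp add: traj_def)
  have int: "((\<lambda>s. control_field f (u s) (Y s)) has_integral (Y r - Y 0)) {0..r}" if "r \<in> {0..t}" for r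
    using Y that by (simp add: traj_def)
  have "u' integrable_on {0..t}"
    by (rule integrable_eq[OF u]) (simp add: u'_def)
  then have "u' integrable_on {0..}"
    by (rule integrable_on_superset) (auto simp: u'_def)
  then have "u' \<in> borel_measurable (lebesgue_on {0..})" by (rule integrable_imp_measurable)
  then have u': "u' \<in> controls" using u1 by (auto simp: controls_def u'_def)
  \<comment> \<open>On the compact image of \<open>Y\<close> the fields are bounded, so
    \<open>Y\<close> is Lipschitz and therefore absolutely continuous.\<close>
  have "bounded (\<Union>i. f i ` Y ` {0..t})"
    by (intro bounded_UN finite ballI compact_imp_bounded compact_continuous_image cY compact_Icc continuous_on_subset[OF f]) auto
  then obtain C where C0: "C > 0" "\<forall>x\<in>(\<Union>i. f i ` Y ` {0..t}). norm x \<le> C"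
    unfolding bounded_pos by (elim exE conjE)
  have C: "C > 0" "\<And>i s. s \<in> {0..t} \<Longrightarrow> norm (f i (Y s)) \<le> C"
    using C0 by auto
  have bound: "norm (control_field f (u s) (Y s)) \<le> real CARD('a) * C" if s: "s \<in> {0..t}" for s
  proof -
    have "norm (control_field f (u s) (Y s)) \<le> (\<Sum>i\<in>(UNIV::'a set). C)"
      unfolding control_field_def
    proof (rule sum_norm_le)
      fix i
      have "\<bar>u s $ i\<bar> \<le> 1" using component_le_norm_cart[of "u s" i] u1[OF s] by simp
      then show "norm ((u s $ i) *\<^sub>R f i (Y s)) \<le> C"
        using C(2)[OF s, of i] mult_mono[of "\<bar>u s $ i\<bar>" 1 "norm (f i (Y s))" C] by simp
    qed
    then show ?thesis by simp
  qed
  have "abs_continuous_on_interval 0 t Y"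
  proof (rule lipschitz_imp_abs_continuous)
    show "0 < real CARD('a) * C" using C by simp
    show "norm (Y r - Y s) \<le> real CARD('a) * C * \<bar>r - s\<bar>" if "r \<in> {0..t}" "s \<in> {0..t}" for r s
      by (rule primitive_lipschitz[OF int bound that])
  qed
  moreover obtain S where S: "negligible S"
    "\<And>s. s \<in> {0..t} - S \<Longrightarrow> (Y has_vector_derivative control_field f (u s) (Y s)) (at s within {0..t})"
    using primitive_has_derivative_ae[OF int \<open>0 \<le> t\<close>] by blast
  have "AE s in lebesgue_on {0..t}. (Y has_vector_derivative (\<Sum>i\<in>UNIV. (u' s $ i) *\<^sub>R f i (Y s))) (at s within {0..t})"
  proof (rule AE_I')
    show "S \<inter> {0..t} \<in> null_sets (lebesgue_on {0..t})"
      using S(1) by (simp add: null_sets_restrict_space negligible_iff_null_sets null_set_Int2)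
    show "{s \<in> space (lebesgue_on {0..t}). \<not> (Y has_vector_derivative (\<Sum>i\<in>UNIV. (u' s $ i) *\<^sub>R f i (Y s))) (at s within {0..t})} \<subseteq> S \<inter> {0..t}"
      using S(2) by (auto simp: u'_def control_field_def)
  qed
  ultimately show ?thesis using that[OF u'] by (simp add: solution_on_def)
qed

lemma minimum_time_eq:
  assumes f: "\<And>i. continuous_on UNIV (f i)"
  shows "minimum_time K f x = Inf {ennreal t | t. \<exists>k\<in>K. reach f t x k}"
proof -
  have "(t \<ge> 0 \<and> (\<exists>u\<in>controls. \<exists>y. solution_on f x u t y \<and> y t \<in> K)) \<longleftrightarrow> (\<exists>k\<in>K. reach f t x k)" for t
  proof
    assume "t \<ge> 0 \<and> (\<exists>u\<in>controls. \<exists>y. solution_on f x u t y \<and> y t \<in> K)"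
    then obtain u y where "t \<ge> 0" "u \<in> controls" "solution_on f x u t y" "y t \<in> K" by blast
    then show "\<exists>k\<in>K. reach f t x k"
      unfolding reach_def using solution_on_imp_traj[of f x u t y] by blast
  next
    assume "\<exists>k\<in>K. reach f t x k"
    then obtain u Y where Y: "0 \<le> t" "traj f u t Y" "Y 0 = x" "Y t \<in> K" unfolding reach_def by blast
    obtain u' where "u' \<in> controls" "solution_on f (Y 0) u' t Y"
      by (rule traj_imp_solution_on[OF f Y(2,1)])
    then show "t \<ge> 0 \<and> (\<exists>u\<in>controls. \<exists>y. solution_on f x u t y \<and> y t \<in> K)" using Y by blast
  qed
  then show ?thesis unfolding minimum_time_def by simp
qed

section \<open>Local estimates and the adjoint equation\<close>

definition control_field_deriv :: "('m::finite \<Rightarrow> ('n::finite) vector_field) \<Rightarrow> real ^ 'm \<Rightarrow> real ^ 'n \<Rightarrow> real ^ 'n \<Rightarrow> real ^ 'n" where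
  "control_field_deriv f v y h = (\<Sum>i\<in>UNIV. (v $ i) *\<^sub>R frechet_derivative (f i) (at y) h)"

definition control_field_adjoint :: "('m::finite \<Rightarrow> ('n::finite) vector_field) \<Rightarrow> real ^ 'm \<Rightarrow> real ^ 'n \<Rightarrow> real ^ 'n \<Rightarrow> real ^ 'n" where
  "control_field_adjoint f v y p =
     (\<Sum>i\<in>UNIV. (v $ i) *\<^sub>R (\<Sum>b\<in>Basis. (p \<bullet> frechet_derivative (f i) (at y) b) *\<^sub>R b))"

text \<open>The bounds are uniform over the control ball, so they can be applied at each time
  separately to a merely measurable control. The single \<open>L\<close> serves as Lipschitz
  constant, as bound of the derivative and as Taylor coefficient.\<close>

definition local_bounds :: "('m::finite \<Rightarrow> ('n::finite) vector_field) \<Rightarrow> real ^ 'n \<Rightarrow> real \<Rightarrow> real \<Rightarrow> real \<Rightarrow> bool" where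
  "local_bounds f c R M L \<longleftrightarrow> 0 < R \<and> 0 < M \<and> 0 < L \<and>
     (\<forall>v a b. norm v \<le> 1 \<longrightarrow> a \<in> cball c R \<longrightarrow> b \<in> cball c R \<longrightarrow>
        norm (control_field f v a) \<le> M \<and>
        norm (control_field f v a - control_field f v b) \<le> L * norm (a - b) \<and>
        norm (control_field f v a - control_field f v b - control_field_deriv f v b (a - b)) \<le> L * (norm (a - b))\<^sup>2) \<and>
     (\<forall>v a h. norm v \<le> 1 \<longrightarrow> a \<in> cball c R \<longrightarrow> norm (control_field_deriv f v a h) \<le> L * norm h)"

lemma local_bounds_exist:
  fixes f :: "'m::finite \<Rightarrow> ('n::finite) vector_field"
  assumes f: "\<And>i. C_infinity (f i)" and "R > 0"
  obtains M L where "local_bounds f c R M L"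
proof -
  have "\<exists>C>0. (\<forall>a\<in>cball c R. norm (f i a) \<le> C) \<and>
      (\<forall>a\<in>cball c R. \<forall>b\<in>cball c R. norm (f i a - f i b) \<le> C * norm (a - b)) \<and>
      (\<forall>a\<in>cball c R. \<forall>b\<in>cball c R. norm (f i a - f i b - frechet_derivative (f i) (at b) (a - b)) \<le> C * (norm (a - b))\<^sup>2) \<and>
      (\<forall>a\<in>cball c R. \<forall>h. norm (frechet_derivative (f i) (at a) h) \<le> C * norm h)" for i
  proof -
    obtain C1 where C1: "C1 > 0" "\<And>a. a \<in> cball c R \<Longrightarrow> norm (f i a) \<le> C1"
      by (rule C_infinity_bounded_on_compact[OF f compact_cball]) blast
    obtain C2 where C2: "C2 > 0" "\<And>a b. a \<in> cball c R \<Longrightarrow> b \<in> cball c R \<Longrightarrow> norm (f i a - f i b) \<le> C2 * norm (a - b)"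
      by (rule C_infinity_lipschitz_on_cball[OF f, of c R]) blast
    obtain C3 where C3: "C3 > 0" "\<And>a b. a \<in> cball c R \<Longrightarrow> b \<in> cball c R \<Longrightarrow>
        norm (f i a - f i b - frechet_derivative (f i) (at b) (a - b)) \<le> C3 * (norm (a - b))\<^sup>2"
      by (rule C_infinity_taylor2[OF f, of c R]) blast
    obtain C4 where C4: "C4 > 0" "\<And>a h. a \<in> cball c R \<Longrightarrow> norm (frechet_derivative (f i) (at a) h) \<le> C4 * norm h"
      by (rule C_infinity_derivative_bound[OF f, of "cball c R"]) auto
    define C where "C = C1 + C2 + C3 + C4"
    have C: "C > 0" "C1 \<le> C" "C2 \<le> C" "C3 \<le> C" "C4 \<le> C" using C1(1) C2(1) C3(1) C4(1) by (auto simp: C_def)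
    show ?thesis
    proof (intro exI[of _ C] conjI ballI allI C(1))
      fix a b :: "real ^ 'n" and h assume a: "a \<in> cball c R"
      show "norm (f i a) \<le> C" using C1(2)[OF a] C by simp
      show "norm (frechet_derivative (f i) (at a) h) \<le> C * norm h"
        using C4(2)[OF a, of h] mult_right_mono[OF C(5), of "norm h"] by simp
      assume b: "b \<in> cball c R"
      show "norm (f i a - f i b) \<le> C * norm (a - b)"
        using C2(2)[OF a b] mult_right_mono[OF C(3), of "norm (a - b)"] by simp
      show "norm (f i a - f i b - frechet_derivative (f i) (at b) (a - b)) \<le> C * (norm (a - b))\<^sup>2"
        using C3(2)[OF a b] mult_right_mono[OF C(4), of "(norm (a - b))\<^sup>2"] by simp
    qed
  qed
  then obtain C where C: "\<And>i. C i > 0" "\<And>i a. a \<in> cball c R \<Longrightarrow> norm (f i a) \<le> C i"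
     "\<And>i a b. a \<in> cball c R \<Longrightarrow> b \<in> cball c R \<Longrightarrow> norm (f i a - f i b) \<le> C i * norm (a - b)"
     "\<And>i a b. a \<in> cball c R \<Longrightarrow> b \<in> cball c R \<Longrightarrow> norm (f i a - f i b - frechet_derivative (f i) (at b) (a - b)) \<le> C i * (norm (a - b))\<^sup>2"
     "\<And>i a h. a \<in> cball c R \<Longrightarrow> norm (frechet_derivative (f i) (at a) h) \<le> C i * norm h"
    by metis
  have bound: "norm (\<Sum>i\<in>UNIV. (v $ i) *\<^sub>R g i) \<le> (\<Sum>i\<in>UNIV. C i) * B"
    if "norm v \<le> 1" "\<And>i. norm (g i) \<le> C i * B" for v :: "real ^ 'm" and g :: "'m \<Rightarrow> real ^ 'n" and B
    unfolding sum_distrib_right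
  proof (rule sum_norm_le)
    fix i
    have "\<bar>v $ i\<bar> \<le> 1" using component_le_norm_cart[of v i] that by simp
    then have "\<bar>v $ i\<bar> * norm (g i) \<le> 1 * norm (g i)" by (rule mult_right_mono) simp
    then show "norm ((v $ i) *\<^sub>R g i) \<le> C i * B" using that(2)[of i] by simp
  qed
  define K where "K = (\<Sum>i\<in>UNIV. C i)"
  have "K > 0" unfolding K_def using C(1) by (intro sum_pos) auto
  have "local_bounds f c R K K"
    unfolding local_bounds_def
  proof (intro conjI allI impI \<open>K > 0\<close> \<open>R > 0\<close>)
    fix v :: "real ^ 'm" and a b h :: "real ^ 'n" assume v: "norm v \<le> 1" and a: "a \<in> cball c R"
    show "norm (control_field_deriv f v a h) \<le> K * norm h"
      unfolding control_field_deriv_def K_def by (rule bound[OF v C(5)[OF a]])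
    assume b: "b \<in> cball c R"
    show "norm (control_field f v a) \<le> K"
      unfolding control_field_def K_def using bound[OF v, of "\<lambda>i. f i a" 1] C(2)[OF a] by simp
    have "control_field f v a - control_field f v b = (\<Sum>i\<in>UNIV. (v $ i) *\<^sub>R (f i a - f i b))"
      by (simp add: control_field_def scaleR_diff_right sum_subtractf)
    then show "norm (control_field f v a - control_field f v b) \<le> K * norm (a - b)"
      unfolding K_def using bound[OF v C(3)[OF a b]] by simp
    have "control_field f v a - control_field f v b - control_field_deriv f v b (a - b) =
        (\<Sum>i\<in>UNIV. (v $ i) *\<^sub>R (f i a - f i b - frechet_derivative (f i) (at b) (a - b)))"
      by (simp add: control_field_def control_field_deriv_def scaleR_diff_right sum_subtractf)
    then show "norm (control_field f v a - control_field f v b - control_field_deriv f v b (a - b)) \<le> K * (norm (a - b))\<^sup>2"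
      unfolding K_def using bound[OF v C(4)[OF a b]] by simp
  qed
  then show ?thesis by (rule that)
qed

lemma inner_control_field_adjoint:
  fixes f :: "'m::finite \<Rightarrow> ('n::finite) vector_field"
  assumes f: "\<And>i. C_infinity (f i)"
  shows "control_field_adjoint f v y p \<bullet> h = p \<bullet> control_field_deriv f v y h"
proof -
  have "(\<Sum>b\<in>Basis. (p \<bullet> frechet_derivative (f i) (at y) b) *\<^sub>R b) \<bullet> h = p \<bullet> frechet_derivative (f i) (at y) h" for i
    by (subst linear_basis_expansion[OF bounded_linear_frechet_derivative[OF f], of i y h])
       (simp add: inner_sum_left inner_sum_right inner_commute mult.commute)
  then show ?thesis
    by (simp add: control_field_adjoint_def control_field_deriv_def inner_sum_left inner_sum_right)
qed

text \<open>Pair the adjoint vector with itself and move the operator across; one factor of its norm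
  cancels.\<close>

lemma norm_control_field_adjoint:
  assumes f: "\<And>i. C_infinity (f i)" and lb: "local_bounds f c R M L" and v: "norm v \<le> 1" and y: "y \<in> cball c R"
  shows "norm (control_field_adjoint f v y p) \<le> L * norm p"
proof -
  let ?q = "control_field_adjoint f v y p"
  have "norm ?q * norm ?q = p \<bullet> control_field_deriv f v y ?q"
    by (simp add: inner_control_field_adjoint[OF f, symmetric] power2_norm_eq_inner[symmetric] power2_eq_square)
  also have "\<dots> \<le> norm p * norm (control_field_deriv f v y ?q)" by (rule norm_cauchy_schwarz)
  also have "\<dots> \<le> norm p * (L * norm ?q)"
    using lb v y unfolding local_bounds_def by (intro mult_left_mono) auto
  finally have "norm ?q * norm ?q \<le> (L * norm p) * norm ?q" by (simp add: mult_ac)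
  moreover have "0 \<le> L * norm p" using lb by (simp add: local_bounds_def)
  ultimately show ?thesis by (cases "norm ?q = 0") (auto simp: mult_le_cancel_right)
qed

text \<open>A substitute for Gronwall's inequality on short intervals. At a maximum point
  \<open>m\<close> of norm (w s) the integral contributes at most L * t \<le> 1 / 4 of that maximum,
  so norm (w m) is at most 4 / 3 of norm (w 0). The constants 2 and 1 / 2 are rounded forms.\<close>

lemma small_time_growth:
  fixes w :: "real \<Rightarrow> 'a::euclidean_space"
  assumes w: "\<And>r. r \<in> {0..t} \<Longrightarrow> (F has_integral (w r - w 0)) {0..r}" and cont: "continuous_on {0..t} w"
    and bound: "\<And>s. s \<in> {0..t} \<Longrightarrow> norm (F s) \<le> L * norm (w s)" and L: "0 \<le> L" "L * t \<le> 1 / 4"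
    and r: "r \<in> {0..t}"
  shows "norm (w r) \<le> 2 * norm (w 0)" "norm (w r - w 0) \<le> norm (w 0) / 2"
proof -
  have "0 \<le> t" using r by simp
  have "\<exists>m\<in>{0..t}. \<forall>s\<in>{0..t}. norm (w s) \<le> norm (w m)"
    using \<open>0 \<le> t\<close> by (intro continuous_attains_sup compact_Icc continuous_on_norm cont) auto
  then obtain m where m: "m \<in> {0..t}" "\<And>s. s \<in> {0..t} \<Longrightarrow> norm (w s) \<le> norm (w m)" by blast
  have dif: "norm (w s - w 0) \<le> norm (w m) / 4" if s: "s \<in> {0..t}" for s
  proof -
    have "norm (w s - w 0) \<le> (L * norm (w m)) * \<bar>s - 0\<bar>"
    proof (rule primitive_lipschitz[OF w])
      fix s assume "s \<in> {0..t}"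
      then show "norm (F s) \<le> L * norm (w m)"
        using bound[of s] mult_left_mono[OF m(2)[of s] L(1)] by linarith
    qed (use s \<open>0 \<le> t\<close> in auto)
    also have "\<dots> \<le> (L * norm (w m)) * t" using s L by (intro mult_left_mono) auto
    also have "\<dots> = (L * t) * norm (w m)" by simp
    also have "\<dots> \<le> 1 / 4 * norm (w m)" using L by (intro mult_right_mono) auto
    finally show ?thesis by simp
  qed
  have "norm (w m) \<le> norm (w 0) + norm (w m - w 0)" using norm_triangle_sub by blast
  then have wm: "norm (w m) \<le> 2 * norm (w 0)" using dif[OF m(1)] norm_ge_zero[of "w 0"] by linarith
  then show "norm (w r) \<le> 2 * norm (w 0)" using m(2)[OF r] by linarith
  show "norm (w r - w 0) \<le> norm (w 0) / 2" using wm dif[OF r] by linarith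
qed

text \<open>First exit argument: before the first time \<open>s\<close> at which the distance from
  \<open>c\<close> reaches \<open>R\<close> the speed is at most \<open>M\<close>, so the curve has
  moved by less than R / 2 and cannot have got there.\<close>

lemma traj_stays:
  assumes lb: "local_bounds f c R M L" and Y: "traj f u t Y" and Y0: "Y 0 \<in> cball c (R / 2)"
    and Mt: "M * t < R / 2" and r: "r \<in> {0..t}"
  shows "Y r \<in> cball c R"
proof (rule ccontr)
  assume "Y r \<notin> cball c R"
  have cY: "continuous_on {0..t} Y" using Y by (simp add: traj_def)
  define S where "S = {s \<in> {0..r}. R \<le> dist c (Y s)}"
  have "continuous_on {0..r} (\<lambda>s. dist c (Y s))"
    using r by (intro continuous_intros continuous_on_subset[OF cY]) auto
  then have "closed S"
    unfolding S_def by (intro closed_Collect_le continuous_closed_preimage_constant continuous_on_closed_Collect_le) auto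
  moreover have "bounded S"
    by (rule bounded_subset[OF bounded_closed_interval[of 0 r]]) (auto simp: S_def)
  ultimately have "compact S" by (simp add: compact_eq_bounded_closed)
  moreover have "r \<in> S" using r \<open>Y r \<notin> cball c R\<close> by (auto simp: S_def)
  ultimately obtain s where s: "s \<in> S" "\<And>s'. s' \<in> S \<Longrightarrow> s \<le> s'"
    using compact_attains_inf[of S] by blast
  have "s \<in> {0..t}" using s(1) r by (auto simp: S_def)
  have lt: "dist c (Y s') < R" if "s' \<in> {0..<s}" for s'
    using s(2)[of s'] that s(1) by (force simp: S_def)
  have R: "R > 0" "M > 0" using lb by (auto simp: local_bounds_def)
  have "s \<noteq> 0" using s(1) Y0 R by (auto simp: S_def)
  have "((\<lambda>s. control_field f (u s) (Y s)) has_integral (Y s - Y 0)) {0..s}"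
    using Y \<open>s \<in> {0..t}\<close> by (simp add: traj_def)
  then have "norm (Y s - Y 0) \<le> M * measure lborel {0..s}"
  proof (rule has_integral_bound_spike_finite[where S = "{s}" and a=0 and b=s, unfolded box_real, rotated 2])
    fix s' assume "s' \<in> {0..s} - {s}"
    then have "s' \<in> {0..<s}" "norm (u s') \<le> 1" using Y \<open>s \<in> {0..t}\<close> by (auto simp: traj_def)
    moreover from this have "Y s' \<in> cball c R" using lt[of s'] by simp
    ultimately show "norm (control_field f (u s') (Y s')) \<le> M"
      using lb unfolding local_bounds_def by blast
  qed (use R in auto)
  also have "\<dots> \<le> M * t" using \<open>s \<in> {0..t}\<close> R by simp
  finally have "dist c (Y s) < R"
    using Mt Y0 dist_triangle[of c "Y s" "Y 0"] by (simp add: dist_norm norm_minus_commute)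
  then show False using s(1) by (simp add: S_def)
qed

lemma traj_speed:
  assumes lb: "local_bounds f c R M L" and Y: "traj f u t Y" and "\<And>r. r \<in> {0..t} \<Longrightarrow> Y r \<in> cball c R"
    and "r \<in> {0..t}" "s \<in> {0..t}"
  shows "norm (Y r - Y s) \<le> M * \<bar>r - s\<bar>"
proof (rule primitive_lipschitz[OF _ _ assms(4,5)])
  show "((\<lambda>s. control_field f (u s) (Y s)) has_integral (Y r - Y 0)) {0..r}" if "r \<in> {0..t}" for r
    using Y that by (simp add: traj_def)
  show "norm (control_field f (u s) (Y s)) \<le> M" if "s \<in> {0..t}" for s
    using lb assms(3)[OF that] Y that unfolding local_bounds_def traj_def by blast
qed

text \<open>Composing the fields with the nearest-point projection onto the ball makes them globally
  Lipschitz, so the contraction argument applies. The speed bound keeps the solution inside the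
  ball, where the projection is the identity. No growth condition enters, at the price of a short
  time.\<close>

lemma traj_exists:
  assumes f: "\<And>i. C_infinity (f i)" and lb: "local_bounds f c R M L"
    and t: "0 \<le> t" "L * t \<le> 1 / 4" "M * t < R / 2" and x: "x \<in> cball c (R / 2)"
    and u: "u integrable_on {0..t}" "\<And>s. s \<in> {0..t} \<Longrightarrow> norm (u s) \<le> 1"
  obtains Y where "traj f u t Y" "Y 0 = x"
proof -
  have R: "R > 0" "M > 0" "L > 0" using lb by (auto simp: local_bounds_def)
  let ?\<pi> = "closest_point (cball c R)"
  have \<pi>: "?\<pi> a \<in> cball c R" for a using R by (intro closest_point_in_set) auto
  have \<pi>lip: "norm (?\<pi> a - ?\<pi> b) \<le> norm (a - b)" for a b
    using closest_point_lipschitz[of "cball c R" a b] R by (simp add: dist_norm)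
  have \<pi>cont: "continuous_on UNIV ?\<pi>" using R by (intro continuous_on_closest_point) auto
  have contf: "continuous_on UNIV (f i)" for i by (rule C_infinity_continuous[OF f])
  obtain Y where Y: "continuous_on {0..t} Y" "Y 0 = x"
    "\<And>r. r \<in> {0..t} \<Longrightarrow> ((\<lambda>s. control_field f (u s) (?\<pi> (Y s))) has_integral (Y r - Y 0)) {0..r}"
  proof (rule picard_solution_exists[of t L "\<lambda>s a. control_field f (u s) (?\<pi> a)" x])
    show "norm (control_field f (u s) (?\<pi> a) - control_field f (u s) (?\<pi> b)) \<le> L * norm (a - b)"
      if "s \<in> {0..t}" for s a b
    proof -
      have "norm (control_field f (u s) (?\<pi> a) - control_field f (u s) (?\<pi> b)) \<le> L * norm (?\<pi> a - ?\<pi> b)"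
        using lb u(2)[OF that] \<pi> unfolding local_bounds_def by blast
      also have "\<dots> \<le> L * norm (a - b)" using \<pi>lip R by (intro mult_left_mono) auto
      finally show ?thesis .
    qed
    show "(\<lambda>s. control_field f (u s) (?\<pi> (y s))) integrable_on {0..t}" if "continuous_on {0..t} y" for y
      using u contf continuous_on_compose2[OF \<pi>cont that] by (intro integrable_control_field) auto
  qed (use t R in auto)
  have stay: "?\<pi> (Y r) = Y r" if r: "r \<in> {0..t}" for r
  proof (rule closest_point_self)
    have "norm (Y r - Y 0) \<le> M * \<bar>r - 0\<bar>"
    proof (rule primitive_lipschitz[OF Y(3) _ r])
      show "norm (control_field f (u s) (?\<pi> (Y s))) \<le> M" if "s \<in> {0..t}" for s
        using lb u(2)[OF that] \<pi> unfolding local_bounds_def by blast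
    qed (use t in auto)
    also have "\<dots> \<le> M * t" using r R by simp
    finally show "Y r \<in> cball c R"
      using t x Y(2) dist_triangle[of c "Y r" "Y 0"] by (simp add: dist_norm norm_minus_commute)
  qed
  have "traj f u t Y"
    unfolding traj_def
  proof (intro conjI ballI u Y(1))
    fix r assume r: "r \<in> {0..t}"
    show "((\<lambda>s. control_field f (u s) (Y s)) has_integral (Y r - Y 0)) {0..r}"
      by (rule has_integral_eq[OF _ Y(3)[OF r]]) (use stay r in auto)
  qed
  then show ?thesis using Y(2) by (rule that)
qed

text \<open>The second estimate follows because the difference changes by at most half of its
  initial norm. It lets distances at the start of a trajectory be measured at its end, which is how
  the transport estimates use it.\<close>

lemma traj_dependence:
  assumes lb: "local_bounds f c R M L" and Y: "traj f u t Y" and Z: "traj f u t Z" and Lt: "L * t \<le> 1 / 4"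
    and YR: "\<And>r. r \<in> {0..t} \<Longrightarrow> Y r \<in> cball c R" and ZR: "\<And>r. r \<in> {0..t} \<Longrightarrow> Z r \<in> cball c R"
    and r: "r \<in> {0..t}"
  shows "norm (Z r - Y r) \<le> 2 * norm (Z 0 - Y 0)" "norm (Z 0 - Y 0) \<le> 2 * norm (Z r - Y r)"
proof -
  let ?w = "\<lambda>r. Z r - Y r" and ?F = "\<lambda>s. control_field f (u s) (Z s) - control_field f (u s) (Y s)"
  have cont: "continuous_on {0..t} ?w" using Y Z by (auto simp: traj_def intro!: continuous_intros)
  have int: "(?F has_integral (?w r - ?w 0)) {0..r}" if "r \<in> {0..t}" for r
  proof -
    have "(?F has_integral ((Z r - Z 0) - (Y r - Y 0))) {0..r}"
      using Y Z that by (intro has_integral_diff) (auto simp: traj_def)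
    then show ?thesis by (simp add: algebra_simps)
  qed
  have bound: "norm (?F s) \<le> L * norm (?w s)" if "s \<in> {0..t}" for s
    using lb YR[OF that] ZR[OF that] Y that unfolding local_bounds_def traj_def by blast
  have "0 \<le> L" using lb by (simp add: local_bounds_def)
  note g = small_time_growth[OF int cont bound this Lt r]
  show "norm (Z r - Y r) \<le> 2 * norm (Z 0 - Y 0)" by (rule g(1))
  show "norm (Z 0 - Y 0) \<le> 2 * norm (Z r - Y r)"
    using g(2) norm_triangle_ineq2[of "?w 0" "?w r"] by (simp add: norm_minus_commute)
qed

text \<open>The covector \<open>\<zeta>\<close> is transported by the adjoint equation along \<open>Y\<close>; this linearises the flow of
  the (merely measurable) control up to a quadratic error.\<close>

lemma adjoint_transport:
  assumes f: "\<And>i. C_infinity (f i)" and lb: "local_bounds f c R M L" and Y: "traj f u t Y"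
    and Lt: "L * t \<le> 1 / 4" and "0 \<le> t" and YR: "\<And>r. r \<in> {0..t} \<Longrightarrow> Y r \<in> cball c R"
  obtains p where "norm (p - \<zeta>) \<le> norm \<zeta> / 2"
    "\<And>Z. traj f u t Z \<Longrightarrow> (\<And>r. r \<in> {0..t} \<Longrightarrow> Z r \<in> cball c R) \<Longrightarrow>
      \<bar>p \<bullet> (Z t - Y t) - \<zeta> \<bullet> (Z 0 - Y 0)\<bar> \<le> 8 * norm \<zeta> * (norm (Z t - Y t))\<^sup>2"
proof -
  have R: "R > 0" "M > 0" "L > 0" using lb by (auto simp: local_bounds_def)
  have u: "u integrable_on {0..t}" "\<And>s. s \<in> {0..t} \<Longrightarrow> norm (u s) \<le> 1" and cY: "continuous_on {0..t} Y"
    using Y by (auto simp: traj_def)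
  \<comment> \<open>With the minus sign the pairing of \<open>P\<close> with a solution of the
    linearised equation is constant in time.\<close>
  define G where "G s a = - control_field_adjoint f (u s) (Y s) a" for s a
  have Gb: "norm (G s a) \<le> L * norm a" if "s \<in> {0..t}" for s a
    unfolding G_def norm_minus_cancel by (rule norm_control_field_adjoint[OF f lb u(2)[OF that] YR[OF that]])
  obtain P where P: "continuous_on {0..t} P" "P 0 = \<zeta>"
    "\<And>r. r \<in> {0..t} \<Longrightarrow> ((\<lambda>s. G s (P s)) has_integral (P r - P 0)) {0..r}"
  proof (rule picard_solution_exists[of t L G \<zeta>])
    show "norm (G s a - G s b) \<le> L * norm (a - b)" if "s \<in> {0..t}" for s a b
    proof -
      have "G s a - G s b = G s (a - b)"
        by (simp add: G_def control_field_adjoint_def inner_diff_left scaleR_diff_left scaleR_diff_right sum_subtractf)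
      then show ?thesis using Gb[OF that, of "a - b"] by simp
    qed
    show "(\<lambda>s. G s (y s)) integrable_on {0..t}" if y: "continuous_on {0..t} y" for y
      unfolding G_def control_field_adjoint_def
    proof (intro integrable_neg integrable_sum finite integrable_scaleR_continuous u)
      fix i
      have "continuous_on {0..t} (\<lambda>s. frechet_derivative (f i) (at (Y s)) b)" for b
        by (rule continuous_on_compose2[OF C_infinity_continuous[OF C_infinity_directional[OF f]] cY]) auto
      then show "continuous_on {0..t} (\<lambda>s. \<Sum>b\<in>Basis. (y s \<bullet> frechet_derivative (f i) (at (Y s)) b) *\<^sub>R b)"
        using y by (intro continuous_intros) auto
    qed
  qed (use Lt R \<open>0 \<le> t\<close> in auto)
  have P2: "norm (P r) \<le> 2 * norm \<zeta>" "norm (P r - \<zeta>) \<le> norm \<zeta> / 2" if "r \<in> {0..t}" for r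
    using small_time_growth[OF P(3) P(1) Gb less_imp_le[OF R(3)] Lt that] P(2) by auto
  have Plip: "norm (P r - P s) \<le> (L * (2 * norm \<zeta>)) * \<bar>r - s\<bar>" if "r \<in> {0..t}" "s \<in> {0..t}" for r s
  proof (rule primitive_lipschitz[OF P(3) _ that])
    show "norm (G s (P s)) \<le> L * (2 * norm \<zeta>)" if "s \<in> {0..t}" for s
      using Gb[OF that, of "P s"] mult_left_mono[OF P2(1)[OF that], of L] R by linarith
  qed
  show ?thesis
  proof (rule that[of "P t"])
    show "norm (P t - \<zeta>) \<le> norm \<zeta> / 2" using P2(2)[of t] \<open>0 \<le> t\<close> by simp
    fix Z assume Z: "traj f u t Z" and ZR: "\<And>r. r \<in> {0..t} \<Longrightarrow> Z r \<in> cball c R"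
    have dep: "norm (Z r - Y r) \<le> 2 * norm (Z 0 - Y 0)" "norm (Z 0 - Y 0) \<le> 2 * norm (Z r - Y r)" if "r \<in> {0..t}" for r
      by (rule traj_dependence[OF lb Y Z Lt YR ZR that]; assumption)+
    define w where "w r = Z r - Y r" for r
    \<comment> \<open>The pairing \<open>d\<close> would be constant if \<open>w\<close> solved the
      linearised equation. Its derivative \<open>g\<close> exists almost everywhere, and the adjoint
      term in \<open>g\<close> cancels the linear part of the difference of the fields.\<close>
    define d where "d r = P r \<bullet> w r" for r
    define g where "g s = P s \<bullet> (control_field f (u s) (Z s) - control_field f (u s) (Y s)) + G s (P s) \<bullet> w s" for s
    have wb: "norm (w r) \<le> 4 * norm (w t)" if "r \<in> {0..t}" for r
      using dep(1)[OF that] dep(2)[of t] \<open>0 \<le> t\<close> by (simp add: w_def)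
    have wlip: "norm (w r - w s) \<le> (2 * M) * \<bar>r - s\<bar>" if "r \<in> {0..t}" "s \<in> {0..t}" for r s
    proof -
      have "norm (Z r - Z s) \<le> M * \<bar>r - s\<bar>" "norm (Y r - Y s) \<le> M * \<bar>r - s\<bar>"
        using traj_speed[OF lb Z ZR] traj_speed[OF lb Y YR] that by auto
      moreover have "w r - w s = (Z r - Z s) - (Y r - Y s)" by (simp add: w_def)
      ultimately show ?thesis using norm_triangle_ineq4[of "Z r - Z s" "Y r - Y s"] by simp
    qed
    have "abs_continuous_on_interval 0 t d"
    proof (rule lipschitz_imp_abs_continuous)
      let ?C = "2 * norm \<zeta> * (2 * M) + L * (2 * norm \<zeta>) * (4 * norm (w t)) + 1"
      show "0 < ?C" using R by (intro add_nonneg_pos add_nonneg_nonneg mult_nonneg_nonneg) auto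
      fix r s assume rs: "r \<in> {0..t}" "s \<in> {0..t}"
      have "d r - d s = P r \<bullet> (w r - w s) + (P r - P s) \<bullet> w s"
        by (simp add: d_def inner_diff_left inner_diff_right)
      also have "norm \<dots> \<le> norm (P r) * norm (w r - w s) + norm (P r - P s) * norm (w s)"
        by (intro norm_triangle_le add_mono) (simp_all add: Cauchy_Schwarz_ineq2)
      also have "\<dots> \<le> (2 * norm \<zeta>) * (2 * M * \<bar>r - s\<bar>) + (L * (2 * norm \<zeta>) * \<bar>r - s\<bar>) * (4 * norm (w t))"
        using P2(1)[OF rs(1)] wlip[OF rs] Plip[OF rs] wb[OF rs(2)] R
        by (intro add_mono mult_mono) auto
      also have "\<dots> \<le> ?C * \<bar>r - s\<bar>" by (simp add: algebra_simps)
      finally show "norm (d r - d s) \<le> ?C * \<bar>r - s\<bar>" .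
    qed
    moreover
    have intZ: "((\<lambda>s. control_field f (u s) (Z s)) has_integral (Z r - Z 0)) {0..r}"
      and intY: "((\<lambda>s. control_field f (u s) (Y s)) has_integral (Y r - Y 0)) {0..r}" if "r \<in> {0..t}" for r
      using Y Z that by (auto simp: traj_def)
    obtain S1 where S1: "negligible S1"
      "\<And>s. s \<in> {0..t} - S1 \<Longrightarrow> (Z has_vector_derivative control_field f (u s) (Z s)) (at s within {0..t})"
      by (rule primitive_has_derivative_ae[OF intZ \<open>0 \<le> t\<close>]) (assumption | blast)+
    obtain S2 where S2: "negligible S2"
      "\<And>s. s \<in> {0..t} - S2 \<Longrightarrow> (Y has_vector_derivative control_field f (u s) (Y s)) (at s within {0..t})"
      by (rule primitive_has_derivative_ae[OF intY \<open>0 \<le> t\<close>]) (assumption | blast)+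
    obtain S3 where S3: "negligible S3"
      "\<And>s. s \<in> {0..t} - S3 \<Longrightarrow> (P has_vector_derivative G s (P s)) (at s within {0..t})"
      by (rule primitive_has_derivative_ae[OF P(3) \<open>0 \<le> t\<close>]) (assumption | blast)+
    have "negligible (S1 \<union> S2 \<union> S3)" using S1 S2 S3 by (intro negligible_Un)
    moreover have "(d has_vector_derivative g s) (at s within {0..t})" if s: "s \<in> {0..t} - (S1 \<union> S2 \<union> S3)" for s
    proof -
      have "(w has_vector_derivative control_field f (u s) (Z s) - control_field f (u s) (Y s)) (at s within {0..t})"
        unfolding w_def using s by (intro has_vector_derivative_diff S1(2) S2(2)) auto
      moreover have "(P has_vector_derivative G s (P s)) (at s within {0..t})" using s by (intro S3(2)) auto
      ultimately show ?thesis
        unfolding d_def g_def by (intro bounded_bilinear.has_vector_derivative[OF bounded_bilinear_inner])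
    qed
    ultimately have int: "(g has_integral (d t - d 0)) {0..t}"
      by (intro fundamental_theorem_of_calculus_abs_continuous[OF \<open>0 \<le> t\<close>])
    \<comment> \<open>After that cancellation only the Taylor remainder is left. The factor 32 is 2
      for \<open>P\<close> times 4 squared for \<open>w\<close>; multiplied by L * t \<le> 1 / 4 it
      becomes the 8 of the statement.\<close>
    have gb: "norm (g s) \<le> 32 * L * norm \<zeta> * (norm (w t))\<^sup>2" if s: "s \<in> {0..t}" for s
    proof -
      have "G s (P s) \<bullet> w s = - (P s \<bullet> control_field_deriv f (u s) (Y s) (w s))"
        by (simp add: G_def inner_control_field_adjoint[OF f])
      then have "g s = P s \<bullet> (control_field f (u s) (Z s) - control_field f (u s) (Y s) - control_field_deriv f (u s) (Y s) (Z s - Y s))"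
        by (simp add: g_def w_def inner_diff_right)
      then have "norm (g s) \<le> norm (P s) * norm (control_field f (u s) (Z s) - control_field f (u s) (Y s) - control_field_deriv f (u s) (Y s) (Z s - Y s))"
        by (simp add: Cauchy_Schwarz_ineq2)
      also have "\<dots> \<le> (2 * norm \<zeta>) * (L * (norm (w s))\<^sup>2)"
        using lb YR[OF s] ZR[OF s] u(2)[OF s] P2(1)[OF s] unfolding local_bounds_def w_def by (intro mult_mono) auto
      also have "\<dots> \<le> (2 * norm \<zeta>) * (L * (4 * norm (w t))\<^sup>2)"
        using wb[OF s] R by (intro mult_left_mono power_mono) auto
      finally show ?thesis by (simp add: power_mult_distrib mult_ac)
    qed
    have "norm (d t - d 0) \<le> 32 * L * norm \<zeta> * (norm (w t))\<^sup>2 * measure lborel {0..t}"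
      by (rule has_integral_bound_real[OF _ finite.emptyI int]) (use gb R in auto)
    also have "\<dots> = (L * t) * (32 * norm \<zeta> * (norm (w t))\<^sup>2)" using \<open>0 \<le> t\<close> by (simp add: mult_ac)
    also have "\<dots> \<le> 1 / 4 * (32 * norm \<zeta> * (norm (w t))\<^sup>2)" using Lt by (intro mult_right_mono) auto
    finally show "\<bar>P t \<bullet> (Z t - Y t) - \<zeta> \<bullet> (Z 0 - Y 0)\<bar> \<le> 8 * norm \<zeta> * (norm (Z t - Y t))\<^sup>2"
      using P(2) by (simp add: d_def w_def)
  qed
qed

section \<open>Asymptotic expansions of families of maps\<close>

text \<open>The time 0 belongs to the region of this filter. An estimate norm (\<phi> \<tau> y - y)
  \<le> C * \<tau> along it therefore forces \<open>\<phi> 0\<close> to be the identity near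
  \<open>c\<close>.\<close>

definition near0 :: "'a::real_normed_vector \<Rightarrow> (real \<times> 'a) filter" where
  "near0 c = inf (nhds (0, c)) (principal ({0..} \<times> UNIV))"

lemma eventually_near0:
  "eventually P (near0 c) \<longleftrightarrow> (\<exists>\<delta>>0. \<forall>\<tau>\<in>{0..\<delta>}. \<forall>y\<in>cball c \<delta>. P (\<tau>, y))"
proof
  assume "eventually P (near0 c)"
  then have "eventually (\<lambda>q. q \<in> {0..} \<times> UNIV \<longrightarrow> P q) (nhds (0, c))"
    by (simp add: near0_def eventually_inf_principal)
  then obtain d where d: "d > 0" "\<And>q. dist q (0, c) < d \<Longrightarrow> q \<in> {0..} \<times> UNIV \<Longrightarrow> P q"
    unfolding eventually_nhds_metric by blast
  show "\<exists>\<delta>>0. \<forall>\<tau>\<in>{0..\<delta>}. \<forall>y\<in>cball c \<delta>. P (\<tau>, y)"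
  proof (intro exI[of _ "d / 3"] conjI ballI)
    fix \<tau> y assume *: "\<tau> \<in> {0..d / 3}" "y \<in> cball c (d / 3)"
    have "dist (\<tau>, y) (0, c) \<le> dist \<tau> 0 + dist y c"
      using sqrt_sum_squares_le_sum[of "dist \<tau> 0" "dist y c"] by (simp add: dist_Pair_Pair)
    also have "\<dots> < d" using * d(1) by (simp add: dist_commute)
    finally show "P (\<tau>, y)" using d(2)[of "(\<tau>, y)"] * by simp
  qed (use d in simp)
next
  assume "\<exists>\<delta>>0. \<forall>\<tau>\<in>{0..\<delta>}. \<forall>y\<in>cball c \<delta>. P (\<tau>, y)"
  then obtain \<delta> where d: "\<delta> > 0" "\<And>\<tau> y. \<tau> \<in> {0..\<delta>} \<Longrightarrow> y \<in> cball c \<delta> \<Longrightarrow> P (\<tau>, y)" by blast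
  have "eventually (\<lambda>q. q \<in> {0..} \<times> UNIV \<longrightarrow> P q) (nhds (0, c))"
    unfolding eventually_nhds_metric
  proof (intro exI[of _ \<delta>] conjI allI impI d(1))
    fix q :: "real \<times> 'a" assume q: "dist q (0, c) < \<delta>" "q \<in> {0..} \<times> UNIV"
    obtain \<tau> y where [simp]: "q = (\<tau>, y)" by force
    have "dist \<tau> 0 < \<delta>" "dist y c < \<delta>"
      using q(1) dist_fst_le[of q "(0, c)"] dist_snd_le[of q "(0, c)"] by auto
    then show "P q" using q(2) d(2)[of \<tau> y] by (simp add: dist_commute)
  qed
  then show "eventually P (near0 c)" by (simp add: near0_def eventually_inf_principal)
qed

definition tame :: "'a::real_normed_vector \<Rightarrow> (real \<Rightarrow> 'a \<Rightarrow> 'a) \<Rightarrow> bool" where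
  "tame c \<phi> \<longleftrightarrow> (\<exists>C. \<forall>\<^sub>F (\<tau>, y) in near0 c. norm (\<phi> \<tau> y - y) \<le> C * \<tau>)"

lemma near0_small:
  assumes "d > 0"
  shows "\<forall>\<^sub>F (\<tau>, y) in near0 c. 0 \<le> \<tau> \<and> \<tau> \<le> d \<and> y \<in> cball c d"
  unfolding eventually_near0 using assms by (intro exI[of _ d]) auto

text \<open>A displacement of order \<tau> keeps (\<tau>, \<phi> \<tau> y) near (0, c), so estimates
  valid near (0, c) may be evaluated at \<phi> \<tau> y. This is what allows expansions to be
  composed.\<close>

lemma tame_eventually:
  assumes \<phi>: "tame c \<phi>" and P: "\<forall>\<^sub>F (\<tau>, y) in near0 c. P \<tau> y"
  shows "\<forall>\<^sub>F (\<tau>, y) in near0 c. P \<tau> (\<phi> \<tau> y)"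
proof -
  obtain C where C: "\<forall>\<^sub>F (\<tau>, y) in near0 c. norm (\<phi> \<tau> y - y) \<le> C * \<tau>" using \<phi> by (auto simp: tame_def)
  obtain \<delta> where d: "\<delta> > 0" "\<And>\<tau> y. \<tau> \<in> {0..\<delta>} \<Longrightarrow> y \<in> cball c \<delta> \<Longrightarrow> P \<tau> y"
    using P unfolding eventually_near0 by auto
  \<comment> \<open>Half of \<delta> is left for the distance of \<open>y\<close> from
    \<open>c\<close> and half for the displacement. The absolute value covers a negative
    \<open>C\<close>, and the + 1 avoids division by zero.\<close>
  define e where "e = min (\<delta> / 2) (\<delta> / (2 * (\<bar>C\<bar> + 1)))"
  have e: "e > 0" "e \<le> \<delta> / 2" "(\<bar>C\<bar> + 1) * e \<le> \<delta> / 2"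
  proof -
    have "(\<bar>C\<bar> + 1) * e \<le> (\<bar>C\<bar> + 1) * (\<delta> / (2 * (\<bar>C\<bar> + 1)))" by (intro mult_left_mono) (auto simp: e_def)
    also have "\<dots> = \<delta> / 2" by (simp add: field_simps add_pos_nonneg)
    finally show "(\<bar>C\<bar> + 1) * e \<le> \<delta> / 2" .
    show "e \<le> \<delta> / 2" unfolding e_def by (rule min.cobounded1)
    show "e > 0" using d(1) by (auto simp: e_def)
  qed
  show ?thesis
    using C near0_small[OF e(1), of c]
  proof eventually_elim
    case (elim q)
    obtain \<tau> y where [simp]: "q = (\<tau>, y)" by force
    have \<tau>: "0 \<le> \<tau>" "\<tau> \<le> e" and y: "dist c y \<le> e" using elim by auto
    have "norm (\<phi> \<tau> y - y) \<le> C * \<tau>" using elim by simp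
    also have "\<dots> \<le> (\<bar>C\<bar> + 1) * \<tau>" using \<tau> by (intro mult_right_mono) auto
    also have "\<dots> \<le> (\<bar>C\<bar> + 1) * e" using \<tau> by (intro mult_left_mono) auto
    finally have "dist y (\<phi> \<tau> y) \<le> \<delta> / 2" using e by (simp add: dist_norm norm_minus_commute)
    then have "dist c (\<phi> \<tau> y) \<le> \<delta>" using y e dist_triangle[of c "\<phi> \<tau> y" y] by linarith
    then show ?case using d(2)[of \<tau> "\<phi> \<tau> y"] \<tau> e d(1) by simp
  qed
qed

text \<open>The coefficients act on all smooth maps, not only on the identity, so that they can be
  composed. Instead of linearity of \<open>A j\<close> only preservation of the zero map is
  demanded, which is what the cancellation of low-order terms uses.\<close>

definition expands ::
  "'a::euclidean_space \<Rightarrow> (real \<Rightarrow> 'a \<Rightarrow> 'a) \<Rightarrow> (nat \<Rightarrow> ('a \<Rightarrow> 'a) \<Rightarrow> 'a \<Rightarrow> 'a) \<Rightarrow> bool" where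
  "expands c \<phi> A \<longleftrightarrow> (\<forall>j. A j (\<lambda>_. 0) = (\<lambda>_. 0)) \<and>
     (\<forall>g. C_infinity g \<longrightarrow> A 0 g = g \<and> (\<forall>j. C_infinity (A j g)) \<and>
       (\<forall>r. \<exists>C. \<forall>\<^sub>F (\<tau>, y) in near0 c. norm (g (\<phi> \<tau> y) - (\<Sum>j\<le>r. \<tau> ^ j *\<^sub>R A j g y)) \<le> C * \<tau> ^ Suc r))"

lemma C_infinity_ident: "C_infinity (\<lambda>x. x)"
  by (rule C_infinity_bounded_linear[OF bounded_linear_ident])

lemma expands_tame:
  assumes "expands c \<phi> A" shows "tame c \<phi>"
proof -
  have "A 0 (\<lambda>x. x) = (\<lambda>x. x)"
    "\<exists>C. \<forall>\<^sub>F (\<tau>, y) in near0 c. norm (\<phi> \<tau> y - (\<Sum>j\<le>0. \<tau> ^ j *\<^sub>R A j (\<lambda>x. x) y)) \<le> C * \<tau> ^ Suc 0"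
    using assms C_infinity_ident unfolding expands_def by blast+
  then show ?thesis by (simp add: tame_def)
qed

lemma eventually_sum_bound:
  fixes h :: "nat \<Rightarrow> real \<times> 'a \<Rightarrow> 'b::real_normed_vector"
  assumes "\<And>j. j \<le> r \<Longrightarrow> \<exists>C. eventually (\<lambda>q. norm (h j q) \<le> C * \<rho> q) F"
  shows "\<exists>C. eventually (\<lambda>q. norm (\<Sum>j\<le>r. h j q) \<le> C * \<rho> q) F"
  using assms
proof (induction r)
  case 0
  then show ?case by simp
next
  case (Suc r)
  have "\<exists>C. eventually (\<lambda>q. norm (\<Sum>j\<le>r. h j q) \<le> C * \<rho> q) F"
    by (rule Suc.IH) (simp add: Suc.prems)
  then obtain C1 where C1: "eventually (\<lambda>q. norm (\<Sum>j\<le>r. h j q) \<le> C1 * \<rho> q) F" ..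
  obtain C2 where C2: "eventually (\<lambda>q. norm (h (Suc r) q) \<le> C2 * \<rho> q) F"
    using Suc.prems[of "Suc r"] by auto
  from C1 C2 have "eventually (\<lambda>q. norm (\<Sum>j\<le>Suc r. h j q) \<le> (C1 + C2) * \<rho> q) F"
    by eventually_elim (simp add: distrib_right norm_triangle_le)
  then show ?case by blast
qed

text \<open>Expand \<open>g\<close> along \<phi> at the point \<psi> \<tau> y first, and then each
  coefficient \<open>A j g\<close> along \<psi>; hence the operators appear in the opposite order to
  the maps. The inner expansion is needed only up to r - j because of the factor \<tau> ^ j.\<close>

lemma expands_compose:
  assumes \<phi>: "expands c \<phi> A" and \<psi>: "expands c \<psi> B"
  shows "expands c (\<lambda>\<tau> y. \<phi> \<tau> (\<psi> \<tau> y)) (\<lambda>k g y. \<Sum>j\<le>k. B (k - j) (A j g) y)"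
  unfolding expands_def
proof (intro conjI allI impI)
  fix k show "(\<lambda>y. \<Sum>j\<le>k. B (k - j) (A j (\<lambda>_. 0)) y) = (\<lambda>_. 0)"
    using \<phi> \<psi> by (simp add: expands_def)
next
  fix g :: "'a \<Rightarrow> 'a" assume g: "C_infinity g"
  have A: "A 0 g = g" "\<And>j. C_infinity (A j g)" using \<phi> g by (auto simp: expands_def)
  then show "(\<lambda>y. \<Sum>j\<le>0. B (0 - j) (A j g) y) = g" using \<psi> g by (simp add: expands_def)
  show "C_infinity (\<lambda>y. \<Sum>j\<le>k. B (k - j) (A j g) y)" for k
    using \<psi> A by (intro C_infinity_sum) (auto simp: expands_def)
  fix r
  have "\<exists>C. \<forall>\<^sub>F (\<tau>, y) in near0 c. norm (g (\<phi> \<tau> y) - (\<Sum>j\<le>r. \<tau> ^ j *\<^sub>R A j g y)) \<le> C * \<tau> ^ Suc r"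
    using \<phi> g unfolding expands_def by blast
  then obtain C1 where C1: "\<forall>\<^sub>F (\<tau>, y) in near0 c. norm (g (\<phi> \<tau> y) - (\<Sum>j\<le>r. \<tau> ^ j *\<^sub>R A j g y)) \<le> C1 * \<tau> ^ Suc r" ..
  have 1: "\<forall>\<^sub>F (\<tau>, y) in near0 c. norm (g (\<phi> \<tau> (\<psi> \<tau> y)) - (\<Sum>j\<le>r. \<tau> ^ j *\<^sub>R A j g (\<psi> \<tau> y))) \<le> C1 * \<tau> ^ Suc r"
    by (rule tame_eventually[OF expands_tame[OF \<psi>] C1])
  have "\<exists>C. eventually (\<lambda>q. norm (\<Sum>j\<le>r. fst q ^ j *\<^sub>R (A j g (\<psi> (fst q) (snd q)) - (\<Sum>i\<le>r - j. fst q ^ i *\<^sub>R B i (A j g) (snd q)))) \<le> C * fst q ^ Suc r) (near0 c)"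
  proof (rule eventually_sum_bound)
    fix j assume j: "j \<le> r"
    have "\<exists>C. \<forall>\<^sub>F (\<tau>, y) in near0 c. norm (A j g (\<psi> \<tau> y) - (\<Sum>i\<le>r - j. \<tau> ^ i *\<^sub>R B i (A j g) y)) \<le> C * \<tau> ^ Suc (r - j)"
      using \<psi> A(2) unfolding expands_def by blast
    then obtain C where C: "\<forall>\<^sub>F (\<tau>, y) in near0 c. norm (A j g (\<psi> \<tau> y) - (\<Sum>i\<le>r - j. \<tau> ^ i *\<^sub>R B i (A j g) y)) \<le> C * \<tau> ^ Suc (r - j)" ..
    have "eventually (\<lambda>q. norm (fst q ^ j *\<^sub>R (A j g (\<psi> (fst q) (snd q)) - (\<Sum>i\<le>r - j. fst q ^ i *\<^sub>R B i (A j g) (snd q)))) \<le> C * fst q ^ Suc r) (near0 c)"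
      using C near0_small[OF zero_less_one, of c]
    proof eventually_elim
      case (elim q)
      obtain \<tau> y where [simp]: "q = (\<tau>, y)" by force
      have "\<tau> ^ j * norm (A j g (\<psi> \<tau> y) - (\<Sum>i\<le>r - j. \<tau> ^ i *\<^sub>R B i (A j g) y)) \<le> \<tau> ^ j * (C * \<tau> ^ Suc (r - j))"
        using elim by (intro mult_left_mono) auto
      also have "\<dots> = C * \<tau> ^ (j + Suc (r - j))" by (simp only: power_add mult_ac)
      also have "j + Suc (r - j) = Suc r" using j by simp
      finally show ?case using elim by simp
    qed
    then show "\<exists>C. eventually (\<lambda>q. norm (fst q ^ j *\<^sub>R (A j g (\<psi> (fst q) (snd q)) - (\<Sum>i\<le>r - j. fst q ^ i *\<^sub>R B i (A j g) (snd q)))) \<le> C * fst q ^ Suc r) (near0 c)" by blast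
  qed
  then obtain C2 where C2: "eventually (\<lambda>q. norm (\<Sum>j\<le>r. fst q ^ j *\<^sub>R (A j g (\<psi> (fst q) (snd q)) - (\<Sum>i\<le>r - j. fst q ^ i *\<^sub>R B i (A j g) (snd q)))) \<le> C2 * fst q ^ Suc r) (near0 c)" ..
  have reindex: "(\<Sum>j\<le>r. \<tau> ^ j *\<^sub>R (\<Sum>i\<le>r - j. \<tau> ^ i *\<^sub>R B i (A j g) y)) = (\<Sum>k\<le>r. \<tau> ^ k *\<^sub>R (\<Sum>j\<le>k. B (k - j) (A j g) y))" for \<tau> y
  proof -
    have "(\<Sum>j\<le>r. \<tau> ^ j *\<^sub>R (\<Sum>i\<le>r - j. \<tau> ^ i *\<^sub>R B i (A j g) y)) = (\<Sum>j\<le>r. \<Sum>i\<le>r - j. \<tau> ^ (j + i) *\<^sub>R B i (A j g) y)"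
      by (simp add: scaleR_sum_right power_add)
    also have "\<dots> = (\<Sum>(j, i)\<in>{(j, i). j + i \<le> r}. \<tau> ^ (j + i) *\<^sub>R B i (A j g) y)"
      by (subst sum.Sigma) (auto intro!: sum.cong)
    also have "\<dots> = (\<Sum>k\<le>r. \<Sum>j\<le>k. \<tau> ^ (j + (k - j)) *\<^sub>R B (k - j) (A j g) y)"
      by (rule sum.triangle_reindex_eq)
    also have "\<dots> = (\<Sum>k\<le>r. \<tau> ^ k *\<^sub>R (\<Sum>j\<le>k. B (k - j) (A j g) y))"
      by (intro sum.cong refl) (simp add: scaleR_sum_right)
    finally show ?thesis .
  qed
  have "\<forall>\<^sub>F (\<tau>, y) in near0 c. norm (g (\<phi> \<tau> (\<psi> \<tau> y)) - (\<Sum>k\<le>r. \<tau> ^ k *\<^sub>R (\<Sum>j\<le>k. B (k - j) (A j g) y))) \<le> (C1 + C2) * \<tau> ^ Suc r"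
    using 1 C2
  proof eventually_elim
    case (elim q)
    obtain \<tau> y where [simp]: "q = (\<tau>, y)" by force
    have "g (\<phi> \<tau> (\<psi> \<tau> y)) - (\<Sum>k\<le>r. \<tau> ^ k *\<^sub>R (\<Sum>j\<le>k. B (k - j) (A j g) y)) =
       (g (\<phi> \<tau> (\<psi> \<tau> y)) - (\<Sum>j\<le>r. \<tau> ^ j *\<^sub>R A j g (\<psi> \<tau> y))) +
       (\<Sum>j\<le>r. \<tau> ^ j *\<^sub>R (A j g (\<psi> \<tau> y) - (\<Sum>i\<le>r - j. \<tau> ^ i *\<^sub>R B i (A j g) y)))"
      unfolding reindex[symmetric] by (simp add: scaleR_diff_right sum_subtractf)
    also have "norm \<dots> \<le> C1 * \<tau> ^ Suc r + C2 * \<tau> ^ Suc r"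
      using elim by (intro norm_triangle_mono) auto
    finally show ?case by (simp add: distrib_right)
  qed
  then show "\<exists>C. \<forall>\<^sub>F (\<tau>, y) in near0 c. norm (g (\<phi> \<tau> (\<psi> \<tau> y)) - (\<Sum>k\<le>r. \<tau> ^ k *\<^sub>R (\<Sum>j\<le>k. B (k - j) (A j g) y))) \<le> C * \<tau> ^ Suc r" by blast
qed

text \<open>Uniqueness of asymptotic expansions: letting \<tau> tend to 0 kills the constant term,
  and after division by \<tau> the same estimate holds for the shifted coefficients with one order
  less.\<close>

lemma polynomial_coefficients_zero:
  fixes a :: "nat \<Rightarrow> 'a::real_normed_vector"
  assumes "\<delta> > 0" "\<And>\<tau>. 0 < \<tau> \<Longrightarrow> \<tau> \<le> \<delta> \<Longrightarrow> norm (\<Sum>j\<le>r. \<tau> ^ j *\<^sub>R a j) \<le> C * \<tau> ^ Suc r" "j \<le> r"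
  shows "a j = 0"
  using assms(2,3)
proof (induction r arbitrary: a j)
  case 0
  have "norm (a 0) \<le> 0"
  proof (rule tendsto_lowerbound)
    show "((\<lambda>\<tau>. C * \<tau>) \<longlongrightarrow> 0) (at_right 0)" by (auto intro!: tendsto_eq_intros)
    show "\<forall>\<^sub>F \<tau> in at_right 0. norm (a 0) \<le> C * \<tau>"
      unfolding eventually_at_right_field using 0 \<open>\<delta> > 0\<close> by (intro exI[of _ \<delta>]) auto
  qed simp
  then show ?case using 0 by simp
next
  case (Suc r)
  have split: "(\<Sum>j\<le>Suc r. \<tau> ^ j *\<^sub>R a j) = a 0 + \<tau> *\<^sub>R (\<Sum>j\<le>r. \<tau> ^ j *\<^sub>R a (Suc j))" for \<tau>
    by (subst sum.atMost_Suc_shift) (simp add: scaleR_sum_right)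
  have "norm (a 0) \<le> 0"
  proof (rule tendsto_lowerbound)
    show "((\<lambda>\<tau>. C * \<tau> ^ Suc (Suc r) + norm (\<tau> *\<^sub>R (\<Sum>j\<le>r. \<tau> ^ j *\<^sub>R a (Suc j)))) \<longlongrightarrow> 0) (at_right 0)"
      by (auto intro!: tendsto_eq_intros)
    show "\<forall>\<^sub>F \<tau> in at_right 0. norm (a 0) \<le> C * \<tau> ^ Suc (Suc r) + norm (\<tau> *\<^sub>R (\<Sum>j\<le>r. \<tau> ^ j *\<^sub>R a (Suc j)))"
      unfolding eventually_at_right_field
    proof (intro exI[of _ \<delta>] conjI allI impI \<open>\<delta> > 0\<close>)
      fix \<tau> assume "0 < \<tau>" "\<tau> < \<delta>"
      then have "norm (a 0 + \<tau> *\<^sub>R (\<Sum>j\<le>r. \<tau> ^ j *\<^sub>R a (Suc j))) \<le> C * \<tau> ^ Suc (Suc r)"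
        using Suc.prems(1)[of \<tau>] unfolding split by simp
      then show "norm (a 0) \<le> C * \<tau> ^ Suc (Suc r) + norm (\<tau> *\<^sub>R (\<Sum>j\<le>r. \<tau> ^ j *\<^sub>R a (Suc j)))"
        using norm_triangle_ineq4[of "a 0 + \<tau> *\<^sub>R (\<Sum>j\<le>r. \<tau> ^ j *\<^sub>R a (Suc j))" "\<tau> *\<^sub>R (\<Sum>j\<le>r. \<tau> ^ j *\<^sub>R a (Suc j))"] by simp
    qed
  qed simp
  then have a0: "a 0 = 0" by simp
  show ?case
  proof (cases j)
    case (Suc i)
    have "a (Suc i) = 0"
    proof (rule Suc.IH[of "\<lambda>j. a (Suc j)" i])
      fix \<tau> :: real assume \<tau>: "0 < \<tau>" "\<tau> \<le> \<delta>"
      have "\<tau> * norm (\<Sum>j\<le>r. \<tau> ^ j *\<^sub>R a (Suc j)) \<le> \<tau> * (C * \<tau> ^ Suc r)"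
        using Suc.prems(1)[OF \<tau>] \<tau> unfolding split a0 by (simp add: mult_ac)
      then show "norm (\<Sum>j\<le>r. \<tau> ^ j *\<^sub>R a (Suc j)) \<le> C * \<tau> ^ Suc r"
        using \<tau> by (simp only: mult_le_cancel_left_pos)
    qed (use Suc Suc.prems in simp)
    then show ?thesis using Suc by simp
  qed (use a0 in simp)
qed

text \<open>To leading order the family acts as \<tau> ^ k times the derivation along
  \<open>X\<close>; coefficients beyond \<open>k\<close> are free. The equalities are required on
  the whole space, not just near a point.\<close>

definition leads :: "(nat \<Rightarrow> ('a \<Rightarrow> 'a) \<Rightarrow> 'a \<Rightarrow> 'a::euclidean_space) \<Rightarrow> nat \<Rightarrow> ('a \<Rightarrow> 'a) \<Rightarrow> bool" where
  "leads A k X \<longleftrightarrow> 1 \<le> k \<and> (\<forall>g. C_infinity g \<longrightarrow>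
     (\<forall>j. 0 < j \<longrightarrow> j < k \<longrightarrow> A j g = (\<lambda>_. 0)) \<and> A k g = lie_derivative X g)"

text \<open>An estimate for \<kappa> itself determines the coefficients up to order \<open>K\<close>
  only near \<open>c\<close>, whereas \<open>leads\<close> asks for equality everywhere.
  \<open>W'\<close> therefore overwrites these coefficients by their expected values; uniqueness of
  expansions shows that nothing changes near \<open>c\<close>, so the higher-order estimates
  survive.\<close>

lemma expands_normalize:
  assumes \<kappa>: "expands c \<kappa> W" and "1 \<le> K" and Z: "C_infinity Z"
    and est: "\<forall>\<^sub>F (\<tau>, y) in near0 c. norm (\<kappa> \<tau> y - y - \<tau> ^ K *\<^sub>R Z y) \<le> C0 * \<tau> ^ Suc K"
  obtains W' where "expands c \<kappa> W'" "leads W' K Z"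
proof -
  define W' where "W' j g = (if j = 0 then g else if j < K then (\<lambda>_. 0) else if j = K then lie_derivative Z g else W j g)" for j g
  \<comment> \<open>Passing from the identity to a general \<open>g\<close> costs a Taylor remainder
    of size \<tau> ^ (2 * K), which is absorbed in \<tau> ^ Suc K because 1 \<le> K.\<close>
  have lead_est: "\<exists>C. \<forall>\<^sub>F (\<tau>, y) in near0 c. norm (g (\<kappa> \<tau> y) - g y - \<tau> ^ K *\<^sub>R lie_derivative Z g y) \<le> C * \<tau> ^ Suc K"
    if g: "C_infinity g" for g :: "'a \<Rightarrow> 'a"
  proof -
    obtain C1 where C1: "C1 > 0" "\<And>a b. a \<in> cball c 1 \<Longrightarrow> b \<in> cball c 1 \<Longrightarrow>
        norm (g a - g b - frechet_derivative g (at b) (a - b)) \<le> C1 * (norm (a - b))\<^sup>2"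
      by (rule C_infinity_taylor2[OF g, of c 1]) blast
    obtain C2 where C2: "C2 > 0" "\<And>a h. a \<in> cball c 1 \<Longrightarrow> norm (frechet_derivative g (at a) h) \<le> C2 * norm h"
      by (rule C_infinity_derivative_bound[OF g, of "cball c 1"]) auto
    obtain C3 where C3: "C3 > 0" "\<And>a. a \<in> cball c 1 \<Longrightarrow> norm (Z a) \<le> C3"
      by (rule C_infinity_bounded_on_compact[OF Z, of "cball c 1"]) auto
    let ?C = "C1 * (C3 + \<bar>C0\<bar>)\<^sup>2 + C2 * \<bar>C0\<bar>"
    have "\<forall>\<^sub>F (\<tau>, y) in near0 c. norm (g (\<kappa> \<tau> y) - g y - \<tau> ^ K *\<^sub>R lie_derivative Z g y) \<le> ?C * \<tau> ^ Suc K"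
      using est near0_small[OF zero_less_one, of c]
        tame_eventually[OF expands_tame[OF \<kappa>] near0_small[OF zero_less_one, of c]]
    proof eventually_elim
      case (elim q)
      obtain \<tau> y where [simp]: "q = (\<tau>, y)" by force
      have \<tau>: "0 \<le> \<tau>" "\<tau> \<le> 1" and y: "y \<in> cball c 1" and ky: "\<kappa> \<tau> y \<in> cball c 1"
        and e: "norm (\<kappa> \<tau> y - y - \<tau> ^ K *\<^sub>R Z y) \<le> C0 * \<tau> ^ Suc K" using elim by auto
      have e': "norm (\<kappa> \<tau> y - y - \<tau> ^ K *\<^sub>R Z y) \<le> \<bar>C0\<bar> * \<tau> ^ Suc K"
        using e mult_right_mono[OF abs_ge_self, of "\<tau> ^ Suc K" C0] \<tau> by simp
      have pw: "\<tau> ^ Suc K \<le> \<tau> ^ K" using \<tau> by (intro power_decreasing) auto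
      have "norm (\<kappa> \<tau> y - y) \<le> norm (\<kappa> \<tau> y - y - \<tau> ^ K *\<^sub>R Z y) + norm (\<tau> ^ K *\<^sub>R Z y)"
        using norm_triangle_ineq[of "\<kappa> \<tau> y - y - \<tau> ^ K *\<^sub>R Z y" "\<tau> ^ K *\<^sub>R Z y"] by simp
      also have "\<dots> \<le> \<bar>C0\<bar> * \<tau> ^ K + C3 * \<tau> ^ K"
        using e' mult_left_mono[OF pw, of "\<bar>C0\<bar>"] mult_left_mono[OF C3(2)[OF y], of "\<tau> ^ K"] \<tau>
        by (simp add: mult.commute)
      finally have d: "norm (\<kappa> \<tau> y - y) \<le> (C3 + \<bar>C0\<bar>) * \<tau> ^ K" by (simp add: algebra_simps)
      have "norm (g (\<kappa> \<tau> y) - g y - frechet_derivative g (at y) (\<kappa> \<tau> y - y)) \<le> C1 * (norm (\<kappa> \<tau> y - y))\<^sup>2"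
        by (rule C1(2)[OF ky y])
      also have "\<dots> \<le> C1 * ((C3 + \<bar>C0\<bar>) * \<tau> ^ K)\<^sup>2"
        using d C1(1) by (intro mult_left_mono power_mono) auto
      also have "\<dots> = C1 * (C3 + \<bar>C0\<bar>)\<^sup>2 * \<tau> ^ (K + K)" by (simp add: power2_eq_square power_add mult_ac)
      also have "\<dots> \<le> C1 * (C3 + \<bar>C0\<bar>)\<^sup>2 * \<tau> ^ Suc K"
        using \<tau> C1(1) \<open>1 \<le> K\<close> by (intro mult_left_mono power_decreasing) auto
      finally have t1: "norm (g (\<kappa> \<tau> y) - g y - frechet_derivative g (at y) (\<kappa> \<tau> y - y)) \<le> C1 * (C3 + \<bar>C0\<bar>)\<^sup>2 * \<tau> ^ Suc K" .
      have "norm (frechet_derivative g (at y) (\<kappa> \<tau> y - y - \<tau> ^ K *\<^sub>R Z y)) \<le> C2 * norm (\<kappa> \<tau> y - y - \<tau> ^ K *\<^sub>R Z y)"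
        by (rule C2(2)[OF y])
      also have "\<dots> \<le> C2 * (\<bar>C0\<bar> * \<tau> ^ Suc K)" using e' C2(1) by (intro mult_left_mono) auto
      finally have t2: "norm (frechet_derivative g (at y) (\<kappa> \<tau> y - y - \<tau> ^ K *\<^sub>R Z y)) \<le> C2 * \<bar>C0\<bar> * \<tau> ^ Suc K" by (simp add: mult_ac)
      have lin: "linear (frechet_derivative g (at y))"
        using bounded_linear_frechet_derivative[OF g] bounded_linear.linear by blast
      have "g (\<kappa> \<tau> y) - g y - \<tau> ^ K *\<^sub>R lie_derivative Z g y =
        (g (\<kappa> \<tau> y) - g y - frechet_derivative g (at y) (\<kappa> \<tau> y - y)) + frechet_derivative g (at y) (\<kappa> \<tau> y - y - \<tau> ^ K *\<^sub>R Z y)"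
        by (simp add: linear_diff[OF lin] linear_scale[OF lin] lie_derivative_def)
      also have "norm \<dots> \<le> C1 * (C3 + \<bar>C0\<bar>)\<^sup>2 * \<tau> ^ Suc K + C2 * \<bar>C0\<bar> * \<tau> ^ Suc K"
        by (rule norm_triangle_mono[OF t1 t2])
      finally show ?case by (simp add: distrib_right)
    qed
    then show ?thesis by blast
  qed
  have sumK: "(\<Sum>j\<le>K. \<tau> ^ j *\<^sub>R W' j g y) = g y + \<tau> ^ K *\<^sub>R lie_derivative Z g y" for \<tau> g y
  proof -
    have "(\<Sum>j\<le>K. \<tau> ^ j *\<^sub>R W' j g y) = (\<Sum>j\<in>{0, K}. \<tau> ^ j *\<^sub>R W' j g y)"
      by (rule sum.mono_neutral_right) (use \<open>1 \<le> K\<close> in \<open>auto simp: W'_def\<close>)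
    then show ?thesis using \<open>1 \<le> K\<close> by (simp add: W'_def)
  qed
  have sumr: "(\<Sum>j\<le>r. \<tau> ^ j *\<^sub>R W' j g y) = g y" if "r < K" for \<tau> g y r
  proof -
    have "(\<Sum>j\<le>r. \<tau> ^ j *\<^sub>R W' j g y) = (\<Sum>j\<in>{0}. \<tau> ^ j *\<^sub>R W' j g y)"
      by (rule sum.mono_neutral_right) (use that in \<open>auto simp: W'_def\<close>)
    then show ?thesis by (simp add: W'_def)
  qed
  have "expands c \<kappa> W'"
    unfolding expands_def
  proof (intro conjI allI impI)
    show "W' j (\<lambda>_. 0) = (\<lambda>_. 0)" for j
      using \<kappa> by (auto simp: W'_def expands_def lie_derivative_def)
    fix g :: "'a \<Rightarrow> 'a" assume g: "C_infinity g"
    show "W' 0 g = g" by (simp add: W'_def)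
    show "C_infinity (W' j g)" for j
      using \<kappa> g C_infinity_lie_derivative[OF Z g] by (auto simp: W'_def expands_def C_infinity_const)
    fix r
    obtain C1 where C1: "\<forall>\<^sub>F (\<tau>, y) in near0 c. norm (g (\<kappa> \<tau> y) - g y - \<tau> ^ K *\<^sub>R lie_derivative Z g y) \<le> C1 * \<tau> ^ Suc K"
      using lead_est[OF g] by blast
    show "\<exists>C. \<forall>\<^sub>F (\<tau>, y) in near0 c. norm (g (\<kappa> \<tau> y) - (\<Sum>j\<le>r. \<tau> ^ j *\<^sub>R W' j g y)) \<le> C * \<tau> ^ Suc r"
    proof (cases "r < K")
      case True
      obtain C3 where C3: "C3 > 0" "\<And>a. a \<in> cball c 1 \<Longrightarrow> norm (lie_derivative Z g a) \<le> C3"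
        by (rule C_infinity_bounded_on_compact[OF C_infinity_lie_derivative[OF Z g], of "cball c 1"]) auto
      have "\<forall>\<^sub>F (\<tau>, y) in near0 c. norm (g (\<kappa> \<tau> y) - (\<Sum>j\<le>r. \<tau> ^ j *\<^sub>R W' j g y)) \<le> (\<bar>C1\<bar> + C3) * \<tau> ^ Suc r"
        using C1 near0_small[OF zero_less_one, of c]
      proof eventually_elim
        case (elim q)
        obtain \<tau> y where [simp]: "q = (\<tau>, y)" by force
        have \<tau>: "0 \<le> \<tau>" "\<tau> \<le> 1" and y: "y \<in> cball c 1"
          and e: "norm (g (\<kappa> \<tau> y) - g y - \<tau> ^ K *\<^sub>R lie_derivative Z g y) \<le> C1 * \<tau> ^ Suc K" using elim by auto
        have pw: "\<tau> ^ Suc K \<le> \<tau> ^ Suc r" "\<tau> ^ K \<le> \<tau> ^ Suc r" using \<tau> True by (auto intro!: power_decreasing simp del: power_Suc)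
        have "norm (g (\<kappa> \<tau> y) - g y) \<le> norm (g (\<kappa> \<tau> y) - g y - \<tau> ^ K *\<^sub>R lie_derivative Z g y) + norm (\<tau> ^ K *\<^sub>R lie_derivative Z g y)"
          using norm_triangle_ineq[of "g (\<kappa> \<tau> y) - g y - \<tau> ^ K *\<^sub>R lie_derivative Z g y" "\<tau> ^ K *\<^sub>R lie_derivative Z g y"] by simp
        also have "\<dots> \<le> \<bar>C1\<bar> * \<tau> ^ Suc r + C3 * \<tau> ^ Suc r"
        proof (rule add_mono)
          have "C1 * \<tau> ^ Suc K \<le> \<bar>C1\<bar> * \<tau> ^ Suc r" using pw \<tau> by (intro mult_mono) auto
          then show "norm (g (\<kappa> \<tau> y) - g y - \<tau> ^ K *\<^sub>R lie_derivative Z g y) \<le> \<bar>C1\<bar> * \<tau> ^ Suc r" using e by linarith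
          have "\<tau> ^ K * norm (lie_derivative Z g y) \<le> \<tau> ^ Suc r * C3" using pw(2) C3(2)[OF y] \<tau> by (intro mult_mono) auto
          then show "norm (\<tau> ^ K *\<^sub>R lie_derivative Z g y) \<le> C3 * \<tau> ^ Suc r" using \<tau> by (simp add: mult.commute)
        qed
        finally show ?case using sumr[OF True] by (simp add: distrib_right)
      qed
      then show ?thesis by blast
    next
      case False
      obtain C2 where C2: "\<forall>\<^sub>F (\<tau>, y) in near0 c. norm (g (\<kappa> \<tau> y) - (\<Sum>j\<le>K. \<tau> ^ j *\<^sub>R W j g y)) \<le> C2 * \<tau> ^ Suc K"
        using \<kappa> g unfolding expands_def by blast
      have "\<forall>\<^sub>F (\<tau>, y) in near0 c. norm (\<Sum>j\<le>K. \<tau> ^ j *\<^sub>R (W j g y - W' j g y)) \<le> (C1 + C2) * \<tau> ^ Suc K"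
        using C1 C2
      proof eventually_elim
        case (elim q)
        obtain \<tau> y where [simp]: "q = (\<tau>, y)" by force
        have "(\<Sum>j\<le>K. \<tau> ^ j *\<^sub>R (W j g y - W' j g y)) =
           (g (\<kappa> \<tau> y) - g y - \<tau> ^ K *\<^sub>R lie_derivative Z g y) - (g (\<kappa> \<tau> y) - (\<Sum>j\<le>K. \<tau> ^ j *\<^sub>R W j g y))"
          by (simp add: scaleR_diff_right sum_subtractf sumK)
        also have "norm \<dots> \<le> C1 * \<tau> ^ Suc K + C2 * \<tau> ^ Suc K"
          using elim by (intro order_trans[OF norm_triangle_ineq4 add_mono]) auto
        finally show ?case by (simp add: distrib_right)
      qed
      then obtain \<delta> where \<delta>: "\<delta> > 0" "\<And>\<tau> y. \<tau> \<in> {0..\<delta>} \<Longrightarrow> y \<in> cball c \<delta> \<Longrightarrow>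
          norm (\<Sum>j\<le>K. \<tau> ^ j *\<^sub>R (W j g y - W' j g y)) \<le> (C1 + C2) * \<tau> ^ Suc K"
        unfolding eventually_near0 by auto
      \<comment> \<open>\<open>W\<close> and \<open>W'\<close> expand the same values of
        \<open>g\<close> up to order \<open>K\<close>, so their coefficients agree on the ball of
        radius \<delta>.\<close>
      have eq: "W j g y = W' j g y" if y: "y \<in> cball c \<delta>" for j y
      proof (cases "j \<le> K")
        case True
        have "W j g y - W' j g y = 0"
          by (rule polynomial_coefficients_zero[where \<delta> = \<delta> and r = K and C = "C1 + C2" and a = "\<lambda>j. W j g y - W' j g y"])
            (use \<delta> y True in auto)
        then show ?thesis by simp
      qed (simp add: W'_def)
      obtain C4 where "\<forall>\<^sub>F (\<tau>, y) in near0 c. norm (g (\<kappa> \<tau> y) - (\<Sum>j\<le>r. \<tau> ^ j *\<^sub>R W j g y)) \<le> C4 * \<tau> ^ Suc r"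
        using \<kappa> g unfolding expands_def by blast
      then have "\<forall>\<^sub>F (\<tau>, y) in near0 c. norm (g (\<kappa> \<tau> y) - (\<Sum>j\<le>r. \<tau> ^ j *\<^sub>R W' j g y)) \<le> C4 * \<tau> ^ Suc r"
        using near0_small[OF \<delta>(1), of c]
        by eventually_elim (auto simp: eq)
      then show ?thesis by blast
    qed
  qed
  moreover have "leads W' K Z" using \<open>1 \<le> K\<close> by (auto simp: leads_def W'_def)
  ultimately show ?thesis by (rule that)
qed

section \<open>Commutators of flows\<close>

text \<open>Time linear in \<tau> is enough: \<tau> will be a root of the displacement parameter, so
  the time still tends to 0 with it. Continuity is recorded for the open mapping argument at the
  end.\<close>

definition moves :: "('m::finite \<Rightarrow> ('n::finite) vector_field) \<Rightarrow> real ^ 'n \<Rightarrow> (real \<Rightarrow> real ^ 'n \<Rightarrow> real ^ 'n) \<Rightarrow> bool" where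
  "moves f c \<phi> \<longleftrightarrow> (\<exists>N\<ge>0. \<forall>\<^sub>F (\<tau>, y) in near0 c. reach f (N * \<tau>) y (\<phi> \<tau> y)) \<and>
     (\<exists>\<delta>>0. continuous_on ({0..\<delta>} \<times> cball c \<delta>) (\<lambda>(\<tau>, y). \<phi> \<tau> y))"

text \<open>The parameter \<tau> is never negative, so motion along the opposite of \<open>X\<close>
  needs a separate family; taking the inverse \<phi>' for it is what makes commutators
  available.\<close>

definition flow_family ::
  "('m::finite \<Rightarrow> ('n::finite) vector_field) \<Rightarrow> real ^ 'n \<Rightarrow> nat \<Rightarrow> 'n vector_field \<Rightarrow>
   (real \<Rightarrow> real ^ 'n \<Rightarrow> real ^ 'n) \<Rightarrow> (real \<Rightarrow> real ^ 'n \<Rightarrow> real ^ 'n) \<Rightarrow> bool" where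
  "flow_family f c k X \<phi> \<phi>' \<longleftrightarrow> moves f c \<phi> \<and> moves f c \<phi>' \<and>
     (\<forall>\<^sub>F (\<tau>, y) in near0 c. \<phi> \<tau> (\<phi>' \<tau> y) = y) \<and> (\<forall>\<^sub>F (\<tau>, y) in near0 c. \<phi>' \<tau> (\<phi> \<tau> y) = y) \<and>
     (\<exists>A. expands c \<phi> A \<and> leads A k X) \<and> (\<exists>A. expands c \<phi>' A \<and> leads A k (\<lambda>y. - X y))"

lemma moves_compose:
  assumes \<phi>: "moves f c \<phi>" and \<psi>: "moves f c \<psi>" and tame: "tame c \<psi>"
  shows "moves f c (\<lambda>\<tau> y. \<phi> \<tau> (\<psi> \<tau> y))"
proof -
  obtain N1 where N1: "N1 \<ge> 0" "\<forall>\<^sub>F (\<tau>, y) in near0 c. reach f (N1 * \<tau>) y (\<phi> \<tau> y)"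
    using \<phi> unfolding moves_def by blast
  obtain N2 where N2: "N2 \<ge> 0" "\<forall>\<^sub>F (\<tau>, y) in near0 c. reach f (N2 * \<tau>) y (\<psi> \<tau> y)"
    using \<psi> unfolding moves_def by blast
  have "\<forall>\<^sub>F (\<tau>, y) in near0 c. reach f ((N2 + N1) * \<tau>) y (\<phi> \<tau> (\<psi> \<tau> y))"
    using N2(2) tame_eventually[OF tame N1(2)]
  proof eventually_elim
    case (elim q)
    obtain \<tau> y where [simp]: "q = (\<tau>, y)" by force
    show ?case using elim reach_trans[of f "N2 * \<tau>" y "\<psi> \<tau> y" "N1 * \<tau>" "\<phi> \<tau> (\<psi> \<tau> y)"] by (simp add: distrib_right)
  qed
  moreover
  obtain d1 where d1: "d1 > 0" "continuous_on ({0..d1} \<times> cball c d1) (\<lambda>(\<tau>, y). \<phi> \<tau> y)"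
    using \<phi> unfolding moves_def by blast
  obtain d2 where d2: "d2 > 0" "continuous_on ({0..d2} \<times> cball c d2) (\<lambda>(\<tau>, y). \<psi> \<tau> y)"
    using \<psi> unfolding moves_def by blast
  obtain d3 where d3: "d3 > 0" "\<And>\<tau> y. \<tau> \<in> {0..d3} \<Longrightarrow> y \<in> cball c d3 \<Longrightarrow> 0 \<le> \<tau> \<and> \<tau> \<le> d1 \<and> \<psi> \<tau> y \<in> cball c d1"
    using tame_eventually[OF tame near0_small[OF d1(1)]] unfolding eventually_near0 by auto
  have "continuous_on ({0..min d2 d3} \<times> cball c (min d2 d3)) (\<lambda>q. (\<lambda>(\<tau>, y). \<phi> \<tau> y) (fst q, (\<lambda>(\<tau>, y). \<psi> \<tau> y) q))"
  proof (rule continuous_on_compose2[OF d1(2)])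
    show "continuous_on ({0..min d2 d3} \<times> cball c (min d2 d3)) (\<lambda>q. (fst q, (\<lambda>(\<tau>, y). \<psi> \<tau> y) q))"
      by (intro continuous_intros continuous_on_subset[OF d2(2)]) auto
    show "(\<lambda>q. (fst q, (\<lambda>(\<tau>, y). \<psi> \<tau> y) q)) ` ({0..min d2 d3} \<times> cball c (min d2 d3)) \<subseteq> {0..d1} \<times> cball c d1"
      using d3(2) by fastforce
  qed
  then have "continuous_on ({0..min d2 d3} \<times> cball c (min d2 d3)) (\<lambda>(\<tau>, y). \<phi> \<tau> (\<psi> \<tau> y))"
    by (simp add: case_prod_unfold)
  moreover have "min d2 d3 > 0" using d2(1) d3(1) by simp
  moreover have "N2 + N1 \<ge> 0" using N1(1) N2(1) by simp
  ultimately show ?thesis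
    unfolding moves_def by (intro conjI exI[of _ "N2 + N1"] exI[of _ "min d2 d3"]) assumption+
qed

lemma lie_derivative_ident: "lie_derivative X (\<lambda>x::'a::euclidean_space. x) = X"
proof -
  have "frechet_derivative (\<lambda>x. x) (at y) = (\<lambda>x. x)" for y :: 'a
    by (rule frechet_derivative_at[OF has_derivative_ident, symmetric])
  then show ?thesis by (simp add: lie_derivative_def)
qed

text \<open>A mixed term with 0 < j < m vanishes if j < k or m - j < l. For m \<le> k + l only j = k
  with m = k + l survives, so up to that order the two expansions simply add, with a single
  interaction term at the top.\<close>

lemma compose_coefficients:
  assumes A: "expands c \<phi> A" "leads A k X" and B: "expands c \<psi> B" "leads B l Y"
    and X: "C_infinity X" and m: "m \<le> k + l"
  shows "(\<Sum>j\<le>m. B (m - j) (A j (\<lambda>x. x)) y) =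
     (if m = 0 then y else A m (\<lambda>x. x) y + B m (\<lambda>x. x) y + (if m = k + l then lie_derivative Y X y else 0))"
proof (cases "m = 0")
  case True
  have "A 0 (\<lambda>x. x) = (\<lambda>x. x)" "B 0 (\<lambda>x. x) = (\<lambda>x. x)"
    using A(1) B(1) C_infinity_ident unfolding expands_def by blast+
  then show ?thesis using True by simp
next
  case False
  let ?t = "\<lambda>j. B (m - j) (A j (\<lambda>x. x)) y"
  have kl: "1 \<le> k" "1 \<le> l" using A B by (auto simp: leads_def)
  have Aid: "C_infinity (A j (\<lambda>x. x))" "A 0 (\<lambda>x. x) = (\<lambda>x. x)" "A k (\<lambda>x. x) = X"
      "0 < j \<Longrightarrow> j < k \<Longrightarrow> A j (\<lambda>x. x) = (\<lambda>_. 0)" for j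
    using A C_infinity_ident by (auto simp: expands_def leads_def lie_derivative_ident)
  have B0: "B j (\<lambda>_. 0) = (\<lambda>_. 0)" "B 0 (A m (\<lambda>x. x)) = A m (\<lambda>x. x)" for j
    using B Aid(1) by (auto simp: expands_def)
  have Bz: "B j (A i (\<lambda>x. x)) = (\<lambda>_. 0)" if "0 < j" "j < l" for i j
    using B(2) Aid(1) that by (auto simp: leads_def)
  have zero: "?t j = 0" if "0 < j" "j < m" "\<not> (j = k \<and> m = k + l)" for j
  proof (cases "j < k")
    case True
    then show ?thesis using Aid(4)[of j] that B0 by simp
  next
    case False
    then have "m - j < l" "0 < m - j" using that m by auto
    then show ?thesis using Bz by simp
  qed
  have "(\<Sum>j\<le>m. ?t j) = (\<Sum>j\<in>{0, m}. ?t j) + (\<Sum>j\<in>{..m} - {0, m}. ?t j)"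
    using sum.subset_diff[of "{0, m}" "{..m}" ?t] by simp
  also have "(\<Sum>j\<in>{0, m}. ?t j) = A m (\<lambda>x. x) y + B m (\<lambda>x. x) y"
    using False Aid(2) B0 by (simp add: add.commute)
  also have "(\<Sum>j\<in>{..m} - {0, m}. ?t j) = (if m = k + l then lie_derivative Y X y else 0)"
  proof (cases "m = k + l")
    case True
    have "(\<Sum>j\<in>{..m} - {0, m}. ?t j) = (\<Sum>j\<in>{k}. ?t j)"
    proof (rule sum.mono_neutral_right)
      show "\<forall>j\<in>{..m} - {0, m} - {k}. ?t j = 0"
        using zero by auto
    qed (use True kl in auto)
    moreover have "B l (A k (\<lambda>x. x)) = lie_derivative Y X"
      using B(2) Aid(1)[of k] Aid(3) by (auto simp: leads_def)
    ultimately show ?thesis using True by simp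
  next
    case False
    have "(\<Sum>j\<in>{..m} - {0, m}. ?t j) = 0"
      by (rule sum.neutral) (use zero False in auto)
    then show ?thesis using False by simp
  qed
  finally show ?thesis using False by simp
qed

text \<open>The additive parts of \<open>compose_coefficients\<close> are symmetric in the two
  families and cancel in the difference of the two orders of composition. The interaction terms
  remain: applying \<psi> before \<phi> differentiates \<open>X\<close> along \<open>Y\<close>, and
  conversely, which gives \<open>lie_bracket Y X\<close>.\<close>

lemma commutator_defect:
  assumes A: "expands c \<phi> A" "leads A k X" and B: "expands c \<psi> B" "leads B l Y"
    and X: "C_infinity X" and Y: "C_infinity Y"
  shows "\<exists>C. \<forall>\<^sub>F (\<tau>, y) in near0 c. norm (\<phi> \<tau> (\<psi> \<tau> y) - \<psi> \<tau> (\<phi> \<tau> y) - \<tau> ^ (k + l) *\<^sub>R lie_bracket Y X y) \<le> C * \<tau> ^ Suc (k + l)"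
proof -
  have kl: "1 \<le> k" "1 \<le> l" using A B by (auto simp: leads_def)
  let ?P = "\<lambda>m y. \<Sum>j\<le>m. B (m - j) (A j (\<lambda>x. x)) y" and ?Q = "\<lambda>m y. \<Sum>j\<le>m. A (m - j) (B j (\<lambda>x. x)) y"
  obtain C1 where C1: "\<forall>\<^sub>F (\<tau>, y) in near0 c. norm (\<phi> \<tau> (\<psi> \<tau> y) - (\<Sum>m\<le>k + l. \<tau> ^ m *\<^sub>R ?P m y)) \<le> C1 * \<tau> ^ Suc (k + l)"
    using expands_compose[OF A(1) B(1)] C_infinity_ident unfolding expands_def by blast
  obtain C2 where C2: "\<forall>\<^sub>F (\<tau>, y) in near0 c. norm (\<psi> \<tau> (\<phi> \<tau> y) - (\<Sum>m\<le>k + l. \<tau> ^ m *\<^sub>R ?Q m y)) \<le> C2 * \<tau> ^ Suc (k + l)"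
    using expands_compose[OF B(1) A(1)] C_infinity_ident unfolding expands_def by blast
  have diff: "?P m y - ?Q m y = (if m = k + l then lie_bracket Y X y else 0)" if "m \<le> k + l" for m y
    using compose_coefficients[OF A B X that] compose_coefficients[OF B A Y, of m y] that kl
    by (simp add: add.commute lie_bracket_def lie_derivative_def)
  have sum: "(\<Sum>m\<le>k + l. \<tau> ^ m *\<^sub>R ?P m y) - (\<Sum>m\<le>k + l. \<tau> ^ m *\<^sub>R ?Q m y) = \<tau> ^ (k + l) *\<^sub>R lie_bracket Y X y" for \<tau> y
  proof -
    have "(\<Sum>m\<le>k + l. \<tau> ^ m *\<^sub>R ?P m y) - (\<Sum>m\<le>k + l. \<tau> ^ m *\<^sub>R ?Q m y) =
        (\<Sum>m\<le>k + l. \<tau> ^ m *\<^sub>R (?P m y - ?Q m y))"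
      by (simp only: scaleR_diff_right sum_subtractf)
    also have "\<dots> = (\<Sum>m\<le>k + l. if m = k + l then \<tau> ^ (k + l) *\<^sub>R lie_bracket Y X y else 0)"
      by (intro sum.cong refl) (simp only: diff atMost_iff, simp)
    finally show ?thesis by simp
  qed
  have "\<forall>\<^sub>F (\<tau>, y) in near0 c. norm (\<phi> \<tau> (\<psi> \<tau> y) - \<psi> \<tau> (\<phi> \<tau> y) - \<tau> ^ (k + l) *\<^sub>R lie_bracket Y X y) \<le> (C1 + C2) * \<tau> ^ Suc (k + l)"
    using C1 C2
  proof eventually_elim
    case (elim q)
    obtain \<tau> y where [simp]: "q = (\<tau>, y)" by force
    have "\<phi> \<tau> (\<psi> \<tau> y) - \<psi> \<tau> (\<phi> \<tau> y) - \<tau> ^ (k + l) *\<^sub>R lie_bracket Y X y =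
       (\<phi> \<tau> (\<psi> \<tau> y) - (\<Sum>m\<le>k + l. \<tau> ^ m *\<^sub>R ?P m y)) - (\<psi> \<tau> (\<phi> \<tau> y) - (\<Sum>m\<le>k + l. \<tau> ^ m *\<^sub>R ?Q m y))"
      unfolding sum[symmetric] by (simp only: diff_diff_eq2 algebra_simps)
    also have "norm \<dots> \<le> C1 * \<tau> ^ Suc (k + l) + C2 * \<tau> ^ Suc (k + l)"
      using elim by (intro order_trans[OF norm_triangle_ineq4 add_mono]) auto
    finally show ?case by (simp add: distrib_right)
  qed
  then show ?thesis by blast
qed

lemma C_infinity_lie_bracket:
  assumes "C_infinity X" "C_infinity Y" shows "C_infinity (lie_bracket X Y)"
  using C_infinity_diff[OF C_infinity_lie_derivative[OF assms] C_infinity_lie_derivative[OF assms(2,1)]]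
  by (simp add: lie_bracket_def lie_derivative_def)

text \<open>Evaluate \<open>commutator_defect\<close> at the point z = \<phi>' \<tau> (\<psi>'
  \<tau> y), which \<psi> after \<phi> takes back to \<open>y\<close>. Moving the bracket from
  \<open>z\<close> to \<open>y\<close> costs a factor \<tau> because the map from \<open>y\<close>
  to \<open>z\<close> is tame.\<close>

lemma expands_commutator:
  fixes c :: "real ^ 'n::finite"
  assumes \<phi>: "expands c \<phi> A" "leads A k X" "expands c \<phi>' A'" and \<psi>: "expands c \<psi> B" "leads B l Y" "expands c \<psi>' B'"
    and inv: "\<forall>\<^sub>F (\<tau>, y) in near0 c. \<phi> \<tau> (\<phi>' \<tau> y) = y" "\<forall>\<^sub>F (\<tau>, y) in near0 c. \<psi> \<tau> (\<psi>' \<tau> y) = y"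
    and X: "C_infinity X" and Y: "C_infinity Y"
  obtains W where "expands c (\<lambda>\<tau> y. \<phi> \<tau> (\<psi> \<tau> (\<phi>' \<tau> (\<psi>' \<tau> y)))) W" "leads W (k + l) (lie_bracket Y X)"
proof -
  let ?z = "\<lambda>\<tau> y. \<phi>' \<tau> (\<psi>' \<tau> y)" and ?K = "k + l" and ?Z = "lie_bracket Y X"
  note ez = expands_compose[OF \<phi>(3) \<psi>(3)]
  note tz = expands_tame[OF ez]
  have Z: "C_infinity ?Z" by (rule C_infinity_lie_bracket[OF Y X])
  obtain C1 where C1: "\<forall>\<^sub>F (\<tau>, y) in near0 c. norm (\<phi> \<tau> (\<psi> \<tau> y) - \<psi> \<tau> (\<phi> \<tau> y) - \<tau> ^ ?K *\<^sub>R ?Z y) \<le> C1 * \<tau> ^ Suc ?K"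
    using commutator_defect[OF \<phi>(1,2) \<psi>(1,2) X Y] by blast
  obtain C2 where C2: "\<forall>\<^sub>F (\<tau>, y) in near0 c. norm (?z \<tau> y - y) \<le> C2 * \<tau>" using tz by (auto simp: tame_def)
  obtain C3 where C3: "C3 > 0" "\<And>a b. a \<in> cball c 1 \<Longrightarrow> b \<in> cball c 1 \<Longrightarrow> norm (?Z a - ?Z b) \<le> C3 * norm (a - b)"
    by (rule C_infinity_lipschitz_on_cball[OF Z, of c 1]) blast
  have "\<forall>\<^sub>F (\<tau>, y) in near0 c. norm (\<phi> \<tau> (\<psi> \<tau> (?z \<tau> y)) - y - \<tau> ^ ?K *\<^sub>R ?Z y) \<le> (C1 + C3 * C2) * \<tau> ^ Suc ?K"
    using tame_eventually[OF tz C1] C2 near0_small[OF zero_less_one, of c] inv(2)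
      tame_eventually[OF tz near0_small[OF zero_less_one, of c]] tame_eventually[OF expands_tame[OF \<psi>(3)] inv(1)]
  proof eventually_elim
    case (elim q)
    obtain \<tau> y where [simp]: "q = (\<tau>, y)" by force
    have bk: "\<psi> \<tau> (\<phi> \<tau> (?z \<tau> y)) = y" using elim by simp
    have \<tau>: "0 \<le> \<tau>" using elim by simp
    have "norm (?Z (?z \<tau> y) - ?Z y) \<le> C3 * norm (?z \<tau> y - y)" using elim by (intro C3(2)) auto
    also have "\<dots> \<le> C3 * (C2 * \<tau>)" using elim C3(1) by (intro mult_left_mono) auto
    finally have "\<tau> ^ ?K * norm (?Z (?z \<tau> y) - ?Z y) \<le> \<tau> ^ ?K * (C3 * (C2 * \<tau>))"
      using \<tau> by (intro mult_left_mono) auto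
    then have 2: "norm (\<tau> ^ ?K *\<^sub>R (?Z (?z \<tau> y) - ?Z y)) \<le> C3 * C2 * \<tau> ^ Suc ?K" using \<tau> by (simp add: mult_ac)
    have 1: "norm (\<phi> \<tau> (\<psi> \<tau> (?z \<tau> y)) - \<psi> \<tau> (\<phi> \<tau> (?z \<tau> y)) - \<tau> ^ ?K *\<^sub>R ?Z (?z \<tau> y)) \<le> C1 * \<tau> ^ Suc ?K" using elim by simp
    have "\<phi> \<tau> (\<psi> \<tau> (?z \<tau> y)) - y - \<tau> ^ ?K *\<^sub>R ?Z y =
       (\<phi> \<tau> (\<psi> \<tau> (?z \<tau> y)) - \<psi> \<tau> (\<phi> \<tau> (?z \<tau> y)) - \<tau> ^ ?K *\<^sub>R ?Z (?z \<tau> y)) + \<tau> ^ ?K *\<^sub>R (?Z (?z \<tau> y) - ?Z y)"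
      unfolding bk by (simp add: scaleR_diff_right)
    also have "norm \<dots> \<le> C1 * \<tau> ^ Suc ?K + C3 * C2 * \<tau> ^ Suc ?K" by (rule norm_triangle_mono[OF 1 2])
    finally show ?case by (simp add: distrib_right)
  qed
  moreover have "1 \<le> ?K" using \<phi>(2) by (simp add: leads_def)
  ultimately obtain W where "expands c (\<lambda>\<tau> y. \<phi> \<tau> (\<psi> \<tau> (?z \<tau> y))) W" "leads W ?K ?Z"
    using expands_normalize[OF expands_compose[OF \<phi>(1) expands_compose[OF \<psi>(1) ez]] _ Z, of ?K "C1 + C3 * C2"] by blast
  then show ?thesis by (rule that)
qed

text \<open>Inverting a commutator exchanges the roles of the two families, and this matches the
  antisymmetry of the bracket: the inverse family leads with \<open>lie_bracket X Y\<close>, the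
  negative of \<open>lie_bracket Y X\<close>.\<close>

lemma flow_family_bracket:
  assumes \<phi>: "flow_family f c k X \<phi> \<phi>'" and \<psi>: "flow_family f c l Y \<psi> \<psi>'"
    and X: "C_infinity X" and Y: "C_infinity Y"
  shows "flow_family f c (k + l) (lie_bracket Y X) (\<lambda>\<tau> y. \<phi> \<tau> (\<psi> \<tau> (\<phi>' \<tau> (\<psi>' \<tau> y)))) (\<lambda>\<tau> y. \<psi> \<tau> (\<phi> \<tau> (\<psi>' \<tau> (\<phi>' \<tau> y))))"
proof -
  obtain A A' where A: "expands c \<phi> A" "leads A k X" "expands c \<phi>' A'" using \<phi> unfolding flow_family_def by blast
  obtain B B' where B: "expands c \<psi> B" "leads B l Y" "expands c \<psi>' B'" using \<psi> unfolding flow_family_def by blast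
  have inv: "\<forall>\<^sub>F (\<tau>, y) in near0 c. \<phi> \<tau> (\<phi>' \<tau> y) = y" "\<forall>\<^sub>F (\<tau>, y) in near0 c. \<psi> \<tau> (\<psi>' \<tau> y) = y"
    "\<forall>\<^sub>F (\<tau>, y) in near0 c. \<phi>' \<tau> (\<phi> \<tau> y) = y" "\<forall>\<^sub>F (\<tau>, y) in near0 c. \<psi>' \<tau> (\<psi> \<tau> y) = y"
    using \<phi> \<psi> unfolding flow_family_def by blast+
  have mv: "moves f c \<phi>" "moves f c \<phi>'" "moves f c \<psi>" "moves f c \<psi>'" using \<phi> \<psi> unfolding flow_family_def by blast+
  obtain W where W: "expands c (\<lambda>\<tau> y. \<phi> \<tau> (\<psi> \<tau> (\<phi>' \<tau> (\<psi>' \<tau> y)))) W" "leads W (k + l) (lie_bracket Y X)"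
    by (rule expands_commutator[OF A B inv(1,2) X Y])
  obtain V where V: "expands c (\<lambda>\<tau> y. \<psi> \<tau> (\<phi> \<tau> (\<psi>' \<tau> (\<phi>' \<tau> y)))) V" "leads V (l + k) (lie_bracket X Y)"
    by (rule expands_commutator[OF B A inv(2,1) Y X])
  have V': "leads V (k + l) (\<lambda>y. - lie_bracket Y X y)"
    using V(2) by (simp add: lie_bracket_def add.commute)
  note c1 = expands_compose[OF A(3) B(3)] and c2 = expands_compose[OF B(3) A(3)]
  note d1 = expands_compose[OF B(1) c1] and d2 = expands_compose[OF A(1) c2]
  have m1: "moves f c (\<lambda>\<tau> y. \<phi> \<tau> (\<psi> \<tau> (\<phi>' \<tau> (\<psi>' \<tau> y))))"
    by (intro moves_compose[OF mv(1) moves_compose[OF mv(3) moves_compose[OF mv(2,4)]]]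
        expands_tame[OF B(3)] expands_tame[OF c1] expands_tame[OF d1])
  have m2: "moves f c (\<lambda>\<tau> y. \<psi> \<tau> (\<phi> \<tau> (\<psi>' \<tau> (\<phi>' \<tau> y))))"
    by (intro moves_compose[OF mv(3) moves_compose[OF mv(1) moves_compose[OF mv(4,2)]]]
        expands_tame[OF A(3)] expands_tame[OF c2] expands_tame[OF d2])
  have i1: "\<forall>\<^sub>F (\<tau>, y) in near0 c. \<phi> \<tau> (\<psi> \<tau> (\<phi>' \<tau> (\<psi>' \<tau> (\<psi> \<tau> (\<phi> \<tau> (\<psi>' \<tau> (\<phi>' \<tau> y))))))) = y"
    using tame_eventually[OF expands_tame[OF d2] inv(4)] tame_eventually[OF expands_tame[OF c2] inv(3)]
      tame_eventually[OF expands_tame[OF A(3)] inv(2)] inv(1)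
    by eventually_elim auto
  have i2: "\<forall>\<^sub>F (\<tau>, y) in near0 c. \<psi> \<tau> (\<phi> \<tau> (\<psi>' \<tau> (\<phi>' \<tau> (\<phi> \<tau> (\<psi> \<tau> (\<phi>' \<tau> (\<psi>' \<tau> y))))))) = y"
    using tame_eventually[OF expands_tame[OF d1] inv(3)] tame_eventually[OF expands_tame[OF c1] inv(4)]
      tame_eventually[OF expands_tame[OF B(3)] inv(1)] inv(2)
    by eventually_elim auto
  show ?thesis
    unfolding flow_family_def using m1 m2 i1 i2 W V(1) V' by blast
qed

section \<open>Flows of constant controls\<close>

lemma C_infinity_control_field:
  "(\<And>i. C_infinity (f i)) \<Longrightarrow> C_infinity (control_field f v)"
  unfolding control_field_def by (intro C_infinity_sum C_infinity_scaleR_left)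

text \<open>The time t0 is common to all constant controls and all starting points in the smaller
  ball. Reversing a trajectory of -v gives a trajectory of \<open>v\<close>, and solutions are
  unique by \<open>traj_dependence\<close>, so the two flows are inverse to each other.\<close>

lemma constant_control_flow:
  fixes f :: "'m::finite \<Rightarrow> ('n::finite) vector_field"
  assumes f: "\<And>i. C_infinity (f i)"
  obtains t0 \<Phi> where "t0 > 0"
    "\<And>v y. norm v \<le> 1 \<Longrightarrow> y \<in> cball c (1 / 2) \<Longrightarrow> traj f (\<lambda>_. v) t0 (\<lambda>\<tau>. \<Phi> v \<tau> y)"
    "\<And>v y. norm v \<le> 1 \<Longrightarrow> y \<in> cball c (1 / 2) \<Longrightarrow> \<Phi> v 0 y = y"
    "\<And>v y \<tau>. norm v \<le> 1 \<Longrightarrow> y \<in> cball c (1 / 2) \<Longrightarrow> \<tau> \<in> {0..t0} \<Longrightarrow> \<Phi> v \<tau> y \<in> cball c 1"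
    "\<And>v. norm v \<le> 1 \<Longrightarrow> continuous_on ({0..t0} \<times> cball c (1 / 2)) (\<lambda>(\<tau>, y). \<Phi> v \<tau> y)"
    "\<And>v y \<tau>. norm v \<le> 1 \<Longrightarrow> y \<in> cball c (1 / 2) \<Longrightarrow> \<tau> \<in> {0..t0} \<Longrightarrow> \<Phi> (- v) \<tau> y \<in> cball c (1 / 2) \<Longrightarrow>
       \<Phi> v \<tau> (\<Phi> (- v) \<tau> y) = y"
proof -
  obtain M L where lb: "local_bounds f c 1 M L" by (rule local_bounds_exist[OF f zero_less_one])
  have bounds_pos: "M > 0" "L > 0" using lb by (auto simp: local_bounds_def)
  \<comment> \<open>The first bound is the short-time condition; the second keeps curves that start
    in the ball of radius 1 / 2 inside the unit ball.\<close>
  define t0 where "t0 = min (1 / (4 * L)) (1 / (4 * M))"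
  have t0: "t0 > 0" using bounds_pos by (simp add: t0_def)
  have Lt: "L * t0 \<le> 1 / 4" and Mt: "M * t0 < 1 / 2"
  proof -
    have "L * t0 \<le> L * (1 / (4 * L))" unfolding t0_def using bounds_pos by (intro mult_left_mono) auto
    then show "L * t0 \<le> 1 / 4" using bounds_pos by simp
    have "M * t0 \<le> M * (1 / (4 * M))" unfolding t0_def using bounds_pos by (intro mult_left_mono) auto
    then show "M * t0 < 1 / 2" using bounds_pos by simp
  qed
  define \<Phi> where "\<Phi> v \<tau> y = (SOME Y. traj f (\<lambda>_. v) t0 Y \<and> Y 0 = y) \<tau>" for v \<tau> y
  have ex: "traj f (\<lambda>_. v) t0 (\<lambda>\<tau>. \<Phi> v \<tau> y) \<and> \<Phi> v 0 y = y" if vy: "norm v \<le> 1" "y \<in> cball c (1 / 2)" for v y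
  proof -
    obtain Y where "traj f (\<lambda>_. v) t0 Y" "Y 0 = y"
      by (rule traj_exists[OF f lb, where t = t0 and x = y and u = "\<lambda>_. v"]) (use t0 Lt Mt vy in auto)
    then have "\<exists>Y. traj f (\<lambda>_. v) t0 Y \<and> Y 0 = y" by blast
    from someI_ex[OF this] show ?thesis unfolding \<Phi>_def .
  qed
  have stay: "\<Phi> v \<tau> y \<in> cball c 1" if "norm v \<le> 1" "y \<in> cball c (1 / 2)" "\<tau> \<in> {0..t0}" for v \<tau> y
    by (rule traj_stays[OF lb, where Y = "\<lambda>\<tau>. \<Phi> v \<tau> y" and t = t0]) (use ex[of v y] that Mt in auto)
  have cont: "continuous_on ({0..t0} \<times> cball c (1 / 2)) (\<lambda>(\<tau>, y). \<Phi> v \<tau> y)" if v: "norm v \<le> 1" for v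
  proof -
    have lip: "norm (\<Phi> v \<tau> y - \<Phi> v \<sigma> z) \<le> M * \<bar>\<tau> - \<sigma>\<bar> + 2 * norm (y - z)"
      if "\<tau> \<in> {0..t0}" "\<sigma> \<in> {0..t0}" "y \<in> cball c (1 / 2)" "z \<in> cball c (1 / 2)" for \<tau> \<sigma> y z
    proof -
      have y: "traj f (\<lambda>_. v) t0 (\<lambda>\<tau>. \<Phi> v \<tau> y)" "\<Phi> v 0 y = y" and z: "traj f (\<lambda>_. v) t0 (\<lambda>\<tau>. \<Phi> v \<tau> z)" "\<Phi> v 0 z = z"
        using ex[OF v] that by auto
      have "norm (\<Phi> v \<tau> y - \<Phi> v \<sigma> y) \<le> M * \<bar>\<tau> - \<sigma>\<bar>"
        by (rule traj_speed[OF lb y(1)]) (use stay[OF v] that in auto)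
      moreover have "norm (\<Phi> v \<sigma> y - \<Phi> v \<sigma> z) \<le> 2 * norm (\<Phi> v 0 y - \<Phi> v 0 z)"
        by (rule traj_dependence(1)[OF lb z(1) y(1) Lt]) (use stay[OF v] that in auto)
      moreover have "norm (\<Phi> v \<tau> y - \<Phi> v \<sigma> z) \<le> norm (\<Phi> v \<tau> y - \<Phi> v \<sigma> y) + norm (\<Phi> v \<sigma> y - \<Phi> v \<sigma> z)"
        using norm_triangle_ineq[of "\<Phi> v \<tau> y - \<Phi> v \<sigma> y" "\<Phi> v \<sigma> y - \<Phi> v \<sigma> z"] by simp
      ultimately show ?thesis using y z by simp
    qed
    have "(M + 2)-lipschitz_on ({0..t0} \<times> cball c (1 / 2)) (\<lambda>(\<tau>, y). \<Phi> v \<tau> y)"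
    proof (rule lipschitz_onI)
      fix p q assume pq: "p \<in> {0..t0} \<times> cball c (1 / 2)" "q \<in> {0..t0} \<times> cball c (1 / 2)"
      have "norm (\<Phi> v (fst p) (snd p) - \<Phi> v (fst q) (snd q)) \<le> M * \<bar>fst p - fst q\<bar> + 2 * norm (snd p - snd q)"
        by (rule lip) (use pq in \<open>auto simp: mem_Times_iff\<close>)
      also have "\<dots> \<le> M * dist p q + 2 * dist p q"
        using dist_fst_le[of p q] dist_snd_le[of p q] bounds_pos by (intro add_mono mult_left_mono) (auto simp: dist_norm)
      finally show "dist (case p of (\<tau>, y) \<Rightarrow> \<Phi> v \<tau> y) (case q of (\<tau>, y) \<Rightarrow> \<Phi> v \<tau> y) \<le> (M + 2) * dist p q"
        by (simp add: case_prod_unfold dist_norm distrib_right)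
    qed (use bounds_pos in simp)
    then show ?thesis by (rule lipschitz_on_continuous_on)
  qed
  have inverse: "\<Phi> v \<tau> (\<Phi> (- v) \<tau> y) = y"
    if v: "norm v \<le> 1" and y: "y \<in> cball c (1 / 2)" and \<tau>: "\<tau> \<in> {0..t0}" and w: "\<Phi> (- v) \<tau> y \<in> cball c (1 / 2)" for v y \<tau>
  proof -
    let ?w = "\<Phi> (- v) \<tau> y"
    have v': "norm (- v) \<le> 1" using v by simp
    have "traj f (\<lambda>_. - v) \<tau> (\<lambda>s. \<Phi> (- v) s y)"
      using traj_shift[OF conjunct1[OF ex[OF v' y]], of 0 \<tau>] \<tau> by simp
    from traj_reverse[OF this] have Z: "traj f (\<lambda>_. v) \<tau> (\<lambda>s. \<Phi> (- v) (\<tau> - s) y)" using \<tau> by simp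
    have W: "traj f (\<lambda>_. v) \<tau> (\<lambda>s. \<Phi> v s ?w)"
      using traj_shift[OF conjunct1[OF ex[OF v w]], of 0 \<tau>] \<tau> by simp
    have "L * \<tau> \<le> L * t0" using \<tau> bounds_pos by simp
    then have L\<tau>: "L * \<tau> \<le> 1 / 4" using Lt by simp
    have "norm (\<Phi> v \<tau> ?w - \<Phi> (- v) (\<tau> - \<tau>) y) \<le> 2 * norm (\<Phi> v 0 ?w - \<Phi> (- v) (\<tau> - 0) y)"
      by (rule traj_dependence(1)[OF lb Z W L\<tau>]) (use stay[OF v' y] stay[OF v w] \<tau> in auto)
    then show ?thesis using ex[OF v w] ex[OF v' y] by simp
  qed
  show ?thesis
    by (rule that[of t0 \<Phi>]) (use t0 ex stay cont inverse in blast)+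
qed

lemma funpow_lie_derivative_C_infinity:
  "C_infinity X \<Longrightarrow> C_infinity g \<Longrightarrow> C_infinity ((lie_derivative X ^^ j) g)"
  by (induction j) (auto intro: C_infinity_lie_derivative)

text \<open>Induction on the order, for all \<open>g\<close> at once: the error \<open>D\<close>
  vanishes at time 0, and its derivative \<open>D'\<close> is the error for the Lie derivative of
  \<open>g\<close> one order lower, so integration gains a factor \<tau>. The constant must not
  depend on the trajectory, because it is used uniformly in the starting point.\<close>

lemma constant_control_taylor:
  fixes f :: "'m::finite \<Rightarrow> ('n::finite) vector_field" and g :: "'n vector_field"
  assumes f: "\<And>i. C_infinity (f i)" and "C_infinity g" and "0 < t"
  shows "\<exists>C. \<forall>Y \<tau>. traj f (\<lambda>_. v) t Y \<longrightarrow> (\<forall>s\<in>{0..t}. Y s \<in> cball c R) \<longrightarrow> \<tau> \<in> {0..t} \<longrightarrow>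
     norm (g (Y \<tau>) - (\<Sum>j<r. (\<tau> ^ j / fact j) *\<^sub>R (lie_derivative (control_field f v) ^^ j) g (Y 0))) \<le> C * \<tau> ^ r"
  using \<open>C_infinity g\<close>
proof (induction r arbitrary: g)
  case 0
  obtain C where "\<And>a. a \<in> cball c R \<Longrightarrow> norm (g a) \<le> C"
    by (rule C_infinity_bounded_on_compact[OF 0 compact_cball]) blast
  then show ?case by (intro exI[of _ C]) auto
next
  case (Suc r)
  let ?X = "control_field f v"
  have X: "C_infinity ?X" by (rule C_infinity_control_field[OF f])
  obtain C where C: "\<And>Y \<tau>. traj f (\<lambda>_. v) t Y \<Longrightarrow> (\<forall>s\<in>{0..t}. Y s \<in> cball c R) \<Longrightarrow> \<tau> \<in> {0..t} \<Longrightarrow>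
     norm (lie_derivative ?X g (Y \<tau>) - (\<Sum>j<r. (\<tau> ^ j / fact j) *\<^sub>R (lie_derivative ?X ^^ j) (lie_derivative ?X g) (Y 0))) \<le> C * \<tau> ^ r"
    using Suc.IH[OF C_infinity_lie_derivative[OF X Suc.prems]] by blast
  show ?case
  proof (intro exI[of _ "\<bar>C\<bar>"] allI impI)
    fix Y \<tau> assume Y: "traj f (\<lambda>_. v) t Y" and YR: "\<forall>s\<in>{0..t}. Y s \<in> cball c R" and \<tau>: "\<tau> \<in> {0..t}"
    have cY: "continuous_on {0..t} Y" using Y by (simp add: traj_def)
    have cXY: "continuous_on {0..t} (\<lambda>s. ?X (Y s))"
      by (rule continuous_on_compose2[OF C_infinity_continuous[OF X, of UNIV] cY]) auto
    have dY: "(Y has_vector_derivative ?X (Y s)) (at s within {0..\<tau>})" if s: "s \<in> {0..\<tau>}" for s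
    proof (rule has_vector_derivative_transform[of s "{0..\<tau>}"])
      have "((\<lambda>r. integral {0..r} (\<lambda>s. ?X (Y s))) has_vector_derivative ?X (Y s)) (at s within {0..\<tau>})"
        by (rule integral_has_vector_derivative[OF continuous_on_subset[OF cXY] s]) (use \<tau> in auto)
      from has_vector_derivative_add[OF has_vector_derivative_const this, of "Y 0"]
      show "((\<lambda>r. Y 0 + integral {0..r} (\<lambda>s. ?X (Y s))) has_vector_derivative ?X (Y s)) (at s within {0..\<tau>})" by simp
      fix r assume "r \<in> {0..\<tau>}"
      then have "((\<lambda>s. ?X (Y s)) has_integral (Y r - Y 0)) {0..r}" using Y \<tau> by (auto simp: traj_def)
      from integral_unique[OF this] show "Y r = Y 0 + integral {0..r} (\<lambda>s. ?X (Y s))" by simp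
    qed (rule s)
    define a where "a j = (lie_derivative ?X ^^ j) g (Y 0)" for j
    define D where "D s = g (Y s) - (\<Sum>j<Suc r. (s ^ j / fact j) *\<^sub>R a j)" for s
    define D' where "D' s = lie_derivative ?X g (Y s) - (\<Sum>j<r. (s ^ j / fact j) *\<^sub>R a (Suc j))" for s
    have dD: "(D has_vector_derivative D' s) (at s within {0..\<tau>})" if s: "s \<in> {0..\<tau>}" for s
    proof -
      have "((g \<circ> Y) has_vector_derivative frechet_derivative g (at (Y s)) (?X (Y s))) (at s within {0..\<tau>})"
        by (rule vector_derivative_diff_chain_within[OF dY[OF s] has_derivative_at_withinI[OF C_infinity_has_derivative[OF Suc.prems]]])
      moreover have "((\<lambda>s. \<Sum>j<Suc r. (s ^ j / fact j) *\<^sub>R a j) has_vector_derivative (\<Sum>j<r. (s ^ j / fact j) *\<^sub>R a (Suc j))) (at s within {0..\<tau>})"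
      proof -
        have tm: "((\<lambda>s. (s ^ Suc j / fact (Suc j)) *\<^sub>R a (Suc j)) has_vector_derivative (s ^ j / fact j) *\<^sub>R a (Suc j)) (at s within {0..\<tau>})" for j
        proof -
          have "((\<lambda>s. s ^ Suc j / fact (Suc j)) has_real_derivative (s ^ j / fact j)) (at s within {0..\<tau>})"
          proof (rule DERIV_cong)
            show "((\<lambda>s. s ^ Suc j / fact (Suc j)) has_real_derivative real (Suc j) * s ^ j / fact (Suc j)) (at s within {0..\<tau>})"
              by (auto intro!: derivative_eq_intros simp del: power_Suc fact_Suc)
            have "fact (Suc j) = real (Suc j) * fact j" by simp
            then show "real (Suc j) * s ^ j / fact (Suc j) = s ^ j / fact j"
              by (simp only: mult_divide_mult_cancel_left of_nat_eq_0_iff nat.simps not_False_eq_True)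
          qed
          from has_vector_derivative_scaleR[OF this has_vector_derivative_const[of "a (Suc j)"]] show ?thesis by simp
        qed
        have "((\<lambda>s. (s ^ 0 / fact 0) *\<^sub>R a 0 + (\<Sum>j<r. (s ^ Suc j / fact (Suc j)) *\<^sub>R a (Suc j))) has_vector_derivative
            0 + (\<Sum>j<r. (s ^ j / fact j) *\<^sub>R a (Suc j))) (at s within {0..\<tau>})"
          by (intro has_vector_derivative_add has_vector_derivative_sum tm) simp
        then show ?thesis unfolding sum.lessThan_Suc_shift by simp
      qed
      ultimately show ?thesis
        unfolding D_def D'_def lie_derivative_def o_def by (rule has_vector_derivative_diff)
    qed
    have "D 0 = 0" unfolding D_def sum.lessThan_Suc_shift by (simp add: a_def)
    have int: "(D' has_integral (D \<tau> - D 0)) {0..\<tau>}"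
      by (rule fundamental_theorem_of_calculus) (use \<tau> dD in auto)
    have "norm (D \<tau> - D 0) \<le> \<bar>C\<bar> * \<tau> ^ r * measure lborel {0..\<tau>}"
    proof (rule has_integral_bound_real[OF _ finite.emptyI int])
      fix s assume "s \<in> {0..\<tau>} - {}"
      then have s: "s \<in> {0..\<tau>}" "s \<in> {0..t}" using \<tau> by auto
      have "a (Suc j) = (lie_derivative ?X ^^ j) (lie_derivative ?X g) (Y 0)" for j
        unfolding a_def by (simp only: funpow_Suc_right o_apply)
      then have "norm (D' s) \<le> C * s ^ r" using C[OF Y YR s(2)] by (simp add: D'_def)
      also have "\<dots> \<le> \<bar>C\<bar> * \<tau> ^ r" using s by (intro mult_mono power_mono) auto
      finally show "norm (D' s) \<le> \<bar>C\<bar> * \<tau> ^ r" .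
    qed (use \<tau> in auto)
    then show "norm (g (Y \<tau>) - (\<Sum>j<Suc r. (\<tau> ^ j / fact j) *\<^sub>R (lie_derivative ?X ^^ j) g (Y 0))) \<le> \<bar>C\<bar> * \<tau> ^ Suc r"
      using \<open>D 0 = 0\<close> \<tau> by (simp add: D_def a_def mult_ac)
  qed
qed

lemma lie_derivative_zero: "(lie_derivative X ^^ j) (\<lambda>_. 0) = (\<lambda>_. 0)"
  by (induction j) (auto simp: lie_derivative_def)

lemma generator_flow_family:
  fixes f :: "'m::finite \<Rightarrow> ('n::finite) vector_field"
  assumes f: "\<And>i. C_infinity (f i)"
  shows "\<exists>\<phi> \<phi>'. flow_family f c 1 (f i) \<phi> \<phi>'"
proof -
  obtain t0 \<Phi> where t0: "t0 > 0" and \<Phi>: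
    "\<And>v y. norm v \<le> 1 \<Longrightarrow> y \<in> cball c (1 / 2) \<Longrightarrow> traj f (\<lambda>_. v) t0 (\<lambda>\<tau>. \<Phi> v \<tau> y)"
    "\<And>v y. norm v \<le> 1 \<Longrightarrow> y \<in> cball c (1 / 2) \<Longrightarrow> \<Phi> v 0 y = y"
    "\<And>v y \<tau>. norm v \<le> 1 \<Longrightarrow> y \<in> cball c (1 / 2) \<Longrightarrow> \<tau> \<in> {0..t0} \<Longrightarrow> \<Phi> v \<tau> y \<in> cball c 1"
    and cont: "\<And>v. norm v \<le> 1 \<Longrightarrow> continuous_on ({0..t0} \<times> cball c (1 / 2)) (\<lambda>(\<tau>, y). \<Phi> v \<tau> y)"
    and inverse: "\<And>v y \<tau>. norm v \<le> 1 \<Longrightarrow> y \<in> cball c (1 / 2) \<Longrightarrow> \<tau> \<in> {0..t0} \<Longrightarrow> \<Phi> (- v) \<tau> y \<in> cball c (1 / 2) \<Longrightarrow>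
       \<Phi> v \<tau> (\<Phi> (- v) \<tau> y) = y"
    by (rule constant_control_flow[OF f, of c]) (rule that)
  define d where "d = min t0 (1 / 2)"
  have d: "d > 0" "d \<le> t0" "d \<le> 1 / 2" using t0 by (auto simp: d_def)
  have exp: "\<exists>A. expands c (\<Phi> v) A \<and> leads A 1 (control_field f v)" if v: "norm v \<le> 1" for v
  proof -
    let ?X = "control_field f v"
    have X: "C_infinity ?X" by (rule C_infinity_control_field[OF f])
    \<comment> \<open>These are the coefficients of the formal exponential of the Lie
      derivative.\<close>
    define A where "A j g = (\<lambda>y. (1 / fact j) *\<^sub>R (lie_derivative ?X ^^ j) g y)" for j and g :: "real ^ 'n \<Rightarrow> real ^ 'n"
    have "expands c (\<Phi> v) A"
      unfolding expands_def
    proof (intro conjI allI impI)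
      show "A j (\<lambda>_. 0) = (\<lambda>_. 0)" for j by (simp add: A_def lie_derivative_zero)
      fix g :: "real ^ 'n \<Rightarrow> real ^ 'n" assume g: "C_infinity g"
      show "A 0 g = g" by (simp add: A_def)
      show "C_infinity (A j g)" for j
        unfolding A_def by (intro C_infinity_scaleR_left funpow_lie_derivative_C_infinity X g)
      fix r
      obtain C where C: "\<And>Y \<tau>. traj f (\<lambda>_. v) t0 Y \<Longrightarrow> (\<forall>s\<in>{0..t0}. Y s \<in> cball c 1) \<Longrightarrow> \<tau> \<in> {0..t0} \<Longrightarrow>
         norm (g (Y \<tau>) - (\<Sum>j<Suc r. (\<tau> ^ j / fact j) *\<^sub>R (lie_derivative ?X ^^ j) g (Y 0))) \<le> C * \<tau> ^ Suc r"
        using constant_control_taylor[of f g t0, OF f g t0, where v = v and c = c and R = 1 and r = "Suc r"] by blast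
      have "\<forall>\<^sub>F (\<tau>, y) in near0 c. norm (g (\<Phi> v \<tau> y) - (\<Sum>j\<le>r. \<tau> ^ j *\<^sub>R A j g y)) \<le> C * \<tau> ^ Suc r"
        using near0_small[OF d(1), of c]
      proof eventually_elim
        case (elim q)
        obtain \<tau> y where [simp]: "q = (\<tau>, y)" by force
        have y: "y \<in> cball c (1 / 2)" and \<tau>: "\<tau> \<in> {0..t0}" using elim d by auto
        show ?case using C[OF \<Phi>(1)[OF v y] _ \<tau>] \<Phi>(2,3)[OF v y]
          by (simp add: A_def lessThan_Suc_atMost del: sum.atMost_Suc sum.lessThan_Suc)
      qed
      then show "\<exists>C. \<forall>\<^sub>F (\<tau>, y) in near0 c. norm (g (\<Phi> v \<tau> y) - (\<Sum>j\<le>r. \<tau> ^ j *\<^sub>R A j g y)) \<le> C * \<tau> ^ Suc r" by blast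
    qed
    moreover have "leads A 1 ?X" by (simp add: leads_def A_def)
    ultimately show ?thesis by blast
  qed
  have mv: "moves f c (\<Phi> v)" if v: "norm v \<le> 1" for v
  proof -
    have "\<forall>\<^sub>F (\<tau>, y) in near0 c. reach f (1 * \<tau>) y (\<Phi> v \<tau> y)"
      using near0_small[OF d(1), of c]
    proof eventually_elim
      case (elim q)
      obtain \<tau> y where [simp]: "q = (\<tau>, y)" by force
      have y: "y \<in> cball c (1 / 2)" and \<tau>: "0 \<le> \<tau>" "\<tau> \<le> t0" using elim d by auto
      show ?case using traj_reach[OF \<Phi>(1)[OF v y], of 0 \<tau>] \<tau> \<Phi>(2)[OF v y] by simp
    qed
    moreover have "continuous_on ({0..d} \<times> cball c d) (\<lambda>(\<tau>, y). \<Phi> v \<tau> y)"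
      by (rule continuous_on_subset[OF cont[OF v]]) (use d in auto)
    ultimately show ?thesis
      unfolding moves_def using zero_le_one[where 'a=real] d(1) by blast
  qed
  have inv: "\<forall>\<^sub>F (\<tau>, y) in near0 c. \<Phi> v \<tau> (\<Phi> (- v) \<tau> y) = y" if v: "norm v \<le> 1" for v
  proof -
    have "norm (- v) \<le> 1" using v by simp
    then obtain A where A: "expands c (\<Phi> (- v)) A" using exp by blast
    show ?thesis
      using near0_small[OF d(1), of c] tame_eventually[OF expands_tame[OF A] near0_small[OF d(1), of c]]
    proof eventually_elim
      case (elim q)
      obtain \<tau> y where [simp]: "q = (\<tau>, y)" by force
      show ?case using inverse[OF v, of y \<tau>] elim d by auto
    qed
  qed
  \<comment> \<open>A unit coordinate control isolates the single field \<open>f i\<close>, and its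
    negative gives the opposite field.\<close>
  let ?e = "axis i (1::real) :: real ^ 'm"
  have e: "norm ?e \<le> 1" "norm (- ?e) \<le> 1" by (simp_all add: norm_axis_1)
  have fe: "control_field f ?e = f i" "control_field f (- ?e) = (\<lambda>y. - f i y)"
  proof -
    have "control_field f ?e y = f i y" for y
    proof -
      have "control_field f ?e y = (\<Sum>j\<in>UNIV. if j = i then f i y else 0)"
        unfolding control_field_def by (intro sum.cong) (auto simp: axis_def)
      then show ?thesis by simp
    qed
    then show "control_field f ?e = f i" "control_field f (- ?e) = (\<lambda>y. - f i y)"
      by (auto simp: control_field_minus)
  qed
  have "flow_family f c 1 (f i) (\<Phi> ?e) (\<Phi> (- ?e))"
    unfolding flow_family_def
    using mv[OF e(1)] mv[OF e(2)] inv[OF e(1)] inv[OF e(2)] exp[OF e(1)] exp[OF e(2)] by (simp add: fe)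
  then show ?thesis by blast
qed

section \<open>Iterated brackets and Hormander's condition\<close>

inductive_set lie_monomials :: "('m \<Rightarrow> ('n::finite) vector_field) \<Rightarrow> 'n vector_field set"
  for f :: "'m \<Rightarrow> ('n::finite) vector_field" where
  generator: "f i \<in> lie_monomials f"
| bracket: "X \<in> lie_monomials f \<Longrightarrow> Y \<in> lie_monomials f \<Longrightarrow> lie_bracket X Y \<in> lie_monomials f"

lemma lie_monomials_flow_family:
  fixes f :: "'m::finite \<Rightarrow> ('n::finite) vector_field"
  assumes f: "\<And>i. C_infinity (f i)" and "X \<in> lie_monomials f"
  shows "C_infinity X \<and> (\<exists>k \<phi> \<phi>'. flow_family f c k X \<phi> \<phi>')"
  using assms(2)
proof induction
  case (generator i)
  then show ?case using f generator_flow_family[of f, OF f] by blast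
next
  case (bracket X Y)
  then obtain k l \<phi> \<phi>' \<psi> \<psi>' where *: "flow_family f c k X \<phi> \<phi>'" "flow_family f c l Y \<psi> \<psi>'" "C_infinity X" "C_infinity Y"
    by blast
  show ?case using flow_family_bracket[OF *(2,1,4,3)] C_infinity_lie_bracket[OF *(3,4)] by blast
qed

text \<open>Flow families are constructed for iterated brackets of the generators, not for sums. So
  sums are pulled out: brackets of linear combinations reduce by bilinearity to linear combinations
  of \<open>lie_monomials\<close>, and only values at one point are added later, by composing
  families.\<close>

inductive_set lie_combinations :: "('m \<Rightarrow> ('n::finite) vector_field) \<Rightarrow> 'n vector_field set"
  for f :: "'m \<Rightarrow> ('n::finite) vector_field" where
  monomial: "X \<in> lie_monomials f \<Longrightarrow> X \<in> lie_combinations f"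
| add: "X \<in> lie_combinations f \<Longrightarrow> Y \<in> lie_combinations f \<Longrightarrow> (\<lambda>x. X x + Y x) \<in> lie_combinations f"
| scale: "X \<in> lie_combinations f \<Longrightarrow> (\<lambda>x. c *\<^sub>R X x) \<in> lie_combinations f"

lemma lie_combinations_C_infinity:
  fixes f :: "'m::finite \<Rightarrow> ('n::finite) vector_field"
  assumes f: "\<And>i. C_infinity (f i)" and "X \<in> lie_combinations f"
  shows "C_infinity X"
  using assms(2) by induction (use lie_monomials_flow_family[of f, OF f] in \<open>auto intro: C_infinity_add C_infinity_scaleR_left\<close>)

lemma lie_bracket_bilinear:
  assumes "C_infinity X" "C_infinity Y" "C_infinity Z"
  shows "lie_bracket (\<lambda>x. X x + Y x) Z = (\<lambda>x. lie_bracket X Z x + lie_bracket Y Z x)"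
    "lie_bracket (\<lambda>x. c *\<^sub>R X x) Z = (\<lambda>x. c *\<^sub>R lie_bracket X Z x)"
    "lie_bracket Z (\<lambda>x. X x + Y x) = (\<lambda>x. lie_bracket Z X x + lie_bracket Z Y x)"
    "lie_bracket Z (\<lambda>x. c *\<^sub>R X x) = (\<lambda>x. c *\<^sub>R lie_bracket Z X x)"
proof -
  have add: "frechet_derivative (\<lambda>x. X x + Y x) (at x) = (\<lambda>v. frechet_derivative X (at x) v + frechet_derivative Y (at x) v)" for x
    by (rule frechet_derivative_at[symmetric]) (intro has_derivative_add C_infinity_has_derivative assms)
  have sc: "frechet_derivative (\<lambda>x. c *\<^sub>R X x) (at x) = (\<lambda>v. c *\<^sub>R frechet_derivative X (at x) v)" for x
    by (rule frechet_derivative_at[symmetric]) (intro has_derivative_scaleR_right C_infinity_has_derivative assms)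
  have lin: "linear (frechet_derivative W (at x))" if "C_infinity W" for W :: "real ^ 'a \<Rightarrow> real ^ 'a" and x
    using bounded_linear_frechet_derivative[OF that] bounded_linear.linear by blast
  note l = linear_add[OF lin] linear_scale[OF lin]
  show "lie_bracket (\<lambda>x. X x + Y x) Z = (\<lambda>x. lie_bracket X Z x + lie_bracket Y Z x)"
    "lie_bracket (\<lambda>x. c *\<^sub>R X x) Z = (\<lambda>x. c *\<^sub>R lie_bracket X Z x)"
    "lie_bracket Z (\<lambda>x. X x + Y x) = (\<lambda>x. lie_bracket Z X x + lie_bracket Z Y x)"
    "lie_bracket Z (\<lambda>x. c *\<^sub>R X x) = (\<lambda>x. c *\<^sub>R lie_bracket Z X x)"
    by (auto simp: lie_bracket_def add sc l assms scaleR_diff_right)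
qed

lemma lie_algebra_subset_combinations:
  fixes f :: "'m::finite \<Rightarrow> ('n::finite) vector_field"
  assumes f: "\<And>i. C_infinity (f i)" and "X \<in> lie_algebra f"
  shows "X \<in> lie_combinations f"
proof -
  note smooth = lie_combinations_C_infinity[of f, OF f]
  \<comment> \<open>Bilinearity is used one argument at a time: here the second argument varies
    while the first is a monomial; afterwards the first varies.\<close>
  have 1: "lie_bracket X Y \<in> lie_combinations f" if "Y \<in> lie_combinations f" "X \<in> lie_monomials f" for X Y
    using that
  proof induction
    case (monomial Y)
    then show ?case by (intro lie_combinations.monomial lie_monomials.bracket)
  next
    case (add Y Z)
    have "C_infinity X" using smooth[OF lie_combinations.monomial[OF add.prems]] .
    then show ?case using add lie_bracket_bilinear(3)[OF smooth smooth] by (auto intro: lie_combinations.add)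
  next
    case (scale Y c)
    have "C_infinity X" using smooth[OF lie_combinations.monomial[OF scale.prems]] .
    then show ?case using scale lie_bracket_bilinear(4)[OF smooth smooth] by (auto intro: lie_combinations.scale)
  qed
  have 2: "lie_bracket X Y \<in> lie_combinations f" if "X \<in> lie_combinations f" "Y \<in> lie_combinations f" for X Y
    using that
  proof induction
    case (monomial X)
    then show ?case using 1 by blast
  next
    case (add X Z)
    then show ?case using lie_bracket_bilinear(1)[OF smooth smooth smooth] by (auto intro: lie_combinations.add)
  next
    case (scale X c)
    then show ?case using lie_bracket_bilinear(2)[OF smooth smooth smooth] by (auto intro: lie_combinations.scale)
  qed
  show ?thesis
    using assms(2) by induction (auto intro: lie_combinations.intros lie_monomials.generator 2)
qed

lemma lie_combinations_span:
  "X \<in> lie_combinations f \<Longrightarrow> X c \<in> span ((\<lambda>X. X c) ` lie_monomials f)"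
  by (induction rule: lie_combinations.induct) (auto intro: span_base span_add span_scale)

lemma hoermander_span:
  fixes f :: "'m::finite \<Rightarrow> ('n::finite) vector_field"
  assumes f: "\<And>i. C_infinity (f i)" and "hoermander_condition f"
  shows "span ((\<lambda>X. X c) ` lie_monomials f) = UNIV"
proof -
  have "v \<in> span ((\<lambda>X. X c) ` lie_monomials f)" for v
  proof -
    have "v \<in> lie_algebra_at f c" using assms(2) by (simp add: hoermander_condition_def)
    then obtain X where "X \<in> lie_algebra f" "v = X c" by (auto simp: lie_algebra_at_def)
    then show ?thesis using lie_combinations_span lie_algebra_subset_combinations[of f, OF f] by blast
  qed
  then show ?thesis by blast
qed

section \<open>Small-time controllability\<close>

text \<open>\<Phi> maps a parameter space of the same dimension as the state space to points
  reachable from \<open>c\<close> in arbitrarily small time. Differentiability is asked at 0 only,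
  since reparametrising by roots may destroy it elsewhere.\<close>

definition steers :: "('m::finite \<Rightarrow> ('n::finite) vector_field) \<Rightarrow> real ^ 'n \<Rightarrow> (real ^ 'n \<Rightarrow> real ^ 'n) \<Rightarrow> bool" where
  "steers f c D \<longleftrightarrow> (\<exists>\<Phi>. \<Phi> 0 = c \<and> (\<exists>\<delta>>0. continuous_on (ball 0 \<delta>) \<Phi>) \<and> (\<Phi> has_derivative D) (at 0) \<and>
     (\<forall>s>0. \<forall>\<^sub>F v in nhds 0. \<exists>s'\<le>s. reach f s' c (\<Phi> v)))"

lemma steers_zero: "steers f c (\<lambda>_. 0)"
  unfolding steers_def
proof (intro exI[of _ "\<lambda>_. c"] conjI allI impI)
  show "\<exists>\<delta>>0::real. continuous_on (ball 0 \<delta>) (\<lambda>_. c)" by (intro exI[of _ 1]) auto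
  show "\<forall>\<^sub>F v in nhds 0. \<exists>s'\<le>s. reach f s' c c" if "0 < s" for s :: real
    using that reach_0[of f c] by (intro always_eventually allI exI[of _ 0]) auto
qed auto

lemma root_tendsto_zero:
  assumes "0 < k" and h: "(h \<longlongrightarrow> 0) F"
  shows "((\<lambda>v. root k \<bar>h v\<bar>) \<longlongrightarrow> 0) F"
proof -
  have "((\<lambda>v. root k \<bar>h v\<bar>) \<longlongrightarrow> root k \<bar>0\<bar>) F" by (intro tendsto_intros h)
  then show ?thesis using \<open>0 < k\<close> by simp
qed

text \<open>Flowing along \<open>X\<close> for the signed time \<open>lam v\<close> becomes differentiable at the origin after the
  reparametrisation \<open>\<tau> = \<bar>lam v\<bar>\<^bsup>1/k\<^esup>\<close>, where \<open>k\<close> is the bracket length of \<open>X\<close>.\<close>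

lemma steers_step:
  fixes f :: "'m::finite \<Rightarrow> ('n::finite) vector_field"
  assumes fam: "flow_family f c k X \<phi> \<phi>'" and X: "C_infinity X" and lam: "bounded_linear lam" and D: "steers f c D"
  shows "steers f c (\<lambda>v. D v + lam v *\<^sub>R X c)"
proof -
  interpret lam: bounded_linear lam by fact
  obtain \<Phi> \<delta> where \<Phi>: "\<Phi> 0 = c" "\<delta> > 0" "continuous_on (ball 0 \<delta>) \<Phi>" "(\<Phi> has_derivative D) (at 0)"
    and cost: "\<And>s. s > 0 \<Longrightarrow> \<forall>\<^sub>F v in nhds 0. \<exists>s'\<le>s. reach f s' c (\<Phi> v)"
    using D unfolding steers_def by blast
  obtain A A' where A: "expands c \<phi> A" "leads A k X" and A': "expands c \<phi>' A'" "leads A' k (\<lambda>y. - X y)"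
    using fam unfolding flow_family_def by blast
  have k: "0 < k" using A(2) by (auto simp: leads_def)
  have lead: "\<exists>C. \<forall>\<^sub>F (\<tau>, y) in near0 c. norm (\<phi> \<tau> y - y - \<tau> ^ k *\<^sub>R X y) \<le> C * \<tau> ^ Suc k"
    if A: "expands c \<phi> A" "leads A k X" for \<phi> A X
  proof -
    have id: "A 0 (\<lambda>x. x) = (\<lambda>x. x)" "A k (\<lambda>x. x) = X" "\<And>j. 0 < j \<Longrightarrow> j < k \<Longrightarrow> A j (\<lambda>x. x) = (\<lambda>_. 0)"
      using A C_infinity_ident by (auto simp: expands_def leads_def lie_derivative_ident)
    have "(\<Sum>j\<le>k. \<tau> ^ j *\<^sub>R A j (\<lambda>x. x) y) = y + \<tau> ^ k *\<^sub>R X y" for \<tau> y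
    proof -
      have "(\<Sum>j\<le>k. \<tau> ^ j *\<^sub>R A j (\<lambda>x. x) y) = (\<Sum>j\<in>{0, k}. \<tau> ^ j *\<^sub>R A j (\<lambda>x. x) y)"
        by (rule sum.mono_neutral_right) (use k id(3) in auto)
      then show ?thesis using k id by simp
    qed
    moreover have "\<exists>C. \<forall>\<^sub>F (\<tau>, y) in near0 c. norm (\<phi> \<tau> y - (\<Sum>j\<le>k. \<tau> ^ j *\<^sub>R A j (\<lambda>x. x) y)) \<le> C * \<tau> ^ Suc k"
      using A(1) C_infinity_ident unfolding expands_def by blast
    ultimately show ?thesis by (simp add: diff_diff_eq)
  qed
  obtain C1 where C1: "\<forall>\<^sub>F (\<tau>, y) in near0 c. norm (\<phi> \<tau> y - y - \<tau> ^ k *\<^sub>R X y) \<le> C1 * \<tau> ^ Suc k"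
    using lead[OF A] by blast
  obtain C2 where C2: "\<forall>\<^sub>F (\<tau>, y) in near0 c. norm (\<phi>' \<tau> y - y - \<tau> ^ k *\<^sub>R (- X y)) \<le> C2 * \<tau> ^ Suc k"
    using lead[OF A'] by blast
  define \<sigma> where "\<sigma> v = root k \<bar>lam v\<bar>" for v
  have \<sigma>: "\<sigma> v \<ge> 0" "\<sigma> v ^ k = \<bar>lam v\<bar>" for v using k by (auto simp: \<sigma>_def real_root_pow_pos2)
  \<comment> \<open>A negative parameter is served by the inverse family. Both branches start from
    the point \<Phi> v already reached.\<close>
  define \<Psi> where "\<Psi> v = (if lam v \<le> 0 then \<phi>' (\<sigma> v) (\<Phi> v) else \<phi> (\<sigma> v) (\<Phi> v))" for v
  have "isCont \<Phi> 0" using \<Phi>(2,3) by (meson centre_in_ball continuous_on_eq_continuous_at open_ball)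
  then have \<Phi>lim: "(\<Phi> \<longlongrightarrow> c) (nhds 0)" using \<Phi>(1) by (simp add: tendsto_nhds_iff isCont_def)
  have lamlim: "(lam \<longlongrightarrow> 0) (nhds 0)"
    using lam.tendsto[OF tendsto_ident_at, of 0 UNIV] by (simp add: tendsto_nhds_iff lam.zero)
  have \<sigma>lim: "(\<sigma> \<longlongrightarrow> 0) (nhds 0)" unfolding \<sigma>_def by (rule root_tendsto_zero[OF k lamlim])
  have sub: "\<forall>\<^sub>F v in nhds 0. P (\<sigma> v) (\<Phi> v)" if "\<forall>\<^sub>F (\<tau>, y) in near0 c. P \<tau> y" for P
  proof -
    obtain d where d: "d > 0" "\<And>\<tau> y. \<tau> \<in> {0..d} \<Longrightarrow> y \<in> cball c d \<Longrightarrow> P \<tau> y"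
      using \<open>\<forall>\<^sub>F (\<tau>, y) in near0 c. P \<tau> y\<close> unfolding eventually_near0 by auto
    show ?thesis
      using tendstoD[OF \<sigma>lim d(1)] tendstoD[OF \<Phi>lim d(1)]
    proof eventually_elim
      case (elim v)
      then show ?case using \<sigma>(1)[of v] by (intro d(2)) (auto simp: dist_commute)
    qed
  qed
  \<comment> \<open>At \<tau> = 0 the leading and error terms vanish, since k > 0, so both families
    are the identity there. This glues the two branches of \<Psi> continuously where lam v =
    0.\<close>
  have zero: "\<forall>\<^sub>F (\<tau>, y) in near0 c. \<tau> = 0 \<longrightarrow> \<phi> \<tau> y = y \<and> \<phi>' \<tau> y = y"
    using C1 C2 by eventually_elim (use k in \<open>auto simp: power_0_left\<close>)
  have \<Psi>0: "\<Psi> 0 = c"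
    using eventually_nhds_x_imp_x[OF sub[OF zero]] k by (simp add: \<Psi>_def \<sigma>_def lam.zero \<Phi>(1))
  \<comment> \<open>The error is of order \<bar>lam v\<bar> * \<sigma> v with \<sigma> v tending to
    0, hence little-o of norm v: its derivative at 0 is zero although \<sigma> is in general not
    differentiable there.\<close>
  define err where "err v = \<Psi> v - \<Phi> v - lam v *\<^sub>R X (\<Phi> v)" for v
  have err: "\<forall>\<^sub>F v in nhds 0. norm (err v) \<le> (\<bar>C1\<bar> + \<bar>C2\<bar>) * (\<bar>lam v\<bar> * \<sigma> v)"
    using sub[OF C1] sub[OF C2]
  proof eventually_elim
    case (elim v)
    have nn: "0 \<le> \<bar>lam v\<bar> * \<sigma> v" using \<sigma>(1)[of v] by simp
    have pw: "\<sigma> v ^ Suc k = \<bar>lam v\<bar> * \<sigma> v" using \<sigma>(2)[of v] by simp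
    show ?case
    proof (cases "lam v \<le> 0")
      case True
      then have "err v = \<phi>' (\<sigma> v) (\<Phi> v) - \<Phi> v - \<sigma> v ^ k *\<^sub>R (- X (\<Phi> v))"
        using \<sigma>(2)[of v] by (simp add: err_def \<Psi>_def)
      then have "norm (err v) \<le> C2 * (\<bar>lam v\<bar> * \<sigma> v)" using elim(2) unfolding pw by simp
      also have "\<dots> \<le> (\<bar>C1\<bar> + \<bar>C2\<bar>) * (\<bar>lam v\<bar> * \<sigma> v)" using nn by (intro mult_right_mono) auto
      finally show ?thesis .
    next
      case False
      then have "err v = \<phi> (\<sigma> v) (\<Phi> v) - \<Phi> v - \<sigma> v ^ k *\<^sub>R X (\<Phi> v)"
        using \<sigma>(2)[of v] by (simp add: err_def \<Psi>_def)
      then have "norm (err v) \<le> C1 * (\<bar>lam v\<bar> * \<sigma> v)" using elim(1) unfolding pw by simp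
      also have "\<dots> \<le> (\<bar>C1\<bar> + \<bar>C2\<bar>) * (\<bar>lam v\<bar> * \<sigma> v)" using nn by (intro mult_right_mono) auto
      finally show ?thesis .
    qed
  qed
  obtain B where B: "B > 0" "\<And>v. norm (lam v) \<le> norm v * B" using lam.pos_bounded by blast
  have err0: "err 0 = 0" by (simp add: err_def \<Psi>0 \<Phi>(1) lam.zero)
  have derr: "(err has_derivative (\<lambda>_. 0)) (at 0)"
    unfolding has_derivative_within_alt2
  proof (intro conjI allI impI bounded_linear_zero)
    fix e :: real assume "e > 0"
    define \<eta> where "\<eta> = e / ((\<bar>C1\<bar> + \<bar>C2\<bar> + 1) * B)"
    have "(\<bar>C1\<bar> + \<bar>C2\<bar> + 1) * B > 0" using B(1) by (intro mult_pos_pos add_nonneg_pos) auto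
    then have \<eta>e: "((\<bar>C1\<bar> + \<bar>C2\<bar> + 1) * B) * \<eta> = e" unfolding \<eta>_def by (metis less_irrefl nonzero_mult_div_cancel_left times_divide_eq_right)
    have \<eta>: "\<eta> > 0" using \<open>e > 0\<close> B(1) by (simp add: \<eta>_def add_nonneg_pos)
    have "\<forall>\<^sub>F v in nhds 0. norm (err v - err 0 - 0) \<le> e * norm (v - 0)"
      using err tendstoD[OF \<sigma>lim \<eta>]
    proof eventually_elim
      case (elim v)
      have "\<sigma> v \<le> \<eta>" using elim(2) by simp
      then have "\<bar>lam v\<bar> * \<sigma> v \<le> (norm v * B) * \<eta>"
        using B(2)[of v] \<sigma>(1)[of v] B(1) by (intro mult_mono) auto
      then have "(\<bar>C1\<bar> + \<bar>C2\<bar>) * (\<bar>lam v\<bar> * \<sigma> v) \<le> (\<bar>C1\<bar> + \<bar>C2\<bar> + 1) * ((norm v * B) * \<eta>)"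
        by (rule mult_mono[rotated]) (use \<sigma>(1)[of v] in auto)
      also have "\<dots> = e * norm v" unfolding \<eta>e[symmetric] by (simp only: mult_ac)
      finally show ?case using elim(1) err0 by simp
    qed
    then show "\<forall>\<^sub>F v in at 0. norm (err v - err 0 - 0) \<le> e * norm (v - 0)"
      by (rule filter_leD[rotated]) (simp add: at_within_le_nhds)
  qed
  have dX: "((\<lambda>v. X (\<Phi> v)) has_derivative (\<lambda>h. frechet_derivative X (at (\<Phi> 0)) (D h))) (at 0)"
    by (rule has_derivative_compose[OF \<Phi>(4) C_infinity_has_derivative[OF X]])
  \<comment> \<open>In the product rule the derivative of \<open>X\<close> is multiplied by lam 0 =
    0, so only the value X c survives.\<close>
  have "((\<lambda>v. \<Phi> v + lam v *\<^sub>R X (\<Phi> v) + err v) has_derivative (\<lambda>h. D h + (lam 0 *\<^sub>R frechet_derivative X (at (\<Phi> 0)) (D h) + lam h *\<^sub>R X (\<Phi> 0)) + 0)) (at 0)"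
    by (intro has_derivative_add has_derivative_scaleR \<Phi>(4) derr dX bounded_linear_imp_has_derivative lam)
  then have der: "(\<Psi> has_derivative (\<lambda>v. D v + lam v *\<^sub>R X c)) (at 0)"
    by (simp add: err_def lam.zero \<Phi>(1) fun_eq_iff)
  have mv: "moves f c \<phi>" "moves f c \<phi>'" using fam unfolding flow_family_def by blast+
  obtain d1 where d1: "d1 > 0" "continuous_on ({0..d1} \<times> cball c d1) (\<lambda>(\<tau>, y). \<phi> \<tau> y)"
    using mv(1) unfolding moves_def by blast
  obtain d2 where d2: "d2 > 0" "continuous_on ({0..d2} \<times> cball c d2) (\<lambda>(\<tau>, y). \<phi>' \<tau> y)"
    using mv(2) unfolding moves_def by blast
  have "\<forall>\<^sub>F v in nhds 0. (\<sigma> v, \<Phi> v) \<in> {0..d1} \<times> cball c d1 \<and> (\<sigma> v, \<Phi> v) \<in> {0..d2} \<times> cball c d2 \<and>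
      (\<sigma> v = 0 \<longrightarrow> \<phi> (\<sigma> v) (\<Phi> v) = \<Phi> v \<and> \<phi>' (\<sigma> v) (\<Phi> v) = \<Phi> v) \<and> v \<in> ball 0 \<delta>"
    using sub[OF near0_small[OF d1(1)]] sub[OF near0_small[OF d2(1)]] sub[OF zero] eventually_nhds_ball[OF \<Phi>(2), of 0]
    by eventually_elim auto
  then obtain d where d: "d > 0" "\<And>v. v \<in> ball 0 d \<Longrightarrow> (\<sigma> v, \<Phi> v) \<in> {0..d1} \<times> cball c d1 \<and> (\<sigma> v, \<Phi> v) \<in> {0..d2} \<times> cball c d2 \<and>
      (\<sigma> v = 0 \<longrightarrow> \<phi> (\<sigma> v) (\<Phi> v) = \<Phi> v \<and> \<phi>' (\<sigma> v) (\<Phi> v) = \<Phi> v) \<and> v \<in> ball 0 \<delta>"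
    unfolding eventually_nhds_metric by (auto simp: dist_commute)
  have cp: "continuous_on (ball 0 d) (\<lambda>v. (\<sigma> v, \<Phi> v))"
  proof (rule continuous_on_Pair)
    show "continuous_on (ball 0 d) \<sigma>" unfolding \<sigma>_def by (intro continuous_intros lam.continuous_on)
    show "continuous_on (ball 0 d) \<Phi>" by (rule continuous_on_subset[OF \<Phi>(3)]) (use d(2) in blast)
  qed
  have cont: "continuous_on (ball 0 d) \<Psi>"
    unfolding \<Psi>_def
  proof (rule continuous_on_cases_le)
    have *: "continuous_on (ball 0 d) (\<lambda>v. (\<lambda>(\<tau>, y). \<phi>' \<tau> y) (\<sigma> v, \<Phi> v))"
      by (rule continuous_on_compose2[OF d2(2) cp]) (use d(2) in blast)
    show "continuous_on {v \<in> ball 0 d. lam v \<le> 0} (\<lambda>v. \<phi>' (\<sigma> v) (\<Phi> v))"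
      by (rule continuous_on_subset[OF *[unfolded case_prod_conv]]) auto
    have *: "continuous_on (ball 0 d) (\<lambda>v. (\<lambda>(\<tau>, y). \<phi> \<tau> y) (\<sigma> v, \<Phi> v))"
      by (rule continuous_on_compose2[OF d1(2) cp]) (use d(2) in blast)
    show "continuous_on {v \<in> ball 0 d. 0 \<le> lam v} (\<lambda>v. \<phi> (\<sigma> v) (\<Phi> v))"
      by (rule continuous_on_subset[OF *[unfolded case_prod_conv]]) auto
    show "continuous_on (ball 0 d) lam" by (intro lam.continuous_on continuous_intros)
    fix v assume "v \<in> ball 0 d" "lam v = 0"
    then show "\<phi>' (\<sigma> v) (\<Phi> v) = \<phi> (\<sigma> v) (\<Phi> v)" using d(2)[of v] k by (simp add: \<sigma>_def)
  qed
  obtain N1 where N1: "N1 \<ge> 0" "\<forall>\<^sub>F (\<tau>, y) in near0 c. reach f (N1 * \<tau>) y (\<phi> \<tau> y)"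
    using mv(1) unfolding moves_def by blast
  obtain N2 where N2: "N2 \<ge> 0" "\<forall>\<^sub>F (\<tau>, y) in near0 c. reach f (N2 * \<tau>) y (\<phi>' \<tau> y)"
    using mv(2) unfolding moves_def by blast
  have "\<forall>\<^sub>F v in nhds 0. \<exists>s'\<le>s. reach f s' c (\<Psi> v)" if "s > 0" for s
  proof -
    \<comment> \<open>Half of the time budget goes to reaching \<Phi> v, the other half to the new
      leg.\<close>
    have s2: "s / 2 > 0" and s3: "s / (2 * (N1 + N2 + 1)) > 0" using that N1(1) N2(1) by auto
    show ?thesis
      using cost[OF s2] sub[OF N1(2)] sub[OF N2(2)] tendstoD[OF \<sigma>lim s3]
    proof eventually_elim
      case (elim v)
      obtain s' where s': "s' \<le> s / 2" "reach f s' c (\<Phi> v)" using elim(1) by blast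
      have "(N1 + N2 + 1) * \<sigma> v \<le> (N1 + N2 + 1) * (s / (2 * (N1 + N2 + 1)))"
        using elim(4) N1(1) N2(1) by (intro mult_left_mono) auto
      moreover have "n * (s / (2 * n)) = s / 2" if "n > 0" for n using that by simp
      moreover have "N1 + N2 + 1 > 0" using N1(1) N2(1) by simp
      ultimately have "(N1 + N2 + 1) * \<sigma> v \<le> s / 2" by metis
      moreover have "N1 * \<sigma> v \<le> (N1 + N2 + 1) * \<sigma> v" "N2 * \<sigma> v \<le> (N1 + N2 + 1) * \<sigma> v"
        using N1(1) N2(1) \<sigma>(1)[of v] by (auto intro!: mult_right_mono)
      ultimately have "s' + N1 * \<sigma> v \<le> s" "s' + N2 * \<sigma> v \<le> s" using s' by auto
      moreover have "reach f (s' + N1 * \<sigma> v) c (\<phi> (\<sigma> v) (\<Phi> v))" "reach f (s' + N2 * \<sigma> v) c (\<phi>' (\<sigma> v) (\<Phi> v))"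
        using reach_trans[OF s'(2)] elim(2,3) by blast+
      ultimately show ?case unfolding \<Psi>_def by auto
    qed
  qed
  then show ?thesis
    unfolding steers_def using \<Psi>0 der cont d(1) by blast
qed

text \<open>The directions that can be added to the derivative of a steering map form a subspace
  containing the values at \<open>c\<close> of all iterated brackets, hence every vector. Adding the
  basis directions one by one gives a map with derivative the identity, and an open mapping theorem
  for continuous maps differentiable at a single point shows that it covers a neighbourhood of
  \<open>c\<close>.\<close>

lemma small_time_reachability:
  fixes f :: "'m::finite \<Rightarrow> ('n::finite) vector_field"
  assumes f: "\<And>i. C_infinity (f i)" and "hoermander_condition f" and "s > 0"
  obtains \<delta> where "\<delta> > 0" "\<And>z. z \<in> ball c \<delta> \<Longrightarrow> \<exists>s'\<le>s. reach f s' c z"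
proof -
  \<comment> \<open>Quantifying over every \<open>D\<close> and every functional \<open>lam\<close>
    makes \<open>V\<close> a subspace: a sum is obtained by two successive additions, and a scalar
    is absorbed in \<open>lam\<close>.\<close>
  define V where "V = {e. \<forall>D lam. bounded_linear lam \<longrightarrow> steers f c D \<longrightarrow> steers f c (\<lambda>v. D v + lam v *\<^sub>R e)}"
  have "subspace V"
    unfolding subspace_def
  proof (intro conjI ballI allI)
    show "0 \<in> V" by (simp add: V_def)
    fix x y :: "real ^ 'n" and r :: real assume x: "x \<in> V"
    show "r *\<^sub>R x \<in> V"
      unfolding V_def
    proof (intro CollectI allI impI)
      fix D and lam :: "real ^ 'n \<Rightarrow> real" assume "bounded_linear lam" "steers f c D"
      then have "steers f c (\<lambda>v. D v + (lam v * r) *\<^sub>R x)"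
        using x bounded_linear_mult_const[of lam r] by (simp add: V_def)
      then show "steers f c (\<lambda>v. D v + lam v *\<^sub>R r *\<^sub>R x)" by simp
    qed
    assume y: "y \<in> V"
    show "x + y \<in> V"
      unfolding V_def
    proof (intro CollectI allI impI)
      fix D and lam :: "real ^ 'n \<Rightarrow> real" assume lam: "bounded_linear lam" and D: "steers f c D"
      have "steers f c (\<lambda>v. D v + lam v *\<^sub>R x)" using x lam D by (simp add: V_def)
      then have "steers f c (\<lambda>v. (D v + lam v *\<^sub>R x) + lam v *\<^sub>R y)" using y lam unfolding V_def by blast
      then show "steers f c (\<lambda>v. D v + lam v *\<^sub>R (x + y))" by (simp add: algebra_simps)
    qed
  qed
  moreover have "(\<lambda>X. X c) ` lie_monomials f \<subseteq> V"
  proof clarify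
    fix X assume "X \<in> lie_monomials f"
    then obtain k \<phi> \<phi>' where "C_infinity X" "flow_family f c k X \<phi> \<phi>'"
      using lie_monomials_flow_family[of f, OF f] by blast
    then show "X c \<in> V" unfolding V_def using steers_step by blast
  qed
  ultimately have V: "V = UNIV"
    using span_minimal hoermander_span[of f c, OF f assms(2)] by blast
  have "steers f c (\<lambda>v. \<Sum>b\<in>S. (v \<bullet> b) *\<^sub>R b)" if "finite S" for S
    using that
  proof induction
    case empty
    then show ?case using steers_zero by simp
  next
    case (insert b S)
    have "steers f c (\<lambda>v. (\<Sum>b\<in>S. (v \<bullet> b) *\<^sub>R b) + (v \<bullet> b) *\<^sub>R b)"
      using V insert.IH bounded_linear_inner_left[of b] unfolding V_def by blast
    then show ?case using insert.hyps by (simp add: add.commute)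
  qed
  from this[OF finite_Basis] have "steers f c (\<lambda>v. v)" by (simp add: euclidean_representation)
  then obtain \<Phi> \<delta> where \<Phi>: "\<Phi> 0 = c" "\<delta> > 0" "continuous_on (ball 0 \<delta>) \<Phi>" "(\<Phi> has_derivative (\<lambda>v. v)) (at 0)"
    and cost: "\<forall>\<^sub>F v in nhds 0. \<exists>s'\<le>s. reach f s' c (\<Phi> v)"
    using \<open>s > 0\<close> unfolding steers_def by blast
  obtain d where d: "d > 0" "\<And>v. v \<in> ball 0 d \<Longrightarrow> \<exists>s'\<le>s. reach f s' c (\<Phi> v)"
    using cost unfolding eventually_nhds_metric by (auto simp: dist_commute)
  have "\<Phi> 0 \<in> interior (\<Phi> ` ball 0 (min d \<delta>))"
  proof (rule sussmann_open_mapping[OF open_ball \<Phi>(3) _ \<Phi>(4), where g' = "\<lambda>v. v"])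
    show "(\<lambda>v. v) \<circ> (\<lambda>v. v) = (id :: real ^ 'n \<Rightarrow> _)" by (simp add: fun_eq_iff)
    show "(0 :: real ^ 'n) \<in> interior (ball 0 (min d \<delta>))" using d(1) \<Phi>(2) by simp
  qed (use \<Phi>(2) bounded_linear_ident in auto)
  then obtain e where e: "e > 0" "ball c e \<subseteq> \<Phi> ` ball 0 (min d \<delta>)"
    using \<Phi>(1) by (auto simp: mem_interior)
  show ?thesis
  proof (rule that[OF e(1)])
    fix z assume "z \<in> ball c e"
    then obtain v where "v \<in> ball 0 (min d \<delta>)" "z = \<Phi> v" using e(2) by blast
    then show "\<exists>s'\<le>s. reach f s' c z" using d(2)[of v] by simp
  qed
qed

section \<open>Finiteness and continuity of the minimum time\<close>

lemma minimum_time_triangle: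
  assumes f: "\<And>i. continuous_on UNIV (f i)" and xy: "reach f s x y"
  shows "minimum_time K f x \<le> ennreal s + minimum_time K f y"
proof (rule ennreal_le_epsilon)
  fix e :: real assume fin: "ennreal s + minimum_time K f y < top" and "e > 0"
  have s: "0 \<le> s" using xy by (simp add: reach_def)
  let ?A = "{ennreal t | t. \<exists>k\<in>K. reach f t y k}"
  have "minimum_time K f y < top" using fin by (auto simp: less_top[symmetric])
  then obtain r where r: "0 \<le> r" "minimum_time K f y = ennreal r"
    using ennreal_enn2real enn2real_nonneg by metis
  then have "Inf ?A < Inf ?A + ennreal e"
    using \<open>e > 0\<close> unfolding minimum_time_eq[of f K y, OF f]
    by (simp add: ennreal_plus[symmetric] ennreal_less_iff del: ennreal_plus)
  then obtain t k where t: "k \<in> K" "reach f t y k" "ennreal t < Inf ?A + ennreal e"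
    unfolding Inf_less_iff by blast
  have "0 \<le> t" using t(2) by (simp add: reach_def)
  have "reach f (s + t) x k" by (rule reach_trans[OF xy t(2)])
  then have "minimum_time K f x \<le> ennreal (s + t)"
    unfolding minimum_time_eq[of f K x, OF f] using t(1) by (intro Inf_lower) blast
  also have "\<dots> = ennreal s + ennreal t" using s \<open>0 \<le> t\<close> by (rule ennreal_plus)
  also have "\<dots> \<le> ennreal s + (minimum_time K f y + ennreal e)"
    unfolding minimum_time_eq[of f K y, OF f] using t(3) by (intro add_left_mono) simp
  finally show "minimum_time K f x \<le> ennreal s + minimum_time K f y + ennreal e" by (simp add: add.assoc)
qed

text \<open>By \<open>reach_sym\<close> a point and its neighbours reach each other, so finiteness
  propagates both ways: the set where the time is finite and its complement are open. The space is
  connected and the set contains \<open>K\<close>.\<close>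

lemma minimum_time_finite:
  fixes f :: "'m::finite \<Rightarrow> ('n::finite) vector_field"
  assumes f: "\<And>i. C_infinity (f i)" and H: "hoermander_condition f" and "K \<noteq> {}"
  shows "minimum_time K f x < top"
proof -
  have fc: "\<And>i. continuous_on UNIV (f i)" using f C_infinity_continuous by blast
  have nbhd: "\<exists>\<delta>>0. \<forall>z\<in>ball x \<delta>. minimum_time K f z < top \<longleftrightarrow> minimum_time K f x < top" for x
  proof -
    obtain \<delta> where d: "\<delta> > 0" "\<And>z. z \<in> ball x \<delta> \<Longrightarrow> \<exists>s'\<le>1. reach f s' x z"
      by (rule small_time_reachability[of f 1 x, OF f H zero_less_one]) blast
    show ?thesis
    proof (intro exI[of _ \<delta>] conjI ballI d(1))
      fix z assume "z \<in> ball x \<delta>"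
      then obtain s where s: "reach f s x z" using d(2) by blast
      have "minimum_time K f x \<le> ennreal s + minimum_time K f z" "minimum_time K f z \<le> ennreal s + minimum_time K f x"
        using minimum_time_triangle[of f, OF fc s] minimum_time_triangle[of f, OF fc reach_sym[OF s]] by auto
      then show "minimum_time K f z < top \<longleftrightarrow> minimum_time K f x < top"
        by (metis ennreal_add_eq_top ennreal_neq_top less_top top.extremum_uniqueI)
    qed
  qed
  let ?S = "{x. minimum_time K f x < top}"
  have "open ?S" unfolding open_contains_ball using nbhd by (metis mem_Collect_eq subsetI)
  moreover have "open (- ?S)" unfolding open_contains_ball using nbhd by (metis ComplD ComplI mem_Collect_eq subsetI)
  moreover have "?S \<noteq> {}"
  proof -
    obtain k where "k \<in> K" using \<open>K \<noteq> {}\<close> by blast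
    then have "minimum_time K f k \<le> ennreal 0"
      unfolding minimum_time_eq[of f K k, OF fc] using reach_0 by (intro Inf_lower) blast
    then have "minimum_time K f k < top" by (simp add: le_less_trans)
    then show ?thesis by blast
  qed
  moreover from calculation have "?S = {} \<or> ?S = UNIV" using clopen[of ?S] by (simp add: closed_def)
  ultimately show ?thesis by blast
qed

text \<open>Continuity follows from the triangle inequality in both directions together with
  \<open>small_time_reachability\<close>; the other properties restate the infimum for real
  values.\<close>

lemma minimum_time_real:
  fixes f :: "'m::finite \<Rightarrow> ('n::finite) vector_field"
  assumes f: "\<And>i. C_infinity (f i)" and H: "hoermander_condition f" and "K \<noteq> {}"
  obtains T :: "real ^ 'n \<Rightarrow> real" where "\<And>x. minimum_time K f x = ennreal (T x)" "\<And>x. T x \<ge> 0"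
    "continuous_on UNIV T" "\<And>s x y. reach f s x y \<Longrightarrow> T x \<le> s + T y"
    "\<And>x e. e > 0 \<Longrightarrow> \<exists>t k. k \<in> K \<and> t < T x + e \<and> reach f t x k"
    "\<And>k. k \<in> K \<Longrightarrow> T k = 0"
proof -
  have fc: "\<And>i. continuous_on UNIV (f i)" using f C_infinity_continuous by blast
  define T where "T x = enn2real (minimum_time K f x)" for x
  have eq: "minimum_time K f x = ennreal (T x)" for x
    using minimum_time_finite[of f K x, OF f H \<open>K \<noteq> {}\<close>] by (simp add: T_def)
  have nn: "T x \<ge> 0" for x by (simp add: T_def)
  have tri: "T x \<le> s + T y" if "reach f s x y" for s x y
  proof -
    have "0 \<le> s" using that by (simp add: reach_def)
    moreover have "ennreal (T x) \<le> ennreal s + ennreal (T y)"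
      using minimum_time_triangle[of f, OF fc that, of K] by (simp add: eq)
    ultimately show ?thesis using nn by (simp add: ennreal_plus[symmetric] del: ennreal_plus)
  qed
  have "continuous_on UNIV T"
    unfolding continuous_on_iff
  proof (intro ballI allI impI)
    fix x :: "real ^ 'n" and e :: real assume "e > 0"
    then have e2: "e / 2 > 0" by simp
    obtain \<delta> where d: "\<delta> > 0" "\<And>z. z \<in> ball x \<delta> \<Longrightarrow> \<exists>s'\<le>e / 2. reach f s' x z"
      by (rule small_time_reachability[of f "e / 2" x, OF f H e2]) blast
    show "\<exists>d>0. \<forall>z\<in>UNIV. dist z x < d \<longrightarrow> dist (T z) (T x) < e"
    proof (intro exI[of _ \<delta>] conjI ballI impI d(1))
      fix z assume "dist z x < \<delta>"
      then have "z \<in> ball x \<delta>" by (simp add: dist_commute)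
      then obtain s where s: "s \<le> e / 2" "reach f s x z" using d(2) by blast
      show "dist (T z) (T x) < e"
        using tri[OF s(2)] tri[OF reach_sym[OF s(2)]] s(1) \<open>e > 0\<close> by (simp add: dist_real_def abs_less_iff)
    qed
  qed
  moreover have "\<exists>t k. k \<in> K \<and> t < T x + e \<and> reach f t x k" if "e > 0" for x e
  proof -
    have "Inf {ennreal t | t. \<exists>k\<in>K. reach f t x k} < ennreal (T x + e)"
      using eq[of x] nn[of x] that unfolding minimum_time_eq[of f K x, OF fc] by (simp add: ennreal_less_iff)
    then obtain t k where tk: "k \<in> K" "reach f t x k" "ennreal t < ennreal (T x + e)"
      unfolding Inf_less_iff by blast
    then have "t < T x + e" by (simp add: ennreal_less_iff reach_def)
    then show ?thesis using tk by blast
  qed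
  moreover have "T k = 0" if "k \<in> K" for k
  proof -
    have "minimum_time K f k \<le> ennreal 0"
      unfolding minimum_time_eq[of f K k, OF fc] using that reach_0 by (intro Inf_lower) blast
    then show ?thesis by (simp add: T_def)
  qed
  ultimately show ?thesis using that eq nn tri by blast
qed

section \<open>Proximal subgradients of the minimum time function\<close>

text \<open>Hormander's condition has done its work: it survives only in the finiteness and
  continuity of \<open>T\<close>.\<close>

locale value_function =
  fixes f :: "'m::finite \<Rightarrow> ('n::finite) vector_field" and K :: "(real ^ 'n) set" and T :: "real ^ 'n \<Rightarrow> real"
  assumes smooth: "C_infinity (f i)"
    and nonneg: "0 \<le> T x"
    and cont: "continuous_on UNIV T"
    and triangle: "reach f s x y \<Longrightarrow> T x \<le> s + T y"
    and near_optimal: "e > 0 \<Longrightarrow> \<exists>t k. k \<in> K \<and> t < T x + e \<and> reach f t x k"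
    and target: "k \<in> K \<Longrightarrow> T k = 0"
begin

text \<open>The coefficient \<sigma> and the radius \<open>r\<close> are explicit arguments because
  the suboptimality is later chosen small relative to them.\<close>

definition proximal_subgradient :: "real ^ 'n \<Rightarrow> real ^ 'n \<Rightarrow> real \<Rightarrow> real \<Rightarrow> bool" where
  "proximal_subgradient z \<zeta> \<sigma> r \<longleftrightarrow> 0 < r \<and> 0 \<le> \<sigma> \<and>
     (\<forall>y\<in>cball z r. T z + \<zeta> \<bullet> (y - z) - \<sigma> * (norm (y - z))\<^sup>2 \<le> T y)"

text \<open>A proximal subgradient is transported along a nearly optimal trajectory until the trajectory
  meets the level set \<open>T = \<tau>'\<close>; the price is the suboptimality \<open>e\<close>, which can be made
  arbitrarily small while the quadratic coefficient stays fixed.\<close>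

lemma subgradient_transport:
  assumes lb: "local_bounds f x R M L" and t1: "L * t1 \<le> 1 / 4" "M * t1 < R / 8"
    and z: "z \<in> cball x (R / 8)" and sg: "proximal_subgradient z \<zeta> \<sigma> r"
    and \<tau>': "0 \<le> \<tau>'" "\<tau>' \<le> T z" "T z - \<tau>' + e \<le> t1" and "0 < e"
  obtains y p where "T y = \<tau>'" "y \<in> cball x (R / 4)" "norm (p - \<zeta>) \<le> norm \<zeta> / 2"
    "\<And>y'. y' \<in> cball y (min (R / 16) (r / 2)) \<Longrightarrow>
       \<tau>' - e + p \<bullet> (y' - y) - (8 * norm \<zeta> + 4 * \<sigma>) * (norm (y' - y))\<^sup>2 \<le> T y'"
proof -
  have RM: "R > 0" "M > 0" "L > 0" using lb by (auto simp: local_bounds_def)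
  obtain t k where tk: "k \<in> K" "t < T z + e" "reach f t z k" using near_optimal[OF \<open>0 < e\<close>] by blast
  obtain u Y where Y: "0 \<le> t" "traj f u t Y" "Y 0 = z" "Y t = k" using tk(3) by (auto simp: reach_def)
  have cTY: "continuous_on {0..t} (\<lambda>s. T (Y s))"
    by (rule continuous_on_compose2[OF cont]) (use Y in \<open>auto simp: traj_def\<close>)
  \<comment> \<open>Along the trajectory \<open>T\<close> goes continuously from T z \<ge> \<tau>'
    down to 0 on the target, so it meets the level.\<close>
  have "\<exists>s\<ge>0. s \<le> t \<and> T (Y s) = \<tau>'"
    by (rule IVT2'[OF _ _ Y(1) cTY]) (use Y \<tau>' target[OF tk(1)] in auto)
  then obtain s where s: "0 \<le> s" "s \<le> t" "T (Y s) = \<tau>'" by blast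
  \<comment> \<open>The piece after \<open>s\<close> needs time at least \<tau>' and the whole takes
    less than T z + e, so the level is met no later than T z - \<tau>' + e.\<close>
  have "T (Y s) \<le> (t - s) + T (Y t)" by (rule triangle[OF traj_reach[OF Y(2)]]) (use s in auto)
  then have s_le: "s \<le> T z - \<tau>' + e" using s tk target[OF tk(1)] Y(4) by simp
  then have "s \<le> t1" using \<tau>' by simp
  have "L * s \<le> L * t1" "M * s \<le> M * t1" using \<open>s \<le> t1\<close> RM by auto
  then have Ls: "L * s \<le> 1 / 4" and Ms: "M * s < R / 8" using t1 by auto
  have Ys: "traj f u s Y" using traj_shift[OF Y(2), of 0 s] s by simp
  have Y0: "Y 0 \<in> cball x (R / 2)" using z Y(3) RM by simp
  have YR: "Y r \<in> cball x R" if "r \<in> {0..s}" for r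
    by (rule traj_stays[OF lb Ys Y0 _ that]) (use Ms RM in auto)
  define y where "y = Y s"
  have "norm (Y s - Y 0) \<le> M * \<bar>s - 0\<bar>" by (rule traj_speed[OF lb Ys YR]) (use s in auto)
  then have "dist z y \<le> R / 8" using Ms s(1) Y(3) by (simp add: y_def dist_norm norm_minus_commute)
  then have y: "y \<in> cball x (R / 4)" using z dist_triangle[of x y z] by simp
  have "\<exists>p. norm (p - \<zeta>) \<le> norm \<zeta> / 2 \<and> (\<forall>Z. traj f u s Z \<longrightarrow> (\<forall>r\<in>{0..s}. Z r \<in> cball x R) \<longrightarrow>
      \<bar>p \<bullet> (Z s - Y s) - \<zeta> \<bullet> (Z 0 - Y 0)\<bar> \<le> 8 * norm \<zeta> * (norm (Z s - Y s))\<^sup>2)"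
    by (rule adjoint_transport[OF smooth lb Ys Ls s(1) YR, of \<zeta>]) (assumption, blast)
  then obtain p where p: "norm (p - \<zeta>) \<le> norm \<zeta> / 2"
    "\<And>Z. traj f u s Z \<Longrightarrow> (\<And>r. r \<in> {0..s} \<Longrightarrow> Z r \<in> cball x R) \<Longrightarrow>
      \<bar>p \<bullet> (Z s - Y s) - \<zeta> \<bullet> (Z 0 - Y 0)\<bar> \<le> 8 * norm \<zeta> * (norm (Z s - Y s))\<^sup>2"
    by blast
  show ?thesis
  proof (rule that[of y p])
    show "T y = \<tau>'" using s(3) by (simp add: y_def)
    show "norm (p - \<zeta>) \<le> norm \<zeta> / 2" by (rule p(1))
    fix y' assume y': "y' \<in> cball y (min (R / 16) (r / 2))"
    have d: "norm (y' - y) \<le> R / 16" "norm (y' - y) \<le> r / 2" using y' by (auto simp: dist_norm norm_minus_commute)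
    have y'x: "y' \<in> cball x (R / 2)"
      using d(1) y dist_triangle[of x y' y] RM by (simp add: dist_norm norm_minus_commute)
    \<comment> \<open>Competitor ending at the given y': run the reversed control from y' and
      reverse the result. \<open>Z\<close> then uses the same control \<open>u\<close> as
      \<open>Y\<close>, so the transport estimate applies, and its starting point tests the
      subgradient inequality at \<open>z\<close>.\<close>
    have v: "traj f (\<lambda>r. - u (s - r)) s (\<lambda>r. Y (s - r))" by (rule traj_reverse[OF Ys s(1)])
    have "(\<lambda>r. - u (s - r)) integrable_on {0..s}" "\<And>r. r \<in> {0..s} \<Longrightarrow> norm (- u (s - r)) \<le> 1"
      using v unfolding traj_def by blast+
    moreover have Ms2: "M * s < R / 2" using Ms RM by simp
    ultimately obtain W where W: "traj f (\<lambda>r. - u (s - r)) s W" "W 0 = y'"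
      using traj_exists[OF smooth lb s(1) Ls _ y'x, of "\<lambda>r. - u (s - r)"] by blast
    define Z where "Z r = W (s - r)" for r
    have Z: "traj f u s Z" using traj_reverse[OF W(1) s(1)] by (simp add: Z_def[abs_def])
    have ZR: "Z r \<in> cball x R" if "r \<in> {0..s}" for r
      unfolding Z_def by (rule traj_stays[OF lb W(1) _ Ms2]) (use that W(2) y'x in auto)
    have Zs: "Z s = y'" using W(2) by (simp add: Z_def)
    have "norm (Z 0 - Y 0) \<le> 2 * norm (Z s - Y s)"
      by (rule traj_dependence(2)[OF lb Ys Z Ls YR ZR]) (use s in auto)
    then have zz: "norm (Z 0 - z) \<le> 2 * norm (y' - y)" using Zs Y(3) by (simp add: y_def)
    have "Z 0 \<in> cball z r" using zz d(2) by (simp add: dist_norm norm_minus_commute)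
    then have "T z + \<zeta> \<bullet> (Z 0 - z) - \<sigma> * (norm (Z 0 - z))\<^sup>2 \<le> T (Z 0)"
      using sg unfolding proximal_subgradient_def by blast
    \<comment> \<open>The starting points differ by at most twice the distance of the endpoints;
      hence the coefficient 4 * \<sigma> and the radius r / 2 in the conclusion.\<close>
    moreover have "(norm (Z 0 - z))\<^sup>2 \<le> (2 * norm (y' - y))\<^sup>2" using zz by (rule power_mono) simp
    then have "\<sigma> * (norm (Z 0 - z))\<^sup>2 \<le> \<sigma> * (4 * (norm (y' - y))\<^sup>2)"
      using sg unfolding proximal_subgradient_def by (intro mult_left_mono) (auto simp: power_mult_distrib)
    moreover have "T (Z 0) \<le> s + T y'"
      using triangle[OF traj_reach[OF Z, of 0 s]] s Zs by simp
    moreover have "\<bar>p \<bullet> (y' - y) - \<zeta> \<bullet> (Z 0 - z)\<bar> \<le> 8 * norm \<zeta> * (norm (y' - y))\<^sup>2"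
      using p(2)[OF Z ZR] Zs Y(3) by (simp add: y_def)
    ultimately show "\<tau>' - e + p \<bullet> (y' - y) - (8 * norm \<zeta> + 4 * \<sigma>) * (norm (y' - y))\<^sup>2 \<le> T y'"
      using s_le by (simp add: algebra_simps abs_le_iff)
  qed (rule y)
qed

text \<open>Follow the constant control \<open>v\<close> from \<open>y\<close> for time
  \<open>s\<close>. Reversibility bounds the growth of \<open>T\<close> by \<open>s\<close>, while
  the inequality forces growth of about s * (p \<bullet> control_field f v y). The defect
  \<open>e\<close> and the total second-order error are each at most \<open>s\<close>, so division
  by \<open>s\<close> leaves 1 + 1 + 1.\<close>

lemma subgradient_hamiltonian_bound:
  assumes lb: "local_bounds f x R M L" and y: "y \<in> cball x (R / 4)" and "0 < \<rho>" "\<rho> \<le> R / 16"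
    and s: "0 < s" "M * s \<le> \<rho>" "L * s \<le> 1 / 4" "(B * L * M + \<sigma> * M\<^sup>2) * s \<le> 1"
    and e: "e \<le> s" and pB: "norm p \<le> B" and "0 \<le> \<sigma>"
    and ineq: "\<And>y'. y' \<in> cball y \<rho> \<Longrightarrow> T y - e + p \<bullet> (y' - y) - \<sigma> * (norm (y' - y))\<^sup>2 \<le> T y'"
    and v: "norm v \<le> 1"
  shows "p \<bullet> control_field f v y \<le> 3"
proof -
  have RM: "R > 0" "M > 0" "L > 0" using lb by (auto simp: local_bounds_def)
  have Ms: "M * s < R / 2" using s(2) \<open>\<rho> \<le> R / 16\<close> RM by simp
  have y2: "y \<in> cball x (R / 2)" using y RM by simp
  obtain Y where Y: "traj f (\<lambda>_. v) s Y" "Y 0 = y"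
    by (rule traj_exists[OF smooth lb _ s(3) Ms y2, of "\<lambda>_. v"]) (use s v in auto)
  have YR: "Y r \<in> cball x R" if "r \<in> {0..s}" for r
    by (rule traj_stays[OF lb Y(1) _ Ms that]) (use Y y2 in auto)
  define y' where "y' = Y s"
  have speed: "norm (Y r - y) \<le> M * s" if r: "r \<in> {0..s}" for r
  proof -
    have "norm (Y r - Y 0) \<le> M * \<bar>r - 0\<bar>" by (rule traj_speed[OF lb Y(1) YR]) (use s r in auto)
    also have "\<dots> \<le> M * s" using r RM by simp
    finally show ?thesis using Y(2) by simp
  qed
  have d: "norm (y' - y) \<le> M * s" using speed[of s] s by (simp add: y'_def)
  have "((\<lambda>r. control_field f v (Y r)) has_integral (y' - y)) {0..s}"
    using Y s by (auto simp: traj_def y'_def)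
  moreover have "((\<lambda>r. control_field f v y) has_integral s *\<^sub>R control_field f v y) {0..s}"
    using has_integral_const_real[of "control_field f v y" 0 s] s by simp
  ultimately have int: "((\<lambda>r. control_field f v (Y r) - control_field f v y) has_integral (y' - y - s *\<^sub>R control_field f v y)) {0..s}"
    by (rule has_integral_diff)
  have yR: "y \<in> cball x R" using y RM by simp
  have "norm (y' - y - s *\<^sub>R control_field f v y) \<le> L * (M * s) * measure lborel {0..s}"
  proof (rule has_integral_bound_real[OF _ finite.emptyI int])
    fix r assume "r \<in> {0..s} - {}"
    then have r: "r \<in> {0..s}" by simp
    have "norm (control_field f v (Y r) - control_field f v y) \<le> L * norm (Y r - y)"
      using lb v YR[OF r] yR unfolding local_bounds_def by blast
    also have "\<dots> \<le> L * (M * s)" using speed[OF r] RM by (intro mult_left_mono) auto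
    finally show "norm (control_field f v (Y r) - control_field f v y) \<le> L * (M * s)" .
  qed (use RM s in simp)
  then have lin: "norm (y' - y - s *\<^sub>R control_field f v y) \<le> L * M * s\<^sup>2"
    using s by (simp add: power2_eq_square mult_ac)
  have "\<bar>p \<bullet> (y' - y - s *\<^sub>R control_field f v y)\<bar> \<le> norm p * norm (y' - y - s *\<^sub>R control_field f v y)"
    by (rule Cauchy_Schwarz_ineq2)
  also have "\<dots> \<le> B * (L * M * s\<^sup>2)"
    using pB lin order_trans[OF norm_ge_zero pB] by (intro mult_mono) auto
  finally have 1: "\<bar>p \<bullet> (y' - y) - s * (p \<bullet> control_field f v y)\<bar> \<le> B * (L * M * s\<^sup>2)"
    by (simp add: inner_diff_right)
  have "(norm (y' - y))\<^sup>2 \<le> (M * s)\<^sup>2" using d by (rule power_mono) simp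
  then have 2: "\<sigma> * (norm (y' - y))\<^sup>2 \<le> \<sigma> * (M * s)\<^sup>2" using \<open>0 \<le> \<sigma>\<close> by (rule mult_left_mono)
  have "y' \<in> cball y \<rho>" using d s(2) by (simp add: dist_norm norm_minus_commute)
  then have 3: "T y - e + p \<bullet> (y' - y) - \<sigma> * (norm (y' - y))\<^sup>2 \<le> T y'" by (rule ineq)
  have 4: "T y' \<le> s + T y"
    using triangle[OF reach_sym[OF traj_reach[OF Y(1), of 0 s]]] s Y(2) by (simp add: y'_def)
  have "s * (p \<bullet> control_field f v y) \<le> s + e + B * (L * M * s\<^sup>2) + \<sigma> * (M * s)\<^sup>2"
    using 1 2 3 4 by (simp add: abs_le_iff)
  also have "\<dots> \<le> s + s + ((B * L * M + \<sigma> * M\<^sup>2) * s) * s"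
    using e by (simp add: power2_eq_square algebra_simps)
  also have "\<dots> \<le> s + s + 1 * s" using s by (intro add_left_mono mult_right_mono) auto
  finally have "s * (p \<bullet> control_field f v y) \<le> s * 3" by simp
  then show ?thesis using s(1) by (simp only: mult_le_cancel_left_pos)
qed

text \<open>Maximise the linear form \<open>p\<close> with quadratic penalty 2 * \<sigma> over the
  sublevel set near \<open>y\<close>; the gradient of this objective at the maximiser
  \<open>w\<close> is a proximal normal. The given inequality has the smaller coefficient \<sigma>,
  and the margin \<sigma> traps \<open>w\<close> at squared distance at most e / \<sigma> from
  \<open>y\<close>.\<close>

lemma level_set_proximal_normal:
  assumes "0 < \<rho>" and "0 < \<sigma>" and \<tau>: "T y = \<tau>" and e: "0 < e" "16 * e < \<sigma> * \<rho>\<^sup>2"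
    and ineq: "\<And>y'. y' \<in> cball y \<rho> \<Longrightarrow> \<tau> - e + p \<bullet> (y' - y) - \<sigma> * (norm (y' - y))\<^sup>2 \<le> T y'"
  obtains w q where "T w \<le> \<tau>" "\<sigma> * (norm (w - y))\<^sup>2 \<le> e" "norm (q - p) = 4 * \<sigma> * norm (w - y)"
    "q \<in> proximal_normal_cone {y. T y \<le> \<tau>} w"
proof -
  let ?S = "{y. T y \<le> \<tau>} \<inter> cball y \<rho>"
  let ?g = "\<lambda>y'. p \<bullet> (y' - y) - 2 * \<sigma> * (norm (y' - y))\<^sup>2"
  have "closed {y. T y \<le> \<tau>}" using closed_Collect_le[OF cont continuous_on_const, of \<tau>] by simp
  then have "compact ?S" by (intro closed_Int_compact compact_cball)
  moreover have yS: "y \<in> ?S" using \<tau> \<open>0 < \<rho>\<close> by simp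
  moreover have "continuous_on ?S ?g" by (intro continuous_intros)
  ultimately have "\<exists>w\<in>?S. \<forall>y'\<in>?S. ?g y' \<le> ?g w" by (intro continuous_attains_sup) auto
  then obtain w where w: "w \<in> ?S" "\<And>y'. y' \<in> ?S \<Longrightarrow> ?g y' \<le> ?g w" by blast
  have "0 \<le> ?g w" using w(2)[OF yS] by simp
  moreover have "\<tau> - e + p \<bullet> (w - y) - \<sigma> * (norm (w - y))\<^sup>2 \<le> \<tau>" using ineq[of w] w(1) by force
  ultimately have we: "\<sigma> * (norm (w - y))\<^sup>2 \<le> e" by (simp add: algebra_simps)
  \<comment> \<open>The smallness of \<open>e\<close> keeps \<open>w\<close> in the inner quarter of
    the ball. Points outside the ball are then at least \<rho> / 4 from \<open>w\<close>, and for
    them Cauchy-Schwarz alone gives a quadratic bound, as the normal cone condition is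
    global.\<close>
  have wy: "norm (w - y) < \<rho> / 4"
  proof (rule ccontr)
    assume "\<not> norm (w - y) < \<rho> / 4"
    then have "(\<rho> / 4)\<^sup>2 \<le> (norm (w - y))\<^sup>2" using \<open>0 < \<rho>\<close> by (intro power_mono) auto
    then have "\<sigma> * (\<rho> / 4)\<^sup>2 \<le> \<sigma> * (norm (w - y))\<^sup>2" using \<open>0 < \<sigma>\<close> by (intro mult_left_mono) auto
    then show False using we e by (simp add: power_divide)
  qed
  define q where "q = p - (4 * \<sigma>) *\<^sub>R (w - y)"
  have "q \<bullet> (y' - w) \<le> (2 * \<sigma> + 4 * norm q / \<rho>) * (norm (y' - w))\<^sup>2" if y': "T y' \<le> \<tau>" for y'
  proof (cases "y' \<in> cball y \<rho>")
    case True
    define I where "I = (y' - w) \<bullet> (w - y)"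
    have N: "(norm (y' - y))\<^sup>2 = (norm (y' - w))\<^sup>2 + 2 * I + (norm (w - y))\<^sup>2"
      by (simp add: I_def power2_norm_eq_inner inner_diff_left inner_diff_right inner_commute algebra_simps)
    have "?g y' \<le> ?g w" using w(2) True y' by blast
    then have "p \<bullet> (y' - y) - p \<bullet> (w - y) \<le> 2 * \<sigma> * (norm (y' - w))\<^sup>2 + 4 * \<sigma> * I"
      unfolding N by (simp add: distrib_left)
    moreover have "q \<bullet> (y' - w) = p \<bullet> (y' - y) - p \<bullet> (w - y) - 4 * \<sigma> * I"
      by (simp add: I_def q_def inner_diff_left inner_diff_right inner_commute algebra_simps)
    ultimately have "q \<bullet> (y' - w) \<le> 2 * \<sigma> * (norm (y' - w))\<^sup>2" by simp
    also have "\<dots> \<le> (2 * \<sigma> + 4 * norm q / \<rho>) * (norm (y' - w))\<^sup>2"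
      using \<open>0 < \<rho>\<close> by (intro mult_right_mono) auto
    finally show ?thesis .
  next
    case False
    then have "\<rho> < norm (y' - y)" by (simp add: dist_norm norm_minus_commute)
    then have far: "\<rho> / 4 \<le> norm (y' - w)" using wy norm_triangle_ineq[of "y' - w" "w - y"] \<open>0 < \<rho>\<close> by simp
    have "q \<bullet> (y' - w) \<le> norm q * norm (y' - w)" by (rule norm_cauchy_schwarz)
    also have "\<dots> = (4 * norm q / \<rho>) * ((\<rho> / 4) * norm (y' - w))" using \<open>0 < \<rho>\<close> by simp
    also have "\<dots> \<le> (4 * norm q / \<rho>) * (norm (y' - w) * norm (y' - w))"
      using far \<open>0 < \<rho>\<close> by (intro mult_left_mono mult_right_mono) auto
    also have "\<dots> \<le> (2 * \<sigma> + 4 * norm q / \<rho>) * (norm (y' - w))\<^sup>2"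
      unfolding power2_eq_square using \<open>0 < \<sigma>\<close> by (intro mult_right_mono) auto
    finally show ?thesis .
  qed
  moreover have "0 \<le> 2 * \<sigma> + 4 * norm q / \<rho>" using \<open>0 < \<sigma>\<close> \<open>0 < \<rho>\<close> by simp
  ultimately have "q \<in> proximal_normal_cone {y. T y \<le> \<tau>} w"
    unfolding proximal_normal_cone_def by blast
  moreover have "norm (q - p) = 4 * \<sigma> * norm (w - y)" using \<open>0 < \<sigma>\<close> by (simp add: q_def)
  ultimately show ?thesis using w(1) we that by blast
qed

text \<open>The bounds 3 and 1 do not depend on \<zeta>, \<sigma> or the radius, so they become
  negligible against norm \<zeta> when the latter tends to infinity.\<close>

lemma subgradient_to_level_set:
  assumes lb: "local_bounds f x R M L" and t1: "0 < t1" "L * t1 \<le> 1 / 4" "M * t1 < R / 8"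
    and z: "z \<in> cball x (R / 8)" and sg: "proximal_subgradient z \<zeta> \<sigma> r"
    and \<tau>': "0 \<le> \<tau>'" "\<tau>' \<le> T z" "T z - \<tau>' \<le> t1 / 2" and "0 < \<delta>"
  obtains y p w q where "T y = \<tau>'" "y \<in> cball x (R / 4)" "norm (p - \<zeta>) \<le> norm \<zeta> / 2"
    "\<And>v. norm v \<le> 1 \<Longrightarrow> p \<bullet> control_field f v y \<le> 3"
    "T w \<le> \<tau>'" "norm (w - y) \<le> \<delta>" "norm (q - p) \<le> 1" "q \<in> proximal_normal_cone {y. T y \<le> \<tau>'} w"
proof -
  have RM: "R > 0" "M > 0" "L > 0" using lb by (auto simp: local_bounds_def)
  have r: "r > 0" "\<sigma> \<ge> 0" using sg by (auto simp: proximal_subgradient_def)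
  define \<rho> where "\<rho> = min (R / 16) (r / 2)"
  have \<rho>: "0 < \<rho>" "\<rho> \<le> R / 16" using RM r by (auto simp: \<rho>_def)
  \<comment> \<open>The transported quadratic coefficient, raised by 1 so that S \<ge> 1 even when
    it vanishes.\<close>
  define S where "S = 8 * norm \<zeta> + 4 * \<sigma> + 1"
  have S: "S \<ge> 1" using r by (simp add: S_def)
  define B where "B = 2 * norm \<zeta>"
  define C where "C = B * L * M + S * M\<^sup>2 + 1"
  have C: "C > 0" unfolding C_def B_def using RM S by (intro add_nonneg_pos add_nonneg_nonneg mult_nonneg_nonneg) auto
  \<comment> \<open>The three terms provide the hypotheses of the Hamiltonian estimate: staying in
    the ball of radius \<rho>, the short-time condition, and the second-order error.\<close>
  define s where "s = min (\<rho> / M) (min (1 / (4 * L)) (1 / C))"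
  have s: "0 < s" using \<rho> RM C by (simp add: s_def)
  have "s \<le> \<rho> / M" "s \<le> 1 / (4 * L)" "s \<le> 1 / C" by (simp_all add: s_def)
  then have s2: "M * s \<le> \<rho>" "L * s \<le> 1 / 4" "C * s \<le> 1"
    using RM C by (simp_all add: field_simps)
  have s3: "(B * L * M + S * M\<^sup>2) * s \<le> 1" using s2(3) s unfolding C_def by (simp add: distrib_right)
  \<comment> \<open>In order: the Hamiltonian estimate, the time available for transport, the
    trapping condition of the level set step, the distance of \<open>w\<close> from
    \<open>y\<close>, and norm (q - p) \<le> 1. For the last one, the square of norm (q - p) is at
    most 16 * S * e.\<close>
  define e where "e = min (min s (t1 / 2)) (min (S * \<rho>\<^sup>2 / 32) (min (\<delta>\<^sup>2) (1 / (16 * S))))"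
  have e: "0 < e" "e \<le> s" "e \<le> t1 / 2" "e \<le> S * \<rho>\<^sup>2 / 32" "e \<le> \<delta>\<^sup>2" "e \<le> 1 / (16 * S)"
    using s t1 S \<rho> \<open>0 < \<delta>\<close> by (auto simp: e_def min_le_iff_disj)
  obtain y p where y: "T y = \<tau>'" "y \<in> cball x (R / 4)" and p: "norm (p - \<zeta>) \<le> norm \<zeta> / 2"
    and ineq0: "\<And>y'. y' \<in> cball y (min (R / 16) (r / 2)) \<Longrightarrow>
       \<tau>' - e + p \<bullet> (y' - y) - (8 * norm \<zeta> + 4 * \<sigma>) * (norm (y' - y))\<^sup>2 \<le> T y'"
    by (rule subgradient_transport[OF lb t1(2,3) z sg \<tau>'(1,2), of e]) (use e(1,3) \<tau>' that in auto)
  have ineq: "\<tau>' - e + p \<bullet> (y' - y) - S * (norm (y' - y))\<^sup>2 \<le> T y'" if "y' \<in> cball y \<rho>" for y'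
  proof -
    have "(8 * norm \<zeta> + 4 * \<sigma>) * (norm (y' - y))\<^sup>2 \<le> S * (norm (y' - y))\<^sup>2"
      by (intro mult_right_mono) (auto simp: S_def)
    then show ?thesis using ineq0[of y'] that by (simp add: \<rho>_def)
  qed
  have pB: "norm p \<le> B" using p norm_triangle_ineq[of "p - \<zeta>" \<zeta>] norm_ge_zero[of \<zeta>] unfolding B_def diff_add_cancel by linarith
  have H: "p \<bullet> control_field f v y \<le> 3" if "norm v \<le> 1" for v
    by (rule subgradient_hamiltonian_bound[OF lb y(2) \<rho> s s2(1,2) s3 e(2) pB _ _ that])
      (use ineq y(1) S in auto)
  have "16 * e < S * \<rho>\<^sup>2"
  proof -
    have "0 < S * \<rho>\<^sup>2" using S \<rho> by (intro mult_pos_pos) auto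
    then show ?thesis using e(4) by linarith
  qed
  then obtain w q where w: "T w \<le> \<tau>'" "S * (norm (w - y))\<^sup>2 \<le> e" "norm (q - p) = 4 * S * norm (w - y)"
    "q \<in> proximal_normal_cone {y. T y \<le> \<tau>'} w"
    using level_set_proximal_normal[OF \<rho>(1) _ y(1) e(1) _ ineq] S by auto
  have "(norm (w - y))\<^sup>2 \<le> S * (norm (w - y))\<^sup>2" using S mult_right_mono[of 1 S "(norm (w - y))\<^sup>2"] by simp
  then have "(norm (w - y))\<^sup>2 \<le> \<delta>\<^sup>2" using w(2) e(5) by linarith
  then have wd: "norm (w - y) \<le> \<delta>" using \<open>0 < \<delta>\<close> by (simp add: power2_le_iff_abs_le)
  have "(norm (q - p))\<^sup>2 = 16 * S * (S * (norm (w - y))\<^sup>2)" unfolding w(3) by (simp add: power2_eq_square)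
  also have "\<dots> \<le> 16 * S * (1 / (16 * S))" using w(2) e(6) S by (intro mult_left_mono) auto
  also have "\<dots> = 1\<^sup>2" using S by simp
  finally have "norm (q - p) \<le> 1" by (rule power2_le_imp_le) simp
  with y p H w(1) wd show ?thesis using w(4) by (rule that)
qed

text \<open>Divide by norm \<zeta>, which tends to infinity. The scaled \<open>p\<close> keep norms
  between 1 / 2 and 3 / 2, so a subsequence has a nonzero limit; the scaled Hamiltonian bound and
  the scaled distance of \<open>q\<close> from \<open>p\<close> tend to 0. The points
  \<open>y\<close> lie exactly on the level and fix \<open>T\<close> at the limit, while the nearby
  points \<open>w\<close> carry the proximal normals, all to the same sublevel set.\<close>

lemma unbounded_subgradients_imp_characteristic:
  assumes lb: "local_bounds f x R M L" and t1: "0 < t1" "L * t1 \<le> 1 / 4" "M * t1 < R / 8"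
    and "0 \<le> \<tau>'" and \<rho>: "\<And>z. z \<in> cball x \<rho> \<Longrightarrow> z \<in> cball x (R / 8) \<and> \<tau>' \<le> T z \<and> T z - \<tau>' \<le> t1 / 2"
    and unbounded: "\<And>m::nat. \<exists>z \<zeta> \<sigma> r. z \<in> cball x \<rho> \<and> proximal_subgradient z \<zeta> \<sigma> r \<and> real m \<le> norm \<zeta>"
  obtains w \<eta> where "w \<in> cball x (R / 4)" "T w = \<tau>'" "\<eta> \<noteq> 0" "\<And>i. f i w \<bullet> \<eta> = 0"
    "\<eta> \<in> limiting_normal_cone {y. T y \<le> \<tau>'} w"
proof -
  define good where "good m y p w q \<zeta> \<longleftrightarrow> real (Suc m) \<le> norm \<zeta> \<and> T y = \<tau>' \<and> y \<in> cball x (R / 4) \<and>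
    norm (p - \<zeta>) \<le> norm \<zeta> / 2 \<and> (\<forall>v. norm v \<le> 1 \<longrightarrow> p \<bullet> control_field f v y \<le> 3) \<and>
    T w \<le> \<tau>' \<and> norm (w - y) \<le> 1 / real (Suc m) \<and> norm (q - p) \<le> 1 \<and> q \<in> proximal_normal_cone {y. T y \<le> \<tau>'} w"
    for m y p w q \<zeta>
  have "\<exists>y p w q \<zeta>. good m y p w q \<zeta>" for m
  proof -
    obtain z \<zeta> \<sigma> r where z: "z \<in> cball x \<rho>" "proximal_subgradient z \<zeta> \<sigma> r" "real (Suc m) \<le> norm \<zeta>"
      using unbounded[of "Suc m"] by blast
    have "0 < 1 / real (Suc m)" by simp
    show ?thesis
    proof (rule subgradient_to_level_set[OF lb t1 _ z(2) \<open>0 \<le> \<tau>'\<close> _ _ \<open>0 < 1 / real (Suc m)\<close>])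
      fix y p w q
      assume "T y = \<tau>'" "y \<in> cball x (R / 4)" "norm (p - \<zeta>) \<le> norm \<zeta> / 2"
        "\<And>v. norm v \<le> 1 \<Longrightarrow> p \<bullet> control_field f v y \<le> 3" "T w \<le> \<tau>'"
        "norm (w - y) \<le> 1 / real (Suc m)" "norm (q - p) \<le> 1" "q \<in> proximal_normal_cone {y. T y \<le> \<tau>'} w"
      then have "good m y p w q \<zeta>" using z(3) unfolding good_def by blast
      then show ?thesis by blast
    qed (use \<rho>[OF z(1)] in auto)
  qed
  then have "\<forall>m. \<exists>Q. case Q of (y, p, w, q, \<zeta>) \<Rightarrow> good m y p w q \<zeta>" by simp
  from choice[OF this] obtain Q where Q: "\<forall>m. case Q m of (y, p, w, q, \<zeta>) \<Rightarrow> good m y p w q \<zeta>" ..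
  define y where "y m = fst (Q m)" for m
  define p where "p m = fst (snd (Q m))" for m
  define w where "w m = fst (snd (snd (Q m)))" for m
  define q where "q m = fst (snd (snd (snd (Q m))))" for m
  define \<zeta> where "\<zeta> m = snd (snd (snd (snd (Q m))))" for m
  have P: "real (Suc m) \<le> norm (\<zeta> m)" "T (y m) = \<tau>'" "y m \<in> cball x (R / 4)" "norm (p m - \<zeta> m) \<le> norm (\<zeta> m) / 2"
    "\<And>v. norm v \<le> 1 \<Longrightarrow> p m \<bullet> control_field f v (y m) \<le> 3"
    "T (w m) \<le> \<tau>'" "norm (w m - y m) \<le> 1 / real (Suc m)" "norm (q m - p m) \<le> 1"
    "q m \<in> proximal_normal_cone {y. T y \<le> \<tau>'} (w m)" for m
    using Q[rule_format, of m] unfolding y_def p_def w_def q_def \<zeta>_def good_def by (auto simp: case_prod_unfold)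
  have \<zeta>pos: "0 < norm (\<zeta> m)" "1 \<le> norm (\<zeta> m)" for m using P(1)[of m] by auto
  define \<theta> where "\<theta> m = 1 / norm (\<zeta> m)" for m
  have \<theta>: "0 < \<theta> m" "\<theta> m \<le> 1 / real (Suc m)" for m
    using \<zeta>pos[of m] P(1)[of m] by (auto simp: \<theta>_def intro!: divide_left_mono)
  have inv_lim: "(\<lambda>m. 1 / real (Suc m)) \<longlonglongrightarrow> 0" using LIMSEQ_inverse_real_of_nat by (simp add: inverse_eq_divide)
  have \<theta>lim: "\<theta> \<longlonglongrightarrow> 0"
    by (rule tendsto_sandwich[OF _ _ tendsto_const inv_lim]) (use \<theta> in \<open>auto intro!: always_eventually less_imp_le\<close>)
  have pb: "norm (\<theta> m *\<^sub>R p m) \<le> 3 / 2" "1 / 2 \<le> norm (\<theta> m *\<^sub>R p m)" for m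
  proof -
    have "norm (p m) \<le> norm (\<zeta> m) + norm (\<zeta> m) / 2" "norm (\<zeta> m) / 2 \<le> norm (p m)"
      using P(4)[of m] norm_triangle_ineq[of "p m - \<zeta> m" "\<zeta> m"] norm_triangle_ineq2[of "\<zeta> m" "\<zeta> m - p m"]
      by (auto simp: norm_minus_commute)
    then show "norm (\<theta> m *\<^sub>R p m) \<le> 3 / 2" "1 / 2 \<le> norm (\<theta> m *\<^sub>R p m)"
      using \<zeta>pos[of m] by (auto simp: \<theta>_def field_simps)
  qed
  have "compact (cball x (R / 4) \<times> cball (0 :: real ^ 'n) (3 / 2))" by (intro compact_Times compact_cball)
  moreover have "\<forall>m. (y m, \<theta> m *\<^sub>R p m) \<in> cball x (R / 4) \<times> cball 0 (3 / 2)" using P(3) pb by simp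
  ultimately obtain l h where l: "l \<in> cball x (R / 4) \<times> cball (0 :: real ^ 'n) (3 / 2)" "strict_mono (h :: nat \<Rightarrow> nat)"
    "((\<lambda>m. (y m, \<theta> m *\<^sub>R p m)) \<circ> h) \<longlonglongrightarrow> l"
    unfolding compact_eq_seq_compact_metric seq_compact_def by meson
  define w0 where "w0 = fst l"
  define \<eta> where "\<eta> = snd l"
  have ylim: "(\<lambda>m. y (h m)) \<longlonglongrightarrow> w0" and plim: "(\<lambda>m. \<theta> (h m) *\<^sub>R p (h m)) \<longlonglongrightarrow> \<eta>"
    using tendsto_fst[OF l(3)] tendsto_snd[OF l(3)] by (simp_all add: o_def w0_def \<eta>_def)
  have sub: "(\<lambda>m. a (h m)) \<longlonglongrightarrow> b" if "a \<longlonglongrightarrow> b" for a and b :: "'z::topological_space"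
    using LIMSEQ_subseq_LIMSEQ[OF that l(2)] by (simp add: o_def)
  have "(\<lambda>m. w m - y m) \<longlonglongrightarrow> 0"
    by (rule Lim_null_comparison[OF _ inv_lim]) (use P(7) in \<open>auto intro!: always_eventually\<close>)
  from tendsto_add[OF sub[OF this] ylim] have wlim: "(\<lambda>m. w (h m)) \<longlonglongrightarrow> w0" by simp
  have "(\<lambda>m. \<theta> m *\<^sub>R (q m - p m)) \<longlonglongrightarrow> 0"
  proof (rule Lim_null_comparison[OF _ \<theta>lim], intro always_eventually allI)
    show "norm (\<theta> m *\<^sub>R (q m - p m)) \<le> \<theta> m" for m
      using mult_left_mono[OF P(8)[of m], of "\<theta> m"] \<theta>(1)[of m] by simp
  qed
  from tendsto_add[OF sub[OF this] plim] have qlim: "(\<lambda>m. \<theta> (h m) *\<^sub>R q (h m)) \<longlonglongrightarrow> \<eta>"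
    by (simp add: scaleR_diff_right)
  have Tw: "T w0 = \<tau>'"
  proof -
    have "(\<lambda>m. T (y (h m))) \<longlonglongrightarrow> T w0"
      by (rule continuous_on_tendsto_compose[OF cont ylim]) auto
    then show ?thesis using P(2) by (simp add: LIMSEQ_const_iff)
  qed
  have \<eta>0: "\<eta> \<noteq> 0"
  proof -
    have "1 / 2 \<le> norm \<eta>"
      by (rule tendsto_lowerbound[OF tendsto_norm[OF plim]]) (use pb in auto)
    then show ?thesis by auto
  qed
  have "f i w0 \<bullet> \<eta> = 0" for i
  proof -
    have ax: "control_field f (s *\<^sub>R axis i 1) z = s *\<^sub>R f i z" for s z
    proof -
      have "control_field f (s *\<^sub>R axis i 1) z = (\<Sum>j\<in>UNIV. if j = i then s *\<^sub>R f i z else 0)"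
        unfolding control_field_def by (intro sum.cong) (auto simp: axis_def)
      then show ?thesis by simp
    qed
    \<comment> \<open>The coordinate control and its negative turn the one-sided bound into one on
      the absolute value.\<close>
    have "\<bar>p m \<bullet> f i (y m)\<bar> \<le> 3" for m
      using P(5)[of "1 *\<^sub>R axis i 1" m] P(5)[of "(- 1) *\<^sub>R axis i 1" m] by (simp only: ax) (simp add: norm_axis_1)
    then have bd: "norm (f i (y m) \<bullet> (\<theta> m *\<^sub>R p m)) \<le> 3 * \<theta> m" for m
      using \<theta>(1)[of m] by (simp add: inner_commute abs_mult mult.commute)
    have lim3: "(\<lambda>m. 3 * \<theta> m) \<longlonglongrightarrow> 0" by (rule tendsto_mult_right_zero[OF \<theta>lim])
    have "(\<lambda>m. f i (y m) \<bullet> (\<theta> m *\<^sub>R p m)) \<longlonglongrightarrow> 0"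
      by (rule Lim_null_comparison[OF always_eventually lim3]) (rule allI, rule bd)
    from sub[OF this] have 0: "(\<lambda>m. f i (y (h m)) \<bullet> (\<theta> (h m) *\<^sub>R p (h m))) \<longlonglongrightarrow> 0" .
    have "(\<lambda>m. f i (y (h m))) \<longlonglongrightarrow> f i w0"
      by (rule continuous_on_tendsto_compose[OF C_infinity_continuous[OF smooth] ylim, of UNIV]) auto
    from tendsto_inner[OF this plim] show ?thesis by (rule LIMSEQ_unique[OF _ 0])
  qed
  moreover have "\<eta> \<in> limiting_normal_cone {y. T y \<le> \<tau>'} w0"
  proof -
    have "w (h m) \<in> {y. T y \<le> \<tau>'}" for m using P(6) by simp
    moreover have "\<theta> (h m) *\<^sub>R q (h m) \<in> proximal_normal_cone {y. T y \<le> \<tau>'} (w (h m))" for m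
    proof -
      obtain s where s: "0 \<le> s" "\<And>y'. T y' \<le> \<tau>' \<Longrightarrow> q (h m) \<bullet> (y' - w (h m)) \<le> s * (norm (y' - w (h m)))\<^sup>2"
        using P(9)[of "h m"] unfolding proximal_normal_cone_def by blast
      have "(\<theta> (h m) *\<^sub>R q (h m)) \<bullet> (y' - w (h m)) \<le> (\<theta> (h m) * s) * (norm (y' - w (h m)))\<^sup>2" if "T y' \<le> \<tau>'" for y'
        using mult_left_mono[OF s(2)[OF that], of "\<theta> (h m)"] \<theta>(1)[of "h m"] by (simp add: mult.assoc)
      moreover have "0 \<le> \<theta> (h m) * s" using s(1) \<theta>(1)[of "h m"] by simp
      ultimately show ?thesis unfolding proximal_normal_cone_def by blast
    qed
    ultimately show ?thesis
      unfolding limiting_normal_cone_def using wlim qlim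
      by (intro CollectI exI[of _ "\<lambda>m. w (h m)"] exI[of _ "\<lambda>m. \<theta> (h m) *\<^sub>R q (h m)"]) simp
  qed
  moreover have "w0 \<in> cball x (R / 4)" using l(1) by (auto simp: w0_def)
  ultimately show ?thesis using Tw \<eta>0 by (intro that[of w0 \<eta>])
qed

section \<open>Lipschitz continuity from bounded subgradients\<close>

lemma norm_above_quadratic:
  fixes y w b :: "'a::real_inner"
  assumes "w \<noteq> b"
  shows "norm (y - b) \<le> norm (w - b) + ((1 / norm (w - b)) *\<^sub>R (w - b)) \<bullet> (y - w) + (norm (y - w))\<^sup>2 / (2 * norm (w - b))"
proof -
  let ?D = "norm (w - b)"
  have D: "?D > 0" using assms by simp
  \<comment> \<open>Expanding this square puts the norm below a parabola with the slope of the norm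
    at \<open>w\<close>. Such an upper bound is what turns a minimiser of \<open>T\<close> plus a
    multiple of the norm into a proximal subgradient of \<open>T\<close>.\<close>
  have "0 \<le> (norm (y - b) - ?D)\<^sup>2" by simp
  then have "2 * ?D * norm (y - b) \<le> (norm (y - b))\<^sup>2 + ?D\<^sup>2" by (simp add: power2_diff algebra_simps)
  also have "(norm (y - b))\<^sup>2 = ?D\<^sup>2 + 2 * ((w - b) \<bullet> (y - w)) + (norm (y - w))\<^sup>2"
    by (simp add: power2_norm_eq_inner inner_diff_left inner_diff_right inner_commute algebra_simps)
  finally have "norm (y - b) \<le> (2 * ?D\<^sup>2 + 2 * ((w - b) \<bullet> (y - w)) + (norm (y - w))\<^sup>2) / (2 * ?D)"
    using D by (simp add: pos_le_divide_eq mult.commute)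
  also have "\<dots> = ?D + (1 / ?D) * ((w - b) \<bullet> (y - w)) + (norm (y - w))\<^sup>2 / (2 * ?D)"
    using D by (simp add: add_divide_distrib power2_eq_square)
  finally show ?thesis by simp
qed

text \<open>If T b - T a exceeds C * norm (a - b), then \<open>T\<close> plus the cone of slope
  \<open>C\<close> with vertex \<open>b\<close> is minimal at some w \<noteq> b, and
  \<open>w\<close> is close to \<open>b\<close> because \<open>T\<close> is bounded on the ball.
  Away from its vertex the cone is smooth, so \<open>w\<close> carries a proximal subgradient of
  norm \<open>C\<close>, which the bound excludes.\<close>

lemma bounded_subgradients_imp_lipschitz:
  assumes "0 < \<rho>" and bounded: "\<And>z \<zeta> \<sigma> r. z \<in> cball x \<rho> \<Longrightarrow> proximal_subgradient z \<zeta> \<sigma> r \<Longrightarrow> norm \<zeta> < B"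
  obtains C where "C-lipschitz_on (ball x (\<rho> / 2)) T"
proof -
  have cT: "continuous_on (cball x \<rho>) T" using cont continuous_on_subset by blast
  have "bounded (T ` cball x \<rho>)" by (intro compact_imp_bounded compact_continuous_image cT compact_cball)
  then obtain A where A: "A > 0" "\<forall>a\<in>T ` cball x \<rho>. norm a \<le> A" unfolding bounded_pos by (elim exE conjE)
  have TA: "T a \<le> A" if "a \<in> cball x \<rho>" for a using A(2) that by force
  \<comment> \<open>C \<ge> B contradicts the bound on subgradients, and A < C * (\<rho> / 4)
    confines the minimiser, as \<open>T\<close> lies between 0 and \<open>A\<close> on the
    ball.\<close>
  define C where "C = max B (4 * A / \<rho> + 1)"
  have C: "B \<le> C" "0 < C" "A < C * (\<rho> / 4)"
  proof -
    have "(4 * A / \<rho> + 1) * (\<rho> / 4) \<le> C * (\<rho> / 4)" unfolding C_def using \<open>0 < \<rho>\<close> by (intro mult_right_mono) auto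
    moreover have "(4 * A / \<rho> + 1) * (\<rho> / 4) = A + \<rho> / 4" using \<open>0 < \<rho>\<close> by (simp add: field_simps)
    ultimately have "A + \<rho> / 4 \<le> C * (\<rho> / 4)" by (simp only:)
    then show "A < C * (\<rho> / 4)" using \<open>0 < \<rho>\<close> by linarith
    have "0 < 4 * A / \<rho> + 1" using A(1) \<open>0 < \<rho>\<close> by (intro add_pos_pos) auto
    then show "0 < C" unfolding C_def by linarith
  qed (simp add: C_def)
  have main: "T b - T a \<le> C * norm (a - b)" if ab: "a \<in> ball x (\<rho> / 2)" "b \<in> ball x (\<rho> / 2)" for a b
  proof (rule ccontr)
    assume "\<not> T b - T a \<le> C * norm (a - b)"
    then have less: "T a + C * norm (a - b) < T b" by simp
    have abx: "a \<in> cball x \<rho>" "b \<in> cball x \<rho>" using ab \<open>0 < \<rho>\<close> by auto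
    have "\<exists>w\<in>cball x \<rho>. \<forall>y\<in>cball x \<rho>. T w + C * norm (w - b) \<le> T y + C * norm (y - b)"
      by (rule continuous_attains_inf) (use \<open>0 < \<rho>\<close> cT in \<open>auto intro!: continuous_intros\<close>)
    then obtain w where w: "w \<in> cball x \<rho>" "\<And>y. y \<in> cball x \<rho> \<Longrightarrow> T w + C * norm (w - b) \<le> T y + C * norm (y - b)" by blast
    have wb: "T w + C * norm (w - b) < T b" using w(2)[OF abx(1)] less by simp
    then have "w \<noteq> b" by auto
    have close: "norm (w - b) < \<rho> / 4"
    proof (rule ccontr)
      assume "\<not> norm (w - b) < \<rho> / 4"
      then have "C * (\<rho> / 4) \<le> C * norm (w - b)" using C(2) by (intro mult_left_mono) auto
      then show False using wb nonneg[of w] TA[OF abx(2)] C(3) by linarith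
    qed
    define n where "n = (1 / norm (w - b)) *\<^sub>R (w - b)"
    have "proximal_subgradient w (- C *\<^sub>R n) (C / (2 * norm (w - b))) (\<rho> / 4)"
      unfolding proximal_subgradient_def
    proof (intro conjI ballI)
      fix y assume y: "y \<in> cball w (\<rho> / 4)"
      have "dist x y \<le> dist x b + dist b w + dist w y" using dist_triangle[of x y w] dist_triangle[of x w b] by simp
      also have "\<dots> \<le> \<rho>" using y close ab(2) by (simp add: dist_norm norm_minus_commute)
      finally have "T w + C * norm (w - b) \<le> T y + C * norm (y - b)" by (intro w(2)) simp
      also have "C * norm (y - b) \<le> C * (norm (w - b) + n \<bullet> (y - w) + (norm (y - w))\<^sup>2 / (2 * norm (w - b)))"
        unfolding n_def using norm_above_quadratic[OF \<open>w \<noteq> b\<close>, of y] C(2) by (intro mult_left_mono) auto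
      finally show "T w + (- C *\<^sub>R n) \<bullet> (y - w) - C / (2 * norm (w - b)) * (norm (y - w))\<^sup>2 \<le> T y"
        by (simp add: algebra_simps)
    qed (use \<open>0 < \<rho>\<close> C(2) in auto)
    then have "norm (- C *\<^sub>R n) < B" by (rule bounded[OF w(1)])
    moreover have "norm (- C *\<^sub>R n) = C" using \<open>w \<noteq> b\<close> C(2) by (simp add: n_def)
    ultimately show False using C(1) by simp
  qed
  have "C-lipschitz_on (ball x (\<rho> / 2)) T"
  proof (rule lipschitz_onI)
    fix a b assume "a \<in> ball x (\<rho> / 2)" "b \<in> ball x (\<rho> / 2)"
    then show "dist (T a) (T b) \<le> C * dist a b"
      using main[of a b] main[of b a] by (simp add: dist_norm norm_minus_commute abs_le_iff)
  qed (use C in simp)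
  then show ?thesis by (rule that)
qed

text \<open>The speed is bounded near \<open>x\<close>, so leaving a ball disjoint from
  \<open>K\<close> takes a definite time; nearly optimal trajectories from a point with T x = 0
  would be too short for that.\<close>

lemma positive_outside_target:
  assumes "closed K" "x \<notin> K" shows "0 < T x"
proof (rule ccontr)
  assume "\<not> 0 < T x"
  then have T0: "T x = 0" using nonneg[of x] by simp
  obtain R where R: "R > 0" "cball x R \<subseteq> - K"
    using assms open_contains_cball[of "- K"] by (auto simp: open_Compl)
  obtain M L where lb: "local_bounds f x R M L" by (rule local_bounds_exist[OF smooth R(1)])
  have M: "M > 0" using lb by (simp add: local_bounds_def)
  then have "R / (4 * M) > 0" using R by simp
  from near_optimal[OF this, of x] obtain t k where tk: "k \<in> K" "t < R / (4 * M)" "reach f t x k" using T0 by auto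
  obtain u Y where Y: "0 \<le> t" "traj f u t Y" "Y 0 = x" "Y t = k" using tk(3) by (auto simp: reach_def)
  have "M * t < M * (R / (4 * M))" using tk(2) M by (intro mult_strict_left_mono)
  then have Mt: "M * t < R / 2" using M R by simp
  have "Y t \<in> cball x R" by (rule traj_stays[OF lb Y(2) _ Mt]) (use Y R in auto)
  then show False using R(2) tk(1) Y(4) by blast
qed

text \<open>The characteristic point produced by unbounded subgradients lies near \<open>x\<close>
  on a lower level, not at \<open>x\<close> itself; hence the hypothesis on a whole open set and on
  all levels.\<close>

lemma lipschitz_near_noncharacteristic:
  assumes "closed K" "open U" "x \<in> U" "x \<notin> K"
    and nonchar: "\<And>w \<tau> \<eta>. w \<in> U \<Longrightarrow> 0 < \<tau> \<Longrightarrow> T w = \<tau> \<Longrightarrow> \<eta> \<noteq> 0 \<Longrightarrow>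
      \<eta> \<in> limiting_normal_cone {y. T y \<le> \<tau>} w \<Longrightarrow> \<exists>i. f i w \<bullet> \<eta> \<noteq> 0"
  obtains r C where "0 < r" "C-lipschitz_on (ball x r) T"
proof -
  obtain R where R: "R > 0" "cball x R \<subseteq> U" using assms open_contains_cball by blast
  obtain M L where lb: "local_bounds f x R M L" by (rule local_bounds_exist[OF smooth R(1)])
  have bounds_pos: "M > 0" "L > 0" using lb by (auto simp: local_bounds_def)
  define t1 where "t1 = min (1 / (4 * L)) (R / (16 * M))"
  have t1: "0 < t1" using bounds_pos R by (simp add: t1_def)
  have "t1 \<le> 1 / (4 * L)" "t1 \<le> R / (16 * M)" by (simp_all add: t1_def)
  then have "L * t1 \<le> L * (1 / (4 * L))" "M * t1 \<le> M * (R / (16 * M))"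
    using bounds_pos by (simp_all only: mult_left_mono less_imp_le)
  then have t1b: "L * t1 \<le> 1 / 4" "M * t1 < R / 8" using bounds_pos R by auto
  have \<tau>: "0 < T x" by (rule positive_outside_target[OF assms(1,4)])
  \<comment> \<open>The level used is T x - t. The bound T x / 2 keeps it positive, and T z < T x +
    t gives T z - (T x - t) < 2 * t \<le> t1 / 2 for \<open>z\<close> near \<open>x\<close>.\<close>
  define t where "t = min (T x / 2) (t1 / 4)"
  have t: "0 < t" "t \<le> T x / 2" "t \<le> t1 / 4" using \<tau> t1 by (auto simp: t_def)
  obtain d where d: "d > 0" "\<And>z. dist z x < d \<Longrightarrow> dist (T z) (T x) < t"
    using cont t(1) unfolding continuous_on_iff by blast
  define \<rho> where "\<rho> = min (R / 8) (d / 2)"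
  have \<rho>: "0 < \<rho>" using R d by (simp add: \<rho>_def)
  have \<rho>z: "z \<in> cball x (R / 8) \<and> T x - t \<le> T z \<and> T z - (T x - t) \<le> t1 / 2" if "z \<in> cball x \<rho>" for z
  proof -
    have "dist z x < d" "z \<in> cball x (R / 8)" using that d(1) by (auto simp: \<rho>_def dist_commute)
    then show ?thesis using d(2)[of z] t by (auto simp: dist_real_def abs_less_iff)
  qed
  have "\<exists>B. \<forall>z \<zeta> \<sigma> r. z \<in> cball x \<rho> \<longrightarrow> proximal_subgradient z \<zeta> \<sigma> r \<longrightarrow> norm \<zeta> < B"
  proof (rule ccontr)
    assume "\<not> ?thesis"
    then have unb: "\<exists>z \<zeta> \<sigma> r. z \<in> cball x \<rho> \<and> proximal_subgradient z \<zeta> \<sigma> r \<and> real m \<le> norm \<zeta>" for m :: nat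
      by (meson not_le)
    have pos: "0 \<le> T x - t" using t \<tau> by simp
    obtain w \<eta> where w: "w \<in> cball x (R / 4)" "T w = T x - t" "\<eta> \<noteq> 0" "\<And>i. f i w \<bullet> \<eta> = 0"
      "\<eta> \<in> limiting_normal_cone {y. T y \<le> T x - t} w"
      by (rule unbounded_subgradients_imp_characteristic[OF lb t1 t1b pos \<rho>z unb]; (assumption | rule that))
    have "w \<in> U" using w(1) R by auto
    moreover have "0 < T x - t" using t \<tau> by simp
    ultimately show False using nonchar[OF _ _ w(2,3,5)] w(4) by blast
  qed
  then obtain B where B: "\<And>z \<zeta> \<sigma> r. z \<in> cball x \<rho> \<Longrightarrow> proximal_subgradient z \<zeta> \<sigma> r \<Longrightarrow> norm \<zeta> < B" by blast
  obtain C where "C-lipschitz_on (ball x (\<rho> / 2)) T" by (rule bounded_subgradients_imp_lipschitz[OF \<rho> B])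
  moreover have "0 < \<rho> / 2" using \<rho> by simp
  ultimately show ?thesis using that by blast
qed

end

section \<open>The Lipschitz singular support lies in the exceptional set\<close>

theorem theorem3:
  fixes K :: "(real ^ 'n::finite) set"
    and f :: "'m::finite \<Rightarrow> 'n vector_field"
    and x0 :: "real ^ 'n" and \<epsilon> :: real and N :: "(real ^ 'n) set"
  assumes "CARD('n) \<ge> 2"
    and "closed K" and "K \<noteq> {}"
    and "\<And>i. C_infinity (f i)"
    and "hoermander_condition f"
    and "x0 \<notin> K"
    and "\<epsilon> > 0"
    and "closed N" and "N \<in> null_sets lebesgue"
    and "\<And>\<tau>. \<tau> > 0 \<Longrightarrow> ball x0 \<epsilon> \<inter> characteristic_points K f \<tau> \<subseteq> N"
  shows "sing_supp_Lip (- K) (minimum_time K f) \<inter> ball x0 \<epsilon> \<subseteq> N \<and>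
    sing_supp_Lip (- K) (minimum_time K f) \<inter> ball x0 \<epsilon> \<in> null_sets lebesgue"
proof -
  obtain T :: "real ^ 'n \<Rightarrow> real" where T: "\<And>x. minimum_time K f x = ennreal (T x)" "\<And>x. T x \<ge> 0"
    "continuous_on UNIV T" "\<And>s x y. reach f s x y \<Longrightarrow> T x \<le> s + T y"
    "\<And>x e. e > 0 \<Longrightarrow> \<exists>t k. k \<in> K \<and> t < T x + e \<and> reach f t x k"
    "\<And>k. k \<in> K \<Longrightarrow> T k = 0"
    by (rule minimum_time_real[of f K, OF assms(4,5,3)]) (assumption | rule that)+
  interpret value_function f K T
    by (rule value_function.intro[of f T K]) (rule assms(4) T(2-6), (assumption+)?)+
  have sub: "sing_supp_Lip (- K) (minimum_time K f) \<inter> ball x0 \<epsilon> \<subseteq> N"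
  proof (rule ccontr)
    assume "\<not> ?thesis"
    then obtain x where x: "x \<in> sing_supp_Lip (- K) (minimum_time K f)" "x \<in> ball x0 \<epsilon>" "x \<notin> N" by blast
    have "x \<notin> K"
      using closedin_imp_subset[OF sing_supp_Lip_least(1)] x(1) by blast
    \<comment> \<open>Removing the closed set \<open>N\<close> from the ball leaves an open set in
      which no positive level has a characteristic point.\<close>
    obtain r C where r: "0 < r" "C-lipschitz_on (ball x r) T"
    proof (rule lipschitz_near_noncharacteristic[OF assms(2), of "ball x0 \<epsilon> - N" x])
      show "open (ball x0 \<epsilon> - N)" using assms(8) by (intro open_Diff open_ball)
      show "\<exists>i. f i w \<bullet> \<eta> \<noteq> 0" if w: "w \<in> ball x0 \<epsilon> - N" "0 < \<tau>" "T w = \<tau>" "\<eta> \<noteq> 0"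
        "\<eta> \<in> limiting_normal_cone {y. T y \<le> \<tau>} w" for w \<tau> \<eta>
      proof (rule ccontr)
        assume "\<not> ?thesis"
        then have "hamiltonian f w \<eta> = 0" by (simp add: hamiltonian_def)
        moreover have "reachable_set K f \<tau> = {y. T y \<le> \<tau>}" using w(2) T(2) by (simp add: reachable_set_def T(1))
        moreover have "w \<notin> K" using w(2,3) target by force
        ultimately have "w \<in> characteristic_points K f \<tau>"
          using w by (auto simp: characteristic_points_def T(1))
        then show False using assms(10)[OF w(2)] w(1) by blast
      qed
    qed (use x \<open>x \<notin> K\<close> that in auto)
    \<comment> \<open>The complement of \<open>V\<close> in - K is relatively closed and the time is
      locally Lipschitz off it, so minimality of the singular support excludes \<open>x\<close>.
      \<open>K\<close> is cut out because the singular support is taken relative to - K.\<close>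
    define V where "V = ball x r - K"
    have V: "open V" "x \<in> V" "V \<subseteq> - K" using r(1) \<open>x \<notin> K\<close> assms(2) by (auto simp: V_def open_Diff)
    have "closedin (top_of_set (- K)) (- K - V)"
    proof -
      have "- K - V = - K \<inter> - V" by blast
      then show ?thesis using V(1) by (simp add: closedin_closed_Int closed_Compl)
    qed
    moreover have "locally_Lipschitz_on (- K - (- K - V)) (minimum_time K f)"
    proof -
      have "- K - (- K - V) = V" using V(3) by blast
      moreover have "C-lipschitz_on V (\<lambda>z. enn2real (minimum_time K f z))"
        using lipschitz_on_subset[OF r(2), of V] T(2) by (simp add: T(1) V_def)
      ultimately show ?thesis using V(1) T(1) unfolding locally_Lipschitz_on_def by (auto intro!: exI[of _ V])
    qed
    ultimately have "sing_supp_Lip (- K) (minimum_time K f) \<subseteq> - K - V" by (rule sing_supp_Lip_least(3))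
    then show False using x(1) V(2) by blast
  qed
  moreover have "sing_supp_Lip (- K) (minimum_time K f) \<inter> ball x0 \<epsilon> \<in> null_sets lebesgue"
    using negligible_subset[OF _ sub] assms(9) by (simp add: negligible_iff_null_sets)
  ultimately show ?thesis by blast
qed

end
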